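(* The 5-dimensional Cohn-Elkies linear programming bound (i.e., the Cohn-Elkies linear programming bound in $\mathbb{R}^5$) is greater than $0.09826308$.
   Context: Fourier transform on $\mathbb{R}^d$: $\widehat f(y)=\int_{\mathbb{R}^d} f(x)e^{-2\pi i\langle x,y\rangle}\,dx$, where $\langle x,y\rangle=x_1y_1+\cdots+x_dy_d$. A function $f:\mathbb{R}^d\to\mathbb{R}$ is rapidly decreasing if $f(x)=O\left((1+|x|)^{-k}\right)$ for all positive integers $k$; it is radial if $f(x)$ depends only on $|x|$. For fixed $r>0$ and positive integer $d$, the Cohn-Elkies linear programming bound in $\mathbb{R}^d$ is the infimum of $\left(\frac r2\right)^d f(0)$ over all radial, smooth, rapidly decreasing functions $f:\mathbb{R}^d\to\mathbb{R}$ such that $f(0)>0$; $\widehat f(0)\geq 1$; $f(x)\leq 0$ for all $|x|\geq r$; and $\widehat f(y)\geq 0$ for all $y\in\mathbb{R}^d$. This value does not depend on $r$ (by rescaling $f$). *)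

theory Defs
  imports "HOL-Analysis.Analysis" "HOL-Library.Complex_Order"
begin

definition fourier :: "(real ^ 'n::finite \<Rightarrow> complex) \<Rightarrow> real ^ 'n \<Rightarrow> complex" where
  "fourier f y = (LINT x|lborel. f x * exp (- 2 * of_real pi * \<i> * of_real (x \<bullet> y)))"

text \<open>For \<open>C_diff (Suc k) f\<close>, all directional derivatives of \<open>f\<close> are required to be \<open>C_diff k\<close>;
  for constant directions \<open>v\<close> along the axes these are the partial derivatives.\<close>

primrec C_diff :: "nat \<Rightarrow> ('a::euclidean_space \<Rightarrow> real) \<Rightarrow> bool" where
  "C_diff 0 f \<longleftrightarrow> continuous_on UNIV f"
| "C_diff (Suc k) f \<longleftrightarrow>
     (\<forall>x. f differentiable at x) \<and> (\<forall>v. C_diff k (\<lambda>x. frechet_derivative f (at x) v))"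

definition smooth :: "('a::euclidean_space \<Rightarrow> real) \<Rightarrow> bool" where
  "smooth f \<longleftrightarrow> (\<forall>k. C_diff k f)"

text \<open>The implied constant is uniform over the whole space, not only for large \<open>norm x\<close>
  (no difference for continuous \<open>f\<close>).\<close>

definition rapidly_decreasing :: "('a::real_normed_vector \<Rightarrow> real) \<Rightarrow> bool" where
  "rapidly_decreasing f \<longleftrightarrow> (\<forall>k>0. \<exists>C. \<forall>x. \<bar>f x\<bar> \<le> C * inverse ((1 + norm x) ^ k))"

definition radial :: "('a::real_normed_vector \<Rightarrow> real) \<Rightarrow> bool" where
  "radial f \<longleftrightarrow> (\<forall>x y. norm x = norm y \<longrightarrow> f x = f y)"

text \<open>The Fourier transform is complex-valued; the comparisons \<open>1 \<le> fourier _ 0\<close> and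
  \<open>0 \<le> fourier _ y\<close> are in the order of \<open>HOL-Library.Complex_Order\<close>, so they include that the
  value is real (automatic here, since \<open>f\<close> is real-valued and radial).\<close>

definition cohn_elkies_admissible :: "real \<Rightarrow> (real ^ 'n::finite \<Rightarrow> real) \<Rightarrow> bool" where
  "cohn_elkies_admissible r f \<longleftrightarrow>
     radial f \<and> smooth f \<and> rapidly_decreasing f \<and>
     f 0 > 0 \<and>
     fourier (\<lambda>x. complex_of_real (f x)) 0 \<ge> 1 \<and>
     (\<forall>x. norm x \<ge> r \<longrightarrow> f x \<le> 0) \<and>
     (\<forall>y. fourier (\<lambda>x. complex_of_real (f x)) y \<ge> 0)"

text \<open>The dimension is \<open>CARD('n)\<close>. The infimum is taken in \<^typ>\<open>ereal\<close>, so that it is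
  meaningful without first knowing that admissible functions exist.\<close>

definition cohn_elkies_bound :: "'n::finite itself \<Rightarrow> real \<Rightarrow> ereal" where
  "cohn_elkies_bound _ r =
     (INF f \<in> {f :: real ^ 'n \<Rightarrow> real. cohn_elkies_admissible r f}. ereal ((r / 2) ^ CARD('n) * f 0))"

end

theory Submission
  imports Defs "HOL-Probability.Probability" "HOL-Computational_Algebra.Polynomial"
begin

text \<open>The bound is the value of a minimisation problem, so a lower bound needs a dual certificate. After
rescaling to \<open>r = 1\<close>, let \<open>g\<close> be a radial admissible function on \<open>\<real>\<^sup>5\<close>, up to its
normalisation. If \<open>\<mu>\<close> is a finite signed radial measure whose Fourier transform is nonnegative,
then \<open>\<integral> g d\<mu> \<ge> 0\<close>, because \<open>g\<close> also has a nonnegative transform. Take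
\<open>\<mu> = \<delta>\<^sub>0 + c\<^sub>1 \<sigma>\<^sub>1 + c\<^sub>2 \<sigma>\<^sub>s - h(|x|) 1[|x| < 1.53] dx\<close> with \<open>s = 1.48\<close>,
where \<open>\<sigma>\<^sub>s\<close> is the uniform probability measure on the sphere of radius \<open>s\<close> and \<open>h\<close> is
\<open>3 / (8 \<pi>\<^sup>2)\<close> times the function \<open>tail\<close>, a constant \<open>82.76\<close> plus positive multiples of
the transforms of two spheres. Since \<open>g \<le> 0\<close> on the two spheres, \<open>g(0) \<ge> \<integral> h g\<close> over the ball.
If \<open>h \<ge> 0\<close> outside the ball, where \<open>g \<le> 0\<close>, the integral over the ball is at least the
integral over the whole space; there the two sphere transforms contribute values of the transform of
\<open>g\<close>, which are nonnegative, so that \<open>g(0) \<ge> 82.76 * 3 / (8 \<pi>\<^sup>2) * \<integral> g\<close>. Dividing by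
\<open>2\<^sup>5\<close> gives \<open>0.0982657...\<close> (\<open>unit_scale_bound\<close>, \<open>admissible_lower_bound\<close>).

The pairing inequality is proved by smoothing: convolving \<open>g\<close> with a narrow Gaussian gives an
integral of sphere transforms with nonnegative weights, and the narrow Gaussian is then removed by
continuity (\<open>radial_positive_definite_pairing\<close>). Dimension five is convenient here because the
transform of a sphere is the elementary function \<open>3 (sin t - t cos t) / t\<^sup>3\<close>.

What remains are two inequalities in one real variable. That \<open>tail\<close> is nonnegative beyond
\<open>1.53\<close> follows from the signs of two cosines (\<open>tail_nonneg\<close>). The transform \<open>dual_ft\<close> of
\<open>\<mu>\<close> has a closed form (\<open>dual_ft_eq\<close>), from which it is positive for \<open>t \<ge> 22\<close> because all
terms except the \<open>1\<close> of \<open>\<delta>\<^sub>0\<close> decay. On \<open>[0, 22]\<close> its minimum is about \<open>0.0045\<close>, so crude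
estimates do not suffice. There \<open>dual_ft\<close> is compared with the quintic that interpolates it at six
neighbouring points of the grid \<open>(2 i + 1) / 5\<close>. As \<open>\<mu>\<close> lives on the ball of radius \<open>1.53\<close>, the
sixth derivative of its transform is under control and the interpolation error is at most
\<open>0.003305\<close> (\<open>dual_ft_interp_error\<close>). The grid values are computed to \<open>2 * 10 ^ (- 5)\<close> in integer
arithmetic (\<open>dual_table_correct\<close>), and the Bernstein coefficients of every interpolating quintic
turn out to exceed the error (\<open>dual_ft_nonneg_small\<close>). The weights, radii and frequencies in
\<open>\<mu>\<close> were found by numerical optimisation and rounded to short decimals.\<close>

section \<open>The Fourier transform of a sphere in dimension five\<close>

text \<open>The Fourier transform of the uniform probability measure on the unit sphere of \<open>\<real>\<^sup>5\<close>, as a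
function of the length of the frequency (with kernel \<open>cos (x \<bullet> y)\<close>, without the factor
\<open>2 \<pi>\<close>).\<close>
definition sphere_ft :: "real \<Rightarrow> real" where
  "sphere_ft t = (if t = 0 then 1 else 3 * (sin t - t * cos t) / t ^ 3)"

lemma sphere_ft_0 [simp]: "sphere_ft 0 = 1"
  by (simp add: sphere_ft_def)

lemma sphere_ft_minus [simp]: "sphere_ft (- t) = sphere_ft t"
  by (cases "t = 0") (simp_all add: sphere_ft_def field_simps)

text \<open>Under the uniform measure on the sphere in \<open>\<real>\<^sup>5\<close> a coordinate has density
\<open>3 / 4 * (1 - u\<^sup>2)\<close>. Writing the transform as such an average of cosines transfers estimates for
the cosine (boundedness, Lipschitz continuity, interpolation error) to it.\<close>
lemma sphere_ft_average:
  "((\<lambda>u. 3 / 4 * (1 - u\<^sup>2) * cos (t * u)) has_integral sphere_ft t) {-1..1}"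
proof (cases "t = 0")
  case True
  have "((\<lambda>u. 3 / 4 * (1 - u\<^sup>2)) has_integral
      (3 / 4 * (1 - 1 ^ 3 / 3) - 3 / 4 * ((-1) - (-1) ^ 3 / 3))) {-1..1::real}"
    by (intro fundamental_theorem_of_calculus)
       (auto simp: has_real_derivative_iff_has_vector_derivative [symmetric] power2_eq_square
             intro!: derivative_eq_intros)
  then show ?thesis using True by simp
next
  case False
  define P where "P u = 3 / 4 * ((1 - u\<^sup>2) * sin (t * u) / t - 2 * u * cos (t * u) / t\<^sup>2 + 2 * sin (t * u) / t ^ 3)" for u
  have "((\<lambda>u. 3 / 4 * (1 - u\<^sup>2) * cos (t * u)) has_integral (P 1 - P (-1))) {-1..1}"
  proof (intro fundamental_theorem_of_calculus)
    fix u :: real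
    have "(P has_real_derivative 3 / 4 * (1 - u\<^sup>2) * cos (t * u)) (at u)"
      unfolding P_def using False
      by (auto intro!: derivative_eq_intros simp: field_simps power2_eq_square power3_eq_cube)
    then show "(P has_vector_derivative 3 / 4 * (1 - u\<^sup>2) * cos (t * u)) (at u within {-1..1})"
      by (simp add: has_real_derivative_iff_has_vector_derivative has_vector_derivative_at_within)
  qed auto
  moreover have "P 1 - P (-1) = sphere_ft t"
    using False by (simp add: P_def sphere_ft_def field_simps power2_eq_square power3_eq_cube)
  ultimately show ?thesis by simp
qed

lemma abs_sphere_ft_le_1: "\<bar>sphere_ft t\<bar> \<le> 1"
proof -
  have *: "((\<lambda>u. 3 / 4 * (1 - u\<^sup>2)) has_integral 1) {-1..1::real}"
    using sphere_ft_average[of 0] by simp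
  have b: "\<bar>3 / 4 * (1 - u\<^sup>2) * cos (t * u)\<bar> \<le> 3 / 4 * (1 - u\<^sup>2)" if "u \<in> {-1..1}" for u
  proof -
    have "u\<^sup>2 \<le> 1" using that by (simp add: abs_square_le_1 abs_le_iff)
    then have "\<bar>3 / 4 * (1 - u\<^sup>2)\<bar> * \<bar>cos (t * u)\<bar> \<le> 3 / 4 * (1 - u\<^sup>2) * 1"
      by (intro mult_mono) auto
    then show ?thesis by (simp add: abs_mult)
  qed
  have "sphere_ft t \<le> 1"
    using b by (intro has_integral_le[OF sphere_ft_average *]) (auto simp: abs_le_iff)
  moreover have "- 1 \<le> sphere_ft t"
  proof (rule has_integral_le[OF has_integral_neg[OF *] sphere_ft_average])
    show "- (3 / 4 * (1 - u\<^sup>2)) \<le> 3 / 4 * (1 - u\<^sup>2) * cos (t * u)" if "u \<in> {-1..1}" for u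
      using b[OF that] by linarith
  qed
  ultimately show ?thesis by linarith
qed

lemma borel_measurable_sphere_ft [measurable]: "sphere_ft \<in> borel_measurable borel"
  unfolding sphere_ft_def by measurable

text \<open>The primitive of \<open>r\<^sup>4 sphere_ft (t r)\<close> in \<open>r\<close> that vanishes at \<open>0\<close>; up to the factor
\<open>8 \<pi>\<^sup>2 / 3\<close> it is the Fourier transform of a ball of radius \<open>r\<close>.\<close>
definition ball_ft :: "real \<Rightarrow> real \<Rightarrow> real" where
  "ball_ft t r = (if t = 0 then r ^ 5 / 5 else
     3 * (3 * sin (t * r) - 3 * (t * r) * cos (t * r) - (t * r)\<^sup>2 * sin (t * r)) / t ^ 5)"

lemma ball_ft_0 [simp]: "ball_ft t 0 = 0"
  by (simp add: ball_ft_def)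

lemma has_derivative_ball_ft:
  "(ball_ft t has_real_derivative r ^ 4 * sphere_ft (t * r)) (at r)"
proof (cases "t = 0")
  case True
  have eq: "ball_ft t = (\<lambda>r. r ^ 5 / 5)" using True by (auto simp: ball_ft_def)
  show ?thesis unfolding eq using True by (auto intro!: derivative_eq_intros)
next
  case False
  have eq: "ball_ft t = (\<lambda>r. 3 * (3 * sin (t * r) - 3 * (t * r) * cos (t * r) - (t * r)\<^sup>2 * sin (t * r)) / t ^ 5)"
    using False by (auto simp: ball_ft_def)
  have "((\<lambda>r. 3 * (3 * sin (t * r) - 3 * (t * r) * cos (t * r) - (t * r)\<^sup>2 * sin (t * r)))
     has_real_derivative 3 * (t * (t * r) * (sin (t * r) - t * r * cos (t * r)))) (at r)"
    by (auto intro!: derivative_eq_intros simp: algebra_simps power2_eq_square)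
  then have "((\<lambda>r. 3 * (3 * sin (t * r) - 3 * (t * r) * cos (t * r) - (t * r)\<^sup>2 * sin (t * r)) / t ^ 5)
     has_real_derivative 3 * (t * (t * r) * (sin (t * r) - t * r * cos (t * r))) / t ^ 5) (at r)"
    by (rule DERIV_cdivide)
  also have "3 * (t * (t * r) * (sin (t * r) - t * r * cos (t * r))) / t ^ 5 = r ^ 4 * sphere_ft (t * r)"
    using False by (simp add: sphere_ft_def field_simps eval_nat_numeral)
  finally show ?thesis unfolding eq .
qed

text \<open>The same ball transform computed by slices: the slice at height \<open>y\<close> has four-dimensional
volume proportional to \<open>(R\<^sup>2 - y\<^sup>2)\<^sup>2\<close>.\<close>
lemma has_integral_cos_ball:
  assumes R: "R \<ge> 0"
  shows "((\<lambda>y. (R\<^sup>2 - y\<^sup>2)\<^sup>2 * cos (t * y)) has_integral 16 / 3 * ball_ft t R) {-R..R}"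
proof (cases "t = 0")
  case True
  define P where "P y = R ^ 4 * y - 2 * R\<^sup>2 * y ^ 3 / 3 + y ^ 5 / 5" for y
  have "((\<lambda>y. (R\<^sup>2 - y\<^sup>2)\<^sup>2) has_integral (P R - P (-R))) {-R..R}"
  proof (intro fundamental_theorem_of_calculus)
    fix u :: real
    have "(P has_real_derivative (R\<^sup>2 - u\<^sup>2)\<^sup>2) (at u)"
      unfolding P_def
      by (auto intro!: derivative_eq_intros simp: field_simps eval_nat_numeral)
    then show "(P has_vector_derivative (R\<^sup>2 - u\<^sup>2)\<^sup>2) (at u within {-R..R})"
      by (simp add: has_real_derivative_iff_has_vector_derivative has_vector_derivative_at_within)
  qed (use R in auto)
  moreover have "P R - P (-R) = 16 / 3 * ball_ft t R"
    using True by (simp add: P_def ball_ft_def field_simps eval_nat_numeral)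
  ultimately show ?thesis using True by simp
next
  case False
  define P where "P y = (R\<^sup>2 - y\<^sup>2)\<^sup>2 * sin (t * y) / t - 4 * y * (R\<^sup>2 - y\<^sup>2) * cos (t * y) / t ^ 2
     - (12 * y\<^sup>2 - 4 * R\<^sup>2) * sin (t * y) / t ^ 3 - 24 * y * cos (t * y) / t ^ 4 + 24 * sin (t * y) / t ^ 5" for y
  have "((\<lambda>y. (R\<^sup>2 - y\<^sup>2)\<^sup>2 * cos (t * y)) has_integral (P R - P (-R))) {-R..R}"
  proof (intro fundamental_theorem_of_calculus)
    fix u :: real
    have "(P has_real_derivative (R\<^sup>2 - u\<^sup>2)\<^sup>2 * cos (t * u)) (at u)"
      unfolding P_def using False
      apply (auto intro!: derivative_eq_intros)
      apply (simp add: field_simps eval_nat_numeral)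
      done
    then show "(P has_vector_derivative (R\<^sup>2 - u\<^sup>2)\<^sup>2 * cos (t * u)) (at u within {-R..R})"
      by (simp add: has_real_derivative_iff_has_vector_derivative has_vector_derivative_at_within)
  qed (use R in auto)
  moreover have "P R - P (-R) = 16 / 3 * ball_ft t R"
    using False by (simp add: P_def ball_ft_def field_simps eval_nat_numeral)
  ultimately show ?thesis by simp
qed

text \<open>Inherited from the cosine through \<open>sphere_ft_average\<close>. Its use is continuity at \<open>0\<close>, where the
closed form is singular.\<close>
lemma sphere_ft_lipschitz: "\<bar>sphere_ft s - sphere_ft t\<bar> \<le> \<bar>s - t\<bar>"
proof -
  have d: "((\<lambda>u. 3 / 4 * (1 - u\<^sup>2) * cos (s * u) - 3 / 4 * (1 - u\<^sup>2) * cos (t * u)) has_integral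
     sphere_ft s - sphere_ft t) {-1..1}"
    by (intro has_integral_diff sphere_ft_average)
  have K: "((\<lambda>u. 3 / 4 * (1 - u\<^sup>2) * \<bar>s - t\<bar>) has_integral \<bar>s - t\<bar>) {-1..1::real}"
    using has_integral_mult_left[OF sphere_ft_average[of 0], of "\<bar>s - t\<bar>"] by simp
  have le: "\<bar>3 / 4 * (1 - u\<^sup>2) * cos (s * u) - 3 / 4 * (1 - u\<^sup>2) * cos (t * u)\<bar> \<le> 3 / 4 * (1 - u\<^sup>2) * \<bar>s - t\<bar>"
    if "u \<in> {-1..1}" for u
  proof -
    have u: "\<bar>u\<bar> \<le> 1" using that by auto
    then have "u\<^sup>2 \<le> 1" by (simp add: abs_square_le_1)
    have "\<bar>cos (s * u) - cos (t * u)\<bar> \<le> \<bar>s * u - t * u\<bar>"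
    proof -
      have "cos (s * u) - cos (t * u) = 2 * sin ((s * u + t * u) / 2) * sin ((t * u - s * u) / 2)"
        by (rule cos_diff_cos)
      then have "\<bar>cos (s * u) - cos (t * u)\<bar> = 2 * \<bar>sin ((s * u + t * u) / 2)\<bar> * \<bar>sin ((t * u - s * u) / 2)\<bar>"
        by (simp add: abs_mult)
      also have "\<dots> \<le> 2 * 1 * \<bar>(t * u - s * u) / 2\<bar>"
        by (intro mult_mono abs_sin_x_le_abs_x) auto
      also have "\<dots> = \<bar>s * u - t * u\<bar>" by (simp add: abs_minus_commute)
      finally show ?thesis .
    qed
    also have "\<bar>s * u - t * u\<bar> = \<bar>s - t\<bar> * \<bar>u\<bar>" by (simp add: abs_mult flip: left_diff_distrib)
    also have "\<dots> \<le> \<bar>s - t\<bar> * 1" using u by (intro mult_left_mono) auto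
    finally have "3 / 4 * (1 - u\<^sup>2) * \<bar>cos (s * u) - cos (t * u)\<bar> \<le> 3 / 4 * (1 - u\<^sup>2) * \<bar>s - t\<bar>"
      using \<open>u\<^sup>2 \<le> 1\<close> by (intro mult_left_mono) auto
    moreover have "\<bar>3 / 4 * (1 - u\<^sup>2) * cos (s * u) - 3 / 4 * (1 - u\<^sup>2) * cos (t * u)\<bar> =
       3 / 4 * (1 - u\<^sup>2) * \<bar>cos (s * u) - cos (t * u)\<bar>"
      unfolding right_diff_distrib [symmetric] abs_mult using \<open>u\<^sup>2 \<le> 1\<close> by simp
    ultimately show ?thesis by simp
  qed
  have "sphere_ft s - sphere_ft t \<le> \<bar>s - t\<bar>"
  proof (rule has_integral_le[OF d K])
    show "3 / 4 * (1 - u\<^sup>2) * cos (s * u) - 3 / 4 * (1 - u\<^sup>2) * cos (t * u) \<le> 3 / 4 * (1 - u\<^sup>2) * \<bar>s - t\<bar>"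
      if "u \<in> {-1..1}" for u
      using le[OF that] by linarith
  qed
  moreover have "- \<bar>s - t\<bar> \<le> sphere_ft s - sphere_ft t"
  proof (rule has_integral_le[OF has_integral_neg[OF K] d])
    show "- (3 / 4 * (1 - u\<^sup>2) * \<bar>s - t\<bar>) \<le> 3 / 4 * (1 - u\<^sup>2) * cos (s * u) - 3 / 4 * (1 - u\<^sup>2) * cos (t * u)"
      if "u \<in> {-1..1}" for u
      using le[OF that] by linarith
  qed
  ultimately show ?thesis by linarith
qed

lemma isCont_sphere_ft: "isCont sphere_ft t"
proof -
  have "(\<lambda>s. sphere_ft s - sphere_ft t) \<midarrow>t\<rightarrow> 0"
  proof (rule Lim_null_comparison)
    show "\<forall>\<^sub>F s in at t. norm (sphere_ft s - sphere_ft t) \<le> \<bar>s - t\<bar>"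
      by (intro always_eventually) (simp add: sphere_ft_lipschitz)
    show "(\<lambda>s. \<bar>s - t\<bar>) \<midarrow>t\<rightarrow> 0"
      by (auto intro!: tendsto_eq_intros)
  qed
  then show ?thesis by (simp add: isCont_def LIM_zero_iff)
qed

section \<open>Polar coordinates\<close>

text \<open>Cavalieri's principle for a ball: the slice at height \<open>y\<close> is a ball of radius
\<open>sqrt (R\<^sup>2 - y\<^sup>2)\<close> in one dimension less. The weight \<open>g\<close> stays under the integral; with a cosine
for \<open>g\<close> this computes the Fourier transform of the ball.\<close>
lemma nn_integral_cball_slices:
  fixes b :: "'a :: euclidean_space" and g :: "real \<Rightarrow> ennreal"
  assumes b: "b \<in> Basis" and g [measurable]: "g \<in> borel_measurable borel" and R: "R > 0"
  shows "(\<integral>\<^sup>+x. g (x \<bullet> b) * indicator (cball 0 R) x \<partial>lborel) =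
    (\<integral>\<^sup>+y. g y * ennreal (unit_ball_vol (DIM('a) - 1) * sqrt (R\<^sup>2 - y\<^sup>2) ^ (DIM('a) - 1)) * indicator {-R..R} y \<partial>lborel)"
proof -
  interpret product_sigma_finite "\<lambda>_::'a. lborel :: real measure"
    by standard
  define A where "A = (Basis :: 'a set) - {b}"
  have A: "finite A" "b \<notin> A" "insert b A = Basis" "card A = DIM('a) - 1"
    using b by (auto simp: A_def card_Diff_singleton)
  let ?M = "Pi\<^sub>M Basis (\<lambda>_::'a. lborel :: real measure)"
  have "(\<integral>\<^sup>+x. g (x \<bullet> b) * indicator (cball 0 R) x \<partial>lborel) =
        (\<integral>\<^sup>+f. g (f b) * indicator {f. sqrt (\<Sum>i\<in>Basis. (f i)\<^sup>2) \<le> R} f \<partial>?M)"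
  proof -
    have *: "norm (\<Sum>b\<in>Basis. f b *\<^sub>R b :: 'a) = sqrt (\<Sum>i\<in>Basis. (f i)\<^sup>2)" for f
      by (subst norm_conv_dist, subst euclidean_dist_l2) (auto simp: L2_set_def)
    show ?thesis
      by (subst lborel_eq, subst nn_integral_distr)
         (auto intro!: nn_integral_cong simp: b * indicator_def)
  qed
  also have "\<dots> = (\<integral>\<^sup>+f. g (f b) * indicator {f. sqrt ((f b)\<^sup>2 + (\<Sum>i\<in>A. (f i)\<^sup>2)) \<le> R} f \<partial>Pi\<^sub>M (insert b A) (\<lambda>_::'a. lborel :: real measure))"
    using A by (simp flip: A(3))
  also have "\<dots> = (\<integral>\<^sup>+y. \<integral>\<^sup>+f. g y * indicator {f. sqrt (y\<^sup>2 + (\<Sum>i\<in>A. (f i)\<^sup>2)) \<le> R} f \<partial>Pi\<^sub>M A (\<lambda>_. lborel) \<partial>lborel)"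
  proof (subst product_nn_integral_insert_rev)
    show "finite A" "b \<notin> A" by fact+
    show "(\<integral>\<^sup>+ y. \<integral>\<^sup>+ x. g ((x(b := y)) b) * indicator {f. sqrt ((f b)\<^sup>2 + (\<Sum>i\<in>A. (f i)\<^sup>2)) \<le> R} (x(b := y)) \<partial>Pi\<^sub>M A (\<lambda>_. lborel) \<partial>lborel) =
      (\<integral>\<^sup>+y. \<integral>\<^sup>+f. g y * indicator {f. sqrt (y\<^sup>2 + (\<Sum>i\<in>A. (f i)\<^sup>2)) \<le> R} f \<partial>Pi\<^sub>M A (\<lambda>_. lborel) \<partial>lborel)"
    proof (intro nn_integral_cong)
      fix y and x :: "'a \<Rightarrow> real"
      have "(\<Sum>i\<in>A. ((x(b := y)) i)\<^sup>2) = (\<Sum>i\<in>A. (x i)\<^sup>2)"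
        using A by (intro sum.cong) auto
      then show "g ((x(b := y)) b) * indicator {f. sqrt ((f b)\<^sup>2 + (\<Sum>i\<in>A. (f i)\<^sup>2)) \<le> R} (x(b := y)) =
         g y * indicator {f. sqrt (y\<^sup>2 + (\<Sum>i\<in>A. (f i)\<^sup>2)) \<le> R} x"
        by (auto simp: indicator_def)
    qed
  qed measurable
  also have "\<dots> = (\<integral>\<^sup>+y. g y * emeasure (Pi\<^sub>M A (\<lambda>_. lborel)) ({f. sqrt (y\<^sup>2 + (\<Sum>i\<in>A. (f i)\<^sup>2)) \<le> R} \<inter> space (Pi\<^sub>M A (\<lambda>_. lborel :: real measure))) \<partial>lborel)"
  proof (intro nn_integral_cong)
    fix y :: real
    have "(\<integral>\<^sup>+f. g y * indicator {f. sqrt (y\<^sup>2 + (\<Sum>i\<in>A. (f i)\<^sup>2)) \<le> R} f \<partial>Pi\<^sub>M A (\<lambda>_. lborel)) =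
          (\<integral>\<^sup>+f. g y * indicator ({f. sqrt (y\<^sup>2 + (\<Sum>i\<in>A. (f i)\<^sup>2)) \<le> R} \<inter> space (Pi\<^sub>M A (\<lambda>_. lborel :: real measure))) f \<partial>Pi\<^sub>M A (\<lambda>_. lborel))"
      by (intro nn_integral_cong) (auto simp: indicator_def)
    also have "\<dots> = g y * emeasure (Pi\<^sub>M A (\<lambda>_. lborel)) ({f. sqrt (y\<^sup>2 + (\<Sum>i\<in>A. (f i)\<^sup>2)) \<le> R} \<inter> space (Pi\<^sub>M A (\<lambda>_. lborel :: real measure)))"
      by (subst nn_integral_cmult_indicator) auto
    finally show "(\<integral>\<^sup>+f. g y * indicator {f. sqrt (y\<^sup>2 + (\<Sum>i\<in>A. (f i)\<^sup>2)) \<le> R} f \<partial>Pi\<^sub>M A (\<lambda>_. lborel)) =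
      g y * emeasure (Pi\<^sub>M A (\<lambda>_. lborel)) ({f. sqrt (y\<^sup>2 + (\<Sum>i\<in>A. (f i)\<^sup>2)) \<le> R} \<inter> space (Pi\<^sub>M A (\<lambda>_. lborel :: real measure)))" .
  qed
  also have "\<dots> = (\<integral>\<^sup>+y. g y * ennreal (unit_ball_vol (DIM('a) - 1) * sqrt (R\<^sup>2 - y\<^sup>2) ^ (DIM('a) - 1)) * indicator {-R..R} y \<partial>lborel)"
  proof (intro nn_integral_cong_AE)
    have "AE y in lborel. y \<notin> {-R,R}"
      by (intro AE_not_in countable_imp_null_set_lborel) auto
    thus "AE y in lborel. g y * emeasure (Pi\<^sub>M A (\<lambda>_. lborel)) ({f. sqrt (y\<^sup>2 + (\<Sum>i\<in>A. (f i)\<^sup>2)) \<le> R} \<inter> space (Pi\<^sub>M A (\<lambda>_. lborel :: real measure))) =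
        g y * ennreal (unit_ball_vol (DIM('a) - 1) * sqrt (R\<^sup>2 - y\<^sup>2) ^ (DIM('a) - 1)) * indicator {-R..R} y"
    proof eventually_elim
      case (elim y)
      show ?case
      proof (cases "y \<in> {-R<..<R}")
        case True
        hence y: "y\<^sup>2 < R\<^sup>2" by (subst real_sqrt_less_iff [symmetric]) (use R in auto)
        have eq: "{f. sqrt (y\<^sup>2 + (\<Sum>i\<in>A. (f i)\<^sup>2)) \<le> R} = {f. sqrt (\<Sum>i\<in>A. (f i)\<^sup>2) \<le> sqrt (R\<^sup>2 - y\<^sup>2)}"
          using R by (auto simp: real_sqrt_le_iff' sum_nonneg)
        have "sqrt (R\<^sup>2 - y\<^sup>2) > 0" using y by simp
        from emeasure_cball_aux[OF A(1) this] True show ?thesis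
          unfolding eq A(4) by (auto simp: A(4))
      next
        case False
        with elim have y: "y < -R \<or> y > R" by auto
        hence "R\<^sup>2 < y\<^sup>2" by (subst real_sqrt_less_iff [symmetric]) (use R in auto)
        have "\<not> sqrt (y\<^sup>2 + (\<Sum>i\<in>A. (f i)\<^sup>2)) \<le> R" for f :: "'a \<Rightarrow> real"
        proof
          assume "sqrt (y\<^sup>2 + (\<Sum>i\<in>A. (f i)\<^sup>2)) \<le> R"
          hence "y\<^sup>2 + (\<Sum>i\<in>A. (f i)\<^sup>2) \<le> R\<^sup>2" by (rule sqrt_le_D)
          moreover have "(\<Sum>i\<in>A. (f i)\<^sup>2) \<ge> 0" by (intro sum_nonneg) auto
          ultimately show False using \<open>R\<^sup>2 < y\<^sup>2\<close> by linarith
        qed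
        hence "{f. sqrt (y\<^sup>2 + (\<Sum>i\<in>A. (f i)\<^sup>2)) \<le> R} = {}" by blast
        thus ?thesis using y by (auto simp: indicator_def)
      qed
    qed
  qed
  finally show ?thesis .
qed

text \<open>A rotation reduces an arbitrary frequency to a multiple of a basis vector, where slicing
applies.\<close>
lemma orthogonal_transformation_preserves_lborel:
  fixes T :: "real ^ 'n::{finite,wellorder} \<Rightarrow> real ^ 'n::_"
  assumes T: "orthogonal_transformation T"
  shows "distr lborel borel T = lborel"
proof (rule lborel_eqI [symmetric])
  fix l u :: "real ^ 'n::_"
  assume lu: "\<And>b. b \<in> Basis \<Longrightarrow> l \<bullet> b \<le> u \<bullet> b"
  have "linear T" using T by (rule orthogonal_transformation_linear)
  have [measurable]: "T \<in> borel_measurable borel"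
    by (intro borel_measurable_continuous_onI linear_continuous_on linear_conv_bounded_linear[THEN iffD1] \<open>linear T\<close>)
  have T': "orthogonal_transformation (inv T)"
    using T by (rule orthogonal_transformation_inv)
  have bij: "bij T" using T by (rule orthogonal_transformation_bij)
  have vim: "T -` box l u = inv T ` box l u"
    using bij by (simp add: bij_vimage_eq_inv_image)
  have meas: "inv T ` box l u \<in> sets borel"
    unfolding vim [symmetric] using measurable_sets[of T borel borel "box l u"] by simp
  have "emeasure (distr lborel borel T) (box l u) = emeasure lborel (inv T ` box l u)"
    by (subst emeasure_distr) (auto simp: vim)
  also have "\<dots> = emeasure lebesgue (inv T ` box l u)"
    using meas by simp
  also have "\<dots> = ennreal (measure lebesgue (inv T ` box l u))"
    using measurable_orthogonal_image[OF T', of "box l u"] by (simp add: emeasure_eq_measure2 lmeasurable_box)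
  also have "measure lebesgue (inv T ` box l u) = measure lebesgue (box l u)"
    by (rule measure_orthogonal_image[OF T']) (simp add: lmeasurable_box)
  also have "\<dots> = (\<Prod>b\<in>Basis. (u - l) \<bullet> b)"
    using lu by (simp add: measure_lborel_box_eq)
  finally show "emeasure (distr lborel borel T) (box l u) = (\<Prod>b\<in>Basis. (u - l) \<bullet> b)" .
qed simp

text \<open>The weight is \<open>1 + cos\<close> instead of \<open>cos\<close> so that it is nonnegative. Both sides are then
measures of balls under two measures, and \<open>distr_norm_cos\<close> can identify these measures.\<close>
lemma emeasure_cos_ball:
  fixes b :: "'a :: euclidean_space"
  assumes b: "b \<in> Basis" and dim: "DIM('a) = 5" and R: "R > 0"
  shows "(\<integral>\<^sup>+x. ennreal (1 + cos (t * (x \<bullet> b))) * indicator (cball 0 R) x \<partial>lborel) =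
    (\<integral>\<^sup>+r. ennreal (8 * pi\<^sup>2 / 3 * r ^ 4 * (1 + sphere_ft (t * r))) * indicator {0..R} r \<partial>lborel)"
proof -
  have "1 + cos y \<ge> 0" for y :: real
    using cos_ge_minus_one[of y] by linarith
  have "(\<integral>\<^sup>+x. ennreal (1 + cos (t * (x \<bullet> b))) * indicator (cball 0 R) x \<partial>lborel) =
     (\<integral>\<^sup>+y. ennreal (1 + cos (t * y)) * ennreal (unit_ball_vol 4 * sqrt (R\<^sup>2 - y\<^sup>2) ^ 4) * indicator {-R..R} y \<partial>lborel)"
    using nn_integral_cball_slices[OF b _ R, of "\<lambda>y. ennreal (1 + cos (t * y))"] by (simp add: dim)
  also have "\<dots> = (\<integral>\<^sup>+y. ennreal (pi\<^sup>2 / 2 * ((R\<^sup>2 - y\<^sup>2)\<^sup>2 + (R\<^sup>2 - y\<^sup>2)\<^sup>2 * cos (t * y))) * indicator {-R..R} y \<partial>lborel)"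
  proof (intro nn_integral_cong)
    fix y
    have "sqrt (R\<^sup>2 - y\<^sup>2) ^ 4 = (R\<^sup>2 - y\<^sup>2)\<^sup>2" if "y \<in> {-R..R}"
    proof -
      have "R\<^sup>2 - y\<^sup>2 \<ge> 0" using that by (simp add: abs_le_square_iff[symmetric] abs_le_iff)
      have "sqrt (R\<^sup>2 - y\<^sup>2) ^ 4 = (sqrt (R\<^sup>2 - y\<^sup>2) ^ 2) ^ 2"
        by (simp add: power_mult [symmetric])
      then show ?thesis using \<open>R\<^sup>2 - y\<^sup>2 \<ge> 0\<close> by simp
    qed
    then show "ennreal (1 + cos (t * y)) * ennreal (unit_ball_vol 4 * sqrt (R\<^sup>2 - y\<^sup>2) ^ 4) * indicator {-R..R} y =
      ennreal (pi\<^sup>2 / 2 * ((R\<^sup>2 - y\<^sup>2)\<^sup>2 + (R\<^sup>2 - y\<^sup>2)\<^sup>2 * cos (t * y))) * indicator {-R..R} y"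
      using \<open>\<And>y. 1 + cos y \<ge> 0\<close>
      by (auto simp: indicator_def unit_ball_vol_4 ennreal_mult' [symmetric] algebra_simps add_divide_distrib)
  qed
  also have "\<dots> = ennreal (pi\<^sup>2 / 2 * (16 / 3 * (R ^ 5 / 5) + 16 / 3 * ball_ft t R))"
  proof (rule nn_integral_has_integral_lebesgue')
    show "0 \<le> pi\<^sup>2 / 2 * ((R\<^sup>2 - y\<^sup>2)\<^sup>2 + (R\<^sup>2 - y\<^sup>2)\<^sup>2 * cos (t * y))" for y
    proof -
      have "0 \<le> pi\<^sup>2 / 2 * ((R\<^sup>2 - y\<^sup>2)\<^sup>2 * (1 + cos (t * y)))"
        by (intro mult_nonneg_nonneg \<open>\<And>y. 1 + cos y \<ge> 0\<close>) auto
      then show ?thesis by (simp add: algebra_simps)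
    qed
    have "((\<lambda>y. (R\<^sup>2 - y\<^sup>2)\<^sup>2) has_integral 16 / 3 * (R ^ 5 / 5)) {-R..R}"
      using has_integral_cos_ball[of R 0] R by (simp add: ball_ft_def)
    from has_integral_mult_right[OF has_integral_add[OF this has_integral_cos_ball[of R t]], of "pi\<^sup>2 / 2"] R
    show "((\<lambda>y. pi\<^sup>2 / 2 * ((R\<^sup>2 - y\<^sup>2)\<^sup>2 + (R\<^sup>2 - y\<^sup>2)\<^sup>2 * cos (t * y))) has_integral
      (pi\<^sup>2 / 2 * (16 / 3 * (R ^ 5 / 5) + 16 / 3 * ball_ft t R))) {-R..R}" by simp
  qed
  also have "pi\<^sup>2 / 2 * (16 / 3 * (R ^ 5 / 5) + 16 / 3 * ball_ft t R) =
     8 * pi\<^sup>2 / 3 * (R ^ 5 / 5 + ball_ft t R) - 8 * pi\<^sup>2 / 3 * (0 ^ 5 / 5 + ball_ft t 0)"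
    by (simp add: algebra_simps)
  also have "ennreal \<dots> = (\<integral>\<^sup>+r. ennreal (8 * pi\<^sup>2 / 3 * r ^ 4 * (1 + sphere_ft (t * r))) * indicator {0..R} r \<partial>lborel)"
  proof (rule nn_integral_FTC_Icc [symmetric])
    fix r :: real
    show "((\<lambda>r. 8 * pi\<^sup>2 / 3 * (r ^ 5 / 5 + ball_ft t r)) has_real_derivative 8 * pi\<^sup>2 / 3 * r ^ 4 * (1 + sphere_ft (t * r))) (at r)"
      by (auto intro!: derivative_eq_intros DERIV_chain2[OF has_derivative_ball_ft] simp: algebra_simps)
    show "0 \<le> 8 * pi\<^sup>2 / 3 * r ^ 4 * (1 + sphere_ft (t * r))"
      using abs_sphere_ft_le_1[of "t * r"] by (intro mult_nonneg_nonneg) auto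
  qed (use R in auto)
  finally show ?thesis .
qed

text \<open>The right-hand side is determined by its values on half-lines, that is, by the measures of balls
on the left. This gives polar coordinates and the transform of every radial function at once.\<close>
lemma distr_norm_cos:
  fixes b :: "'a :: euclidean_space"
  assumes b: "b \<in> Basis" and dim: "DIM('a) = 5"
  shows "distr (density lborel (\<lambda>x. ennreal (1 + cos (t * (x \<bullet> b))))) borel norm =
    density lborel (\<lambda>r. ennreal (8 * pi\<^sup>2 / 3 * r ^ 4 * (1 + sphere_ft (t * r)) * indicator {0..} r))"
    (is "?M = ?N")
proof (rule measure_eqI_generator_eq)
  let ?E = "range (\<lambda>R::real. {..R})" and ?A = "\<lambda>n::nat. {..real n}"
  have M: "emeasure ?M {..R} = (\<integral>\<^sup>+x. ennreal (1 + cos (t * (x \<bullet> b))) * indicator (cball 0 R) x \<partial>lborel)" for R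
  proof -
    have "norm -` {..R} = cball (0::'a) R" by auto
    then show ?thesis by (simp add: emeasure_distr emeasure_density)
  qed
  have N: "emeasure ?N {..R} =
    (\<integral>\<^sup>+r. ennreal (8 * pi\<^sup>2 / 3 * r ^ 4 * (1 + sphere_ft (t * r))) * indicator {0..R} r \<partial>lborel)" for R
    by (auto simp: emeasure_density indicator_def intro!: nn_integral_cong)
  show "Int_stable ?E" by (auto simp: Int_stable_def)
  show "?E \<subseteq> Pow UNIV" by simp
  show "sets ?M = sigma_sets UNIV ?E" "sets ?N = sigma_sets UNIV ?E"
    by (simp_all add: borel_eq_atMost)
  show "range ?A \<subseteq> ?E" by auto
  show "(\<Union>i. ?A i) = UNIV" by (auto simp: real_arch_simple)
  have fin: "emeasure ?M {..R} \<noteq> \<infinity>" for R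
  proof -
    have "emeasure ?M {..R} \<le> (\<integral>\<^sup>+x. 2 * indicator (cball 0 R) x \<partial>(lborel :: 'a measure))"
      unfolding M
    proof (intro nn_integral_mono mult_right_mono)
      show "ennreal (1 + cos (t * (x \<bullet> b))) \<le> 2" for x
        using ennreal_leI[of "1 + cos (t * (x \<bullet> b))" 2] cos_le_one[of "t * (x \<bullet> b)"] by simp
    qed simp
    also have "\<dots> < \<infinity>"
      using emeasure_lborel_cball_finite[of "0::'a" R]
      by (simp add: nn_integral_cmult_indicator ennreal_mult_less_top)
    finally show ?thesis by simp
  qed
  show "emeasure ?M (?A i) \<noteq> \<infinity>" for i by (rule fin)
  show "emeasure ?M X = emeasure ?N X" if "X \<in> ?E" for X
  proof -
    from that obtain R where X: "X = {..R}" by auto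
    consider "R < 0" | "R = 0" | "R > 0" by linarith
    then show ?thesis
    proof cases
      case 1
      then show ?thesis unfolding X M N by simp
    next
      case 2
      have "(\<integral>\<^sup>+x. ennreal (1 + cos (t * (x \<bullet> b))) * indicator (cball 0 R) x \<partial>lborel) = 0"
        using AE_lborel_singleton[of "0::'a"] 2
        by (subst nn_integral_0_iff_AE) (auto elim!: eventually_mono simp: indicator_def)
      moreover have "(\<integral>\<^sup>+r. ennreal (8 * pi\<^sup>2 / 3 * r ^ 4 * (1 + sphere_ft (t * r))) * indicator {0..R} r \<partial>lborel) = 0"
        using AE_lborel_singleton[of "0::real"] 2
        by (subst nn_integral_0_iff_AE) (auto elim!: eventually_mono simp: indicator_def)
      ultimately show ?thesis unfolding X M N by simp
    next
      case 3
      then show ?thesis unfolding X M N by (rule emeasure_cos_ball[OF b dim])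
    qed
  qed
qed

text \<open>Both statements come from \<open>distr_norm_cos\<close>: with \<open>t = 0\<close> the weight is the constant \<open>2\<close>, and
subtracting the plain integral from the weighted one leaves the cosine.\<close>
lemma
  fixes \<phi> :: "real \<Rightarrow> real"
  assumes dim: "DIM('a::euclidean_space) = 5" and [measurable]: "\<phi> \<in> borel_measurable borel"
  shows integral_radial:
      "(\<integral>x. \<phi> (norm (x::'a)) \<partial>lborel) = (\<integral>r. 8 * pi\<^sup>2 / 3 * r ^ 4 * indicator {0..} r * \<phi> r \<partial>lborel)"
    and integral_radial_cos_Basis:
      "(b::'a) \<in> Basis \<Longrightarrow> integrable lborel (\<lambda>x::'a. \<phi> (norm x)) \<Longrightarrow>
       (\<integral>x. \<phi> (norm x) * cos (t * (x \<bullet> b)) \<partial>lborel) =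
       (\<integral>x. \<phi> (norm (x::'a)) * sphere_ft (t * norm x) \<partial>lborel)"
proof -
  have pos: "1 + cos y \<ge> 0" "1 + sphere_ft y \<ge> 0" for y :: real
    using cos_ge_minus_one[of y] abs_sphere_ft_le_1[of y] by linarith+
  have L: "(\<integral>r. \<phi> r \<partial>distr (density lborel (\<lambda>x::'a. ennreal (1 + cos (t * (x \<bullet> b))))) borel norm) =
         (\<integral>x. (1 + cos (t * (x \<bullet> b))) * \<phi> (norm x) \<partial>lborel)"
    if [measurable]: "\<phi> \<in> borel_measurable borel" for \<phi> :: "real \<Rightarrow> real" and b :: 'a and t
  proof -
    have [measurable]: "(\<lambda>x::'a. \<phi> (norm x)) \<in> borel_measurable (density lborel (\<lambda>x. ennreal (1 + cos (t * (x \<bullet> b)))))"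
      by simp
    show "(\<integral>r. \<phi> r \<partial>distr (density lborel (\<lambda>x::'a. ennreal (1 + cos (t * (x \<bullet> b))))) borel norm) =
         (\<integral>x. (1 + cos (t * (x \<bullet> b))) * \<phi> (norm x) \<partial>lborel)"
      by (subst integral_distr, simp, simp, subst integral_density) (simp_all add: pos)
  qed
  have R: "(\<integral>r. \<phi> r \<partial>density lborel (\<lambda>r. ennreal (8 * pi\<^sup>2 / 3 * r ^ 4 * (1 + sphere_ft (t * r)) * indicator {0..} r))) =
         (\<integral>r. 8 * pi\<^sup>2 / 3 * r ^ 4 * (1 + sphere_ft (t * r)) * indicator {0..} r * \<phi> r \<partial>lborel)"
     if "\<phi> \<in> borel_measurable borel" for \<phi> :: "real \<Rightarrow> real" and t
    using that by (subst integral_density) (simp_all add: pos)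
  obtain b0 :: 'a where b0: "b0 \<in> Basis" using nonempty_Basis by blast
  have *: "(\<integral>x. \<phi> (norm (x::'a)) \<partial>lborel) = (\<integral>r. 8 * pi\<^sup>2 / 3 * r ^ 4 * indicator {0..} r * \<phi> r \<partial>lborel)"
    if \<phi> [measurable]: "\<phi> \<in> borel_measurable borel" for \<phi> :: "real \<Rightarrow> real"
  proof -
    have "(\<integral>x. 2 * \<phi> (norm (x::'a)) \<partial>lborel) = (\<integral>r. \<phi> r \<partial>distr (density lborel (\<lambda>x::'a. ennreal (1 + cos (0 * (x \<bullet> b0))))) borel norm)"
      by (subst L[OF \<phi>]) simp
    also have "\<dots> = (\<integral>r. 2 * (8 * pi\<^sup>2 / 3 * r ^ 4 * indicator {0..} r * \<phi> r) \<partial>lborel)"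
      unfolding distr_norm_cos[OF b0 dim] R[OF \<phi>] by (intro Bochner_Integration.integral_cong) auto
    finally show ?thesis unfolding integral_mult_right_zero by (rule mult_left_cancel[THEN iffD1, rotated]) simp
  qed
  show "(\<integral>x. \<phi> (norm (x::'a)) \<partial>lborel) = (\<integral>r. 8 * pi\<^sup>2 / 3 * r ^ 4 * indicator {0..} r * \<phi> r \<partial>lborel)"
    by (rule *) measurable
  assume b: "(b::'a) \<in> Basis" and int: "integrable lborel (\<lambda>x::'a. \<phi> (norm x))"
  have int': "integrable lborel (\<lambda>x. \<phi> (norm x) * h x)" if [measurable]: "h \<in> borel_measurable borel" and "\<And>x. \<bar>h x\<bar> \<le> 1" for h :: "'a \<Rightarrow> real"
    by (rule Bochner_Integration.integrable_bound[OF int])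
       (simp_all add: abs_mult mult_left_le that(2))
  have "(\<integral>x. \<phi> (norm (x::'a)) \<partial>lborel) + (\<integral>x. \<phi> (norm x) * cos (t * (x \<bullet> b)) \<partial>lborel) =
        (\<integral>x. (1 + cos (t * (x \<bullet> b))) * \<phi> (norm x) \<partial>lborel)"
    by (subst Bochner_Integration.integral_add [symmetric, OF int int'[of "\<lambda>x. cos (t * (x \<bullet> b))"]])
       (simp_all add: algebra_simps)
  also have "\<dots> = (\<integral>r. 8 * pi\<^sup>2 / 3 * r ^ 4 * (1 + sphere_ft (t * r)) * indicator {0..} r * \<phi> r \<partial>lborel)"
    by (subst L [symmetric], measurable, subst distr_norm_cos[OF b dim], rule R) measurable
  also have "\<dots> = (\<integral>x. (1 + sphere_ft (t * norm x)) * \<phi> (norm (x::'a)) \<partial>lborel)"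
    by (subst *[of "\<lambda>r. (1 + sphere_ft (t * r)) * \<phi> r"]) (simp_all add: mult_ac)
  also have "\<dots> = (\<integral>x. \<phi> (norm (x::'a)) \<partial>lborel) + (\<integral>x. \<phi> (norm x) * sphere_ft (t * norm (x::'a)) \<partial>lborel)"
    by (subst Bochner_Integration.integral_add [symmetric, OF int int'[of "\<lambda>x. sphere_ft (t * norm x)"]])
       (simp_all add: abs_sphere_ft_le_1 algebra_simps)
  finally show "(\<integral>x. \<phi> (norm x) * cos (t * (x \<bullet> b)) \<partial>lborel) =
       (\<integral>x. \<phi> (norm x) * sphere_ft (t * norm (x::'a)) \<partial>lborel)" by simp
qed

text \<open>In the transform of a radial function the cosine may be replaced by its average over the sphere
through \<open>x\<close>.\<close>
lemma integral_radial_cos: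
  fixes g :: "real ^ 5 \<Rightarrow> real"
  assumes "radial g" and int: "integrable lborel g"
  shows "(\<integral>x. g x * cos (x \<bullet> y) \<partial>lborel) = (\<integral>x. g x * sphere_ft (norm y * norm x) \<partial>lborel)"
proof -
  have [measurable]: "g \<in> borel_measurable borel"
    using int by simp
  define b :: "real ^ 5" where "b = axis 1 1"
  have b: "b \<in> Basis" "norm b = 1" by (simp_all add: b_def axis_in_Basis_iff)
  define \<phi> where "\<phi> r = g (r *\<^sub>R b)" for r
  have \<phi>: "\<phi> (norm x) = g x" for x
    unfolding \<phi>_def using b by (intro assms(1)[unfolded radial_def, rule_format]) simp
  have [measurable]: "\<phi> \<in> borel_measurable borel" unfolding \<phi>_def by measurable
  obtain T :: "real ^ 5 \<Rightarrow> real ^ 5" where T: "orthogonal_transformation T" "T (norm y *\<^sub>R b) = y"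
    using orthogonal_transformation_exists[of "norm y *\<^sub>R b" y] b by auto
  have "linear T" using T(1) by (rule orthogonal_transformation_linear)
  then have "continuous_on UNIV T" by (simp add: linear_continuous_on linear_conv_bounded_linear)
  then have [measurable]: "T \<in> borel_measurable borel" by (rule borel_measurable_continuous_onI)
  have "(\<integral>x. g x * cos (x \<bullet> y) \<partial>lborel) = (\<integral>x. g x * cos (x \<bullet> y) \<partial>distr lborel borel T)"
    by (simp only: orthogonal_transformation_preserves_lborel[OF T(1)])
  also have "\<dots> = (\<integral>x. g (T x) * cos (T x \<bullet> T (norm y *\<^sub>R b)) \<partial>lborel)"
    unfolding T(2) by (rule integral_distr) simp_all
  also have "\<dots> = (\<integral>x. \<phi> (norm x) * cos (norm y * (x \<bullet> b)) \<partial>lborel)"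
  proof (intro Bochner_Integration.integral_cong refl)
    fix x
    have "g (T x) = g x"
      using T(1) by (intro assms(1)[unfolded radial_def, rule_format] orthogonal_transformation_norm)
    moreover have "T x \<bullet> T (norm y *\<^sub>R b) = norm y * (x \<bullet> b)"
      using T(1) by (simp add: orthogonal_transformation_def)
    ultimately show "g (T x) * cos (T x \<bullet> T (norm y *\<^sub>R b)) = \<phi> (norm x) * cos (norm y * (x \<bullet> b))"
      by (simp add: \<phi>)
  qed
  also have "\<dots> = (\<integral>x. \<phi> (norm x) * sphere_ft (norm y * norm (x::real^5)) \<partial>lborel)"
  proof (rule integral_radial_cos_Basis)
    show "DIM(real ^ 5) = 5" by simp
    show "integrable lborel (\<lambda>x::real^5. \<phi> (norm x))" unfolding \<phi> by (rule int)
  qed (use b in measurable)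
  finally show ?thesis by (simp add: \<phi>)
qed

section \<open>Gaussians and linear substitutions\<close>

text \<open>Scaling of integrals; it relates an admissible function for \<open>r\<close> to one for radius \<open>1\<close>, and is also
used with factor \<open>-1\<close> for reflections.\<close>
lemma
  fixes h :: "'a::euclidean_space \<Rightarrow> real"
  assumes c: "c \<noteq> 0" and [measurable]: "h \<in> borel_measurable borel"
  shows integral_lborel_affine: "(\<integral>x. h x \<partial>lborel) = \<bar>c\<bar> ^ DIM('a) * (\<integral>x. h (a + c *\<^sub>R x) \<partial>lborel)"
    and integrable_lborel_affine_iff: "integrable lborel h \<longleftrightarrow> integrable lborel (\<lambda>x. h (a + c *\<^sub>R x))"
proof -
  let ?D = "distr lborel borel (\<lambda>x::'a. a + c *\<^sub>R x)"
  have eq: "lborel = density ?D (\<lambda>_. ennreal (\<bar>c\<bar> ^ DIM('a)))"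
    using lborel_affine[OF c, of a] by (simp add: power_abs)
  have "(\<integral>x. h x \<partial>lborel) = (\<integral>x. \<bar>c\<bar> ^ DIM('a) * h x \<partial>?D)"
    by (subst eq, subst integral_density) simp_all
  also have "\<dots> = \<bar>c\<bar> ^ DIM('a) * (\<integral>x. h (a + c *\<^sub>R x) \<partial>lborel)"
    by (subst integral_distr) simp_all
  finally show "(\<integral>x. h x \<partial>lborel) = \<bar>c\<bar> ^ DIM('a) * (\<integral>x. h (a + c *\<^sub>R x) \<partial>lborel)" .
  have "integrable lborel h \<longleftrightarrow> integrable ?D (\<lambda>x. \<bar>c\<bar> ^ DIM('a) * h x)"
    by (subst eq, subst integrable_density) simp_all
  also have "\<dots> \<longleftrightarrow> integrable lborel (\<lambda>x. h (a + c *\<^sub>R x))"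
    by (subst integrable_distr_eq) (use c in simp_all)
  finally show "integrable lborel h \<longleftrightarrow> integrable lborel (\<lambda>x. h (a + c *\<^sub>R x))" .
qed

lemma
  fixes g :: "'a::euclidean_space \<Rightarrow> real \<Rightarrow> complex"
  assumes int: "\<And>b. b \<in> Basis \<Longrightarrow> integrable lborel (g b)"
  shows integrable_lborel_prod: "integrable lborel (\<lambda>x. \<Prod>b\<in>Basis. g b (x \<bullet> b))"
    and integral_lborel_prod: "(\<integral>x. (\<Prod>b\<in>Basis. g b (x \<bullet> b)) \<partial>lborel) = (\<Prod>b\<in>Basis. \<integral>y. g b y \<partial>lborel)"
proof -
  interpret product_sigma_finite "\<lambda>_::'a. lborel :: real measure" by standard
  have [measurable]: "g b \<in> borel_measurable borel" if "b \<in> Basis" for b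
    using int[OF that] by simp
  have [measurable]: "(\<lambda>x. \<Prod>b\<in>Basis. g b (x \<bullet> b)) \<in> borel_measurable borel"
    by (intro borel_measurable_prod) measurable
  have [simp]: "(\<Sum>b\<in>Basis. f b *\<^sub>R b) \<bullet> b = f b" if "b \<in> Basis" for f and b :: 'a
    using that by simp
  show "integrable lborel (\<lambda>x. \<Prod>b\<in>Basis. g b (x \<bullet> b))"
    by (subst lborel_eq, subst integrable_distr_eq)
       (use product_integrable_prod[of "Basis :: 'a set" g] int in simp_all)
  show "(\<integral>x. (\<Prod>b\<in>Basis. g b (x \<bullet> b)) \<partial>lborel) = (\<Prod>b\<in>Basis. \<integral>y. g b y \<partial>lborel)"
    by (subst lborel_eq, subst integral_distr)
       (use product_integral_prod[of "Basis :: 'a set" g] int in simp_all)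
qed

definition gauss :: "'a::euclidean_space \<Rightarrow> real" where
  "gauss x = exp (- (norm x)\<^sup>2 / 2) / sqrt (2 * pi) ^ DIM('a)"

lemma gauss_nonneg [simp]: "gauss x \<ge> 0"
  by (simp add: gauss_def)

lemma borel_measurable_gauss [measurable]: "gauss \<in> borel_measurable borel"
  unfolding gauss_def by measurable

text \<open>Reduces the Gaussian to the one-dimensional normal distribution, whose characteristic function is
known.\<close>
lemma gauss_eq_prod: "gauss x = (\<Prod>b\<in>Basis. std_normal_density (x \<bullet> b))"
proof -
  have norm: "(norm x)\<^sup>2 = (\<Sum>b\<in>Basis. (x \<bullet> b)\<^sup>2)"
    unfolding power2_norm_eq_inner by (subst euclidean_inner) (simp add: power2_eq_square)
  have "(\<Prod>b\<in>Basis. std_normal_density (x \<bullet> b)) =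
      (\<Prod>b\<in>(Basis::'a set). 1 / sqrt (2 * pi)) * (\<Prod>b\<in>Basis. exp (- (x \<bullet> b)\<^sup>2 / 2))"
    unfolding std_normal_density_def by (rule prod.distrib)
  also have "(\<Prod>b\<in>Basis. exp (- (x \<bullet> b)\<^sup>2 / 2)) = exp (\<Sum>b\<in>Basis. - (x \<bullet> b)\<^sup>2 / 2)"
    by (rule exp_sum [symmetric]) simp
  also have "(\<Sum>b\<in>Basis. - (x \<bullet> b)\<^sup>2 / 2) = - (norm x)\<^sup>2 / 2"
    unfolding norm sum_divide_distrib [symmetric] sum_negf ..
  also have "(\<Prod>b\<in>(Basis::'a set). 1 / sqrt (2 * pi)) = 1 / sqrt (2 * pi) ^ DIM('a)"
    by (simp add: power_one_over)
  finally show ?thesis by (simp add: gauss_def)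
qed

lemma
  fixes y :: "'a::euclidean_space"
  shows integrable_gauss: "integrable lborel (gauss :: 'a \<Rightarrow> real)"
    and integral_gauss_cos: "(\<integral>x. gauss x * cos (x \<bullet> y) \<partial>lborel) = exp (- (norm y)\<^sup>2 / 2)"
proof -
  have 1: "integrable lborel (\<lambda>x. complex_of_real (std_normal_density x) * iexp (x * s))" for s
    by (rule Bochner_Integration.integrable_bound[OF integrable_normal_density[of 1 0]])
       (simp_all add: norm_mult)
  have 2: "(\<integral>x. complex_of_real (std_normal_density x) * iexp (x * s) \<partial>lborel) = complex_of_real (exp (- s\<^sup>2 / 2))" for s
  proof -
    have "(\<integral>x. complex_of_real (std_normal_density x) * iexp (x * s) \<partial>lborel) = char std_normal_distribution s"
      unfolding char_def by (subst integral_density) (simp_all add: scaleR_conv_of_real mult_ac)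
    then show ?thesis by (simp add: char_std_normal_distribution)
  qed
  have eq: "(\<Prod>b\<in>Basis. complex_of_real (std_normal_density (x \<bullet> b)) * iexp ((x \<bullet> b) * (y \<bullet> b))) =
      complex_of_real (gauss x) * iexp (x \<bullet> y)" for x y :: 'a
  proof -
    have "(\<Prod>b\<in>Basis. iexp ((x \<bullet> b) * (y \<bullet> b))) = iexp (x \<bullet> y)"
      unfolding exp_sum [OF finite_Basis, symmetric] sum_distrib_left [symmetric] of_real_sum [symmetric]
        euclidean_inner[of x y, symmetric] ..
    then show ?thesis unfolding prod.distrib gauss_eq_prod of_real_prod by simp
  qed
  have I: "integrable lborel (\<lambda>x. complex_of_real (gauss x) * iexp (x \<bullet> y))" for y :: 'a
    using integrable_lborel_prod[of "\<lambda>b x. complex_of_real (std_normal_density x) * iexp (x * (y \<bullet> b))", OF 1]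
    unfolding eq .
  have "(\<integral>x. complex_of_real (gauss x) * iexp (x \<bullet> y) \<partial>lborel) = (\<Prod>b\<in>Basis. complex_of_real (exp (- (y \<bullet> b)\<^sup>2 / 2)))"
    using integral_lborel_prod[of "\<lambda>b x. complex_of_real (std_normal_density x) * iexp (x * (y \<bullet> b))", OF 1]
    unfolding eq 2 .
  also have "\<dots> = complex_of_real (exp (- (norm y)\<^sup>2 / 2))"
  proof -
    have norm: "(norm y)\<^sup>2 = (\<Sum>b\<in>Basis. (y \<bullet> b)\<^sup>2)"
      unfolding power2_norm_eq_inner by (subst euclidean_inner) (simp add: power2_eq_square)
    show ?thesis
      unfolding of_real_prod [symmetric] exp_sum [OF finite_Basis, symmetric] norm
        sum_divide_distrib [symmetric] sum_negf ..
  qed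
  finally have "Re (\<integral>x. complex_of_real (gauss x) * iexp (x \<bullet> y) \<partial>lborel) = exp (- (norm y)\<^sup>2 / 2)"
    by simp
  moreover have "Re (\<integral>x. complex_of_real (gauss x) * iexp (x \<bullet> y) \<partial>lborel) =
     (\<integral>x. gauss x * cos (x \<bullet> y) \<partial>lborel)"
    by (subst integral_Re [symmetric, OF I]) (simp add: Re_exp)
  ultimately show "(\<integral>x. gauss x * cos (x \<bullet> y) \<partial>lborel) = exp (- (norm y)\<^sup>2 / 2)" by simp
  show "integrable lborel (gauss :: 'a \<Rightarrow> real)"
    using integrable_Re[OF I[of 0]] by simp
qed

text \<open>Fubini for a kernel that is bounded by one, such as a cosine or a sphere transform.\<close>
lemma integral_swap_bounded:
  fixes f g :: "'a::euclidean_space \<Rightarrow> real"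
  assumes g: "integrable lborel g" and f: "integrable lborel f"
    and k [measurable]: "(\<lambda>p. k (fst p) (snd p)) \<in> borel_measurable (borel \<Otimes>\<^sub>M borel)"
    and k1: "\<And>z x. \<bar>k z x\<bar> \<le> 1"
  shows "(\<integral>z. g z * (\<integral>x. f x * k z x \<partial>lborel) \<partial>lborel) = (\<integral>x. f x * (\<integral>z. g z * k z x \<partial>lborel) \<partial>lborel)"
proof -
  have [measurable]: "f \<in> borel_measurable borel" "g \<in> borel_measurable borel" using f g by simp_all
  have k' [measurable]: "case_prod k \<in> borel_measurable (borel \<Otimes>\<^sub>M borel)"
    using k by (simp add: case_prod_beta')
  have b: "integrable lborel (\<lambda>x. f x * k z x)" for z
  proof (rule Bochner_Integration.integrable_bound[OF f])
    show "AE x in lborel. norm (f x * k z x) \<le> norm (f x)"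
      by (auto simp: abs_mult intro!: mult_left_le k1)
  qed measurable
  have "integrable (lborel \<Otimes>\<^sub>M lborel) (\<lambda>(z, x). g z * (f x * k z x))"
  proof (rule lborel_pair.Fubini_integrable)
    show "AE z in lborel. integrable lborel (\<lambda>x. case (z, x) of (z, x) \<Rightarrow> g z * (f x * k z x))"
      using b by simp
    show "integrable lborel (\<lambda>z. \<integral>x. norm (case (z, x) of (z, x) \<Rightarrow> g z * (f x * k z x)) \<partial>lborel)"
    proof (rule Bochner_Integration.integrable_bound)
      show "integrable lborel (\<lambda>z. \<bar>g z\<bar> * (\<integral>x. \<bar>f x\<bar> \<partial>lborel))" using g by simp
      show "AE z in lborel. norm (\<integral>x. norm (case (z, x) of (z, x) \<Rightarrow> g z * (f x * k z x)) \<partial>lborel)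
         \<le> norm (\<bar>g z\<bar> * (\<integral>x. \<bar>f x\<bar> \<partial>lborel))"
      proof (intro AE_I2)
        fix z
        have "(\<integral>x. \<bar>f x * k z x\<bar> \<partial>lborel) \<le> (\<integral>x. \<bar>f x\<bar> \<partial>lborel)"
        proof (intro integral_mono)
          show "integrable lborel (\<lambda>x. \<bar>f x * k z x\<bar>)" by (rule integrable_abs[OF b])
          show "\<bar>f x * k z x\<bar> \<le> \<bar>f x\<bar>" for x
            unfolding abs_mult by (rule mult_left_le[OF k1]) simp
        qed (use f in simp)
        then show "norm (\<integral>x. norm (case (z, x) of (z, x) \<Rightarrow> g z * (f x * k z x)) \<partial>lborel)
         \<le> norm (\<bar>g z\<bar> * (\<integral>x. \<bar>f x\<bar> \<partial>lborel))"
          by (simp add: abs_mult mult_left_mono)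
      qed
    qed measurable
  qed measurable
  from lborel_pair.Fubini_integral[OF this]
  have "(\<integral>x. (\<integral>z. g z * (f x * k z x) \<partial>lborel) \<partial>lborel) = (\<integral>z. (\<integral>x. g z * (f x * k z x) \<partial>lborel) \<partial>lborel)"
    by simp
  moreover have "(\<lambda>z. g z * (f x * k z x)) = (\<lambda>z. f x * (g z * k z x))" for x
    by (auto simp: mult_ac)
  ultimately show ?thesis by simp
qed

section \<open>Pairing a positive definite function with a measure\<close>

text \<open>The real part of the Fourier transform with kernel \<open>cos (x \<bullet> w)\<close>; for even functions it is the
whole transform, rescaled by \<open>2 \<pi>\<close> compared with the convention \<open>exp (- 2 \<pi> i \<langle>x, y\<rangle>)\<close>.\<close>
definition cos_transform :: "('a::euclidean_space \<Rightarrow> real) \<Rightarrow> 'a \<Rightarrow> real" where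
  "cos_transform f w = (\<integral>x. f x * cos (x \<bullet> w) \<partial>lborel)"

lemma integrable_mult_bounded:
  fixes f k :: "'a::euclidean_space \<Rightarrow> real"
  assumes f: "integrable lborel f" and k: "k \<in> borel_measurable borel" "\<And>x. \<bar>k x\<bar> \<le> B"
  shows "integrable lborel (\<lambda>x. f x * k x)"
proof (rule Bochner_Integration.integrable_bound)
  show "integrable lborel (\<lambda>x. B * f x)" using f by simp
  show "AE x in lborel. norm (f x * k x) \<le> norm (B * f x)"
  proof (intro AE_I2)
    fix x
    have "\<bar>k x\<bar> \<le> \<bar>B\<bar>" using k(2)[of x] by linarith
    then show "norm (f x * k x) \<le> norm (B * f x)"
      by (simp add: abs_mult mult.commute[of "\<bar>B\<bar>"] mult_left_mono)
  qed
qed (use f k in measurable)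

lemma borel_measurable_cos_transform [measurable]:
  assumes [measurable]: "f \<in> borel_measurable borel"
  shows "cos_transform f \<in> borel_measurable borel"
  unfolding cos_transform_def by measurable

lemma abs_cos_transform_le:
  assumes f: "integrable lborel f"
  shows "\<bar>cos_transform f w\<bar> \<le> (\<integral>x. \<bar>f x\<bar> \<partial>lborel)"
proof -
  have "\<bar>cos_transform f w\<bar> \<le> (\<integral>x. \<bar>f x * cos (x \<bullet> w)\<bar> \<partial>lborel)"
    unfolding cos_transform_def using integral_norm_bound[of lborel "\<lambda>x. f x * cos (x \<bullet> w)"] by simp
  also have "\<dots> \<le> (\<integral>x. \<bar>f x\<bar> \<partial>lborel)"
  proof (rule integral_mono)
    show "integrable lborel (\<lambda>x. \<bar>f x * cos (x \<bullet> w)\<bar>)"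
      by (intro integrable_abs integrable_mult_bounded[where B = 1] f) simp_all
    show "integrable lborel (\<lambda>x. \<bar>f x\<bar>)" using f by (rule integrable_abs)
    show "\<bar>f x * cos (x \<bullet> w)\<bar> \<le> \<bar>f x\<bar>" for x
      unfolding abs_mult by (rule mult_left_le) simp_all
  qed
  finally show ?thesis .
qed

lemma radial_cos_transform:
  fixes f :: "real ^ 5 \<Rightarrow> real"
  assumes "radial f" "integrable lborel f"
  shows "radial (cos_transform f)"
  unfolding radial_def cos_transform_def using integral_radial_cos[OF assms] by simp

text \<open>A Gaussian average of the transform of \<open>f\<close> against cosines recovers the convolution of \<open>f\<close>
with a narrow Gaussian, because the transform of a Gaussian is a Gaussian. This is Fourier
inversion with a Gaussian summability factor.\<close>
lemma gauss_smoothing: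
  fixes f :: "'a::euclidean_space \<Rightarrow> real"
  assumes f: "integrable lborel f" and even: "\<And>x. f (- x) = f x" and n: "n > 0"
  shows "(\<integral>z. gauss z * cos_transform f (n *\<^sub>R z) * cos (n * (z \<bullet> y)) \<partial>lborel) =
    (sqrt (2 * pi) / n) ^ DIM('a) * (\<integral>u. gauss u * f (y + (1 / n) *\<^sub>R u) \<partial>lborel)"
proof -
  have [measurable]: "f \<in> borel_measurable borel" using f by simp
  define E :: "'a \<Rightarrow> real" where "E w = exp (- (norm w)\<^sup>2 / 2)" for w
  have [measurable]: "E \<in> borel_measurable borel" unfolding E_def by measurable
  have E1: "\<bar>E w\<bar> \<le> 1" for w by (simp add: E_def)
  have "(\<integral>z. gauss z * cos_transform f (n *\<^sub>R z) * cos (n * (z \<bullet> y)) \<partial>lborel) =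
        (\<integral>z. gauss z * (\<integral>x. f x * (cos (x \<bullet> (n *\<^sub>R z)) * cos (n * (z \<bullet> y))) \<partial>lborel) \<partial>lborel)"
    unfolding cos_transform_def by (simp add: mult.assoc flip: integral_mult_left_zero)
  also have "\<dots> = (\<integral>x. f x * (\<integral>z. gauss z * (cos (x \<bullet> (n *\<^sub>R z)) * cos (n * (z \<bullet> y))) \<partial>lborel) \<partial>lborel)"
  proof (rule integral_swap_bounded[OF integrable_gauss f])
    show "\<bar>cos (x \<bullet> (n *\<^sub>R z)) * cos (n * (z \<bullet> y))\<bar> \<le> 1" for x z
      unfolding abs_mult by (rule mult_le_one) simp_all
  qed measurable
  also have "\<dots> = (\<integral>x. f x * ((E (n *\<^sub>R (x - y)) + E (n *\<^sub>R (x + y))) / 2) \<partial>lborel)"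
  proof (intro Bochner_Integration.integral_cong refl arg_cong2[where f = "(*)"])
    fix x
    have "gauss z * (cos (x \<bullet> (n *\<^sub>R z)) * cos (n * (z \<bullet> y))) =
       (gauss z * cos (z \<bullet> (n *\<^sub>R (x - y))) + gauss z * cos (z \<bullet> (n *\<^sub>R (x + y)))) / 2" for z
      by (simp add: cos_times_cos inner_diff_right inner_add_right inner_commute algebra_simps)
    from Bochner_Integration.integral_cong[OF refl this]
    have "(\<integral>z. gauss z * (cos (x \<bullet> (n *\<^sub>R z)) * cos (n * (z \<bullet> y))) \<partial>lborel) =
      (\<integral>z. (gauss z * cos (z \<bullet> (n *\<^sub>R (x - y))) + gauss z * cos (z \<bullet> (n *\<^sub>R (x + y)))) / 2 \<partial>lborel)" .
    also have "\<dots> = ((\<integral>z. gauss z * cos (z \<bullet> (n *\<^sub>R (x - y))) \<partial>lborel) +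
         (\<integral>z. gauss z * cos (z \<bullet> (n *\<^sub>R (x + y))) \<partial>lborel)) / 2"
      by (subst integral_divide_zero, subst Bochner_Integration.integral_add)
         (auto intro!: integrable_mult_bounded[OF integrable_gauss, where B = 1])
    finally show "(\<integral>z. gauss z * (cos (x \<bullet> (n *\<^sub>R z)) * cos (n * (z \<bullet> y))) \<partial>lborel) =
        (E (n *\<^sub>R (x - y)) + E (n *\<^sub>R (x + y))) / 2"
      unfolding integral_gauss_cos E_def .
  qed
  also have "\<dots> = ((\<integral>x. f x * E (n *\<^sub>R (x - y)) \<partial>lborel) + (\<integral>x. f x * E (n *\<^sub>R (x + y)) \<partial>lborel)) / 2"
  proof -
    have "(\<lambda>x. f x * ((E (n *\<^sub>R (x - y)) + E (n *\<^sub>R (x + y))) / 2)) =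
       (\<lambda>x. (f x * E (n *\<^sub>R (x - y)) + f x * E (n *\<^sub>R (x + y))) / 2)" by (auto simp: field_simps)
    then show ?thesis
      by (simp only:, subst integral_divide_zero, subst Bochner_Integration.integral_add)
         (auto intro!: integrable_mult_bounded[OF f, where B = 1] E1)
  qed
  also have "(\<integral>x. f x * E (n *\<^sub>R (x + y)) \<partial>lborel) = (\<integral>x. f x * E (n *\<^sub>R (x - y)) \<partial>lborel)"
  proof -
    have "f (0 + - 1 *\<^sub>R x) * E (n *\<^sub>R (0 + - 1 *\<^sub>R x + y)) = f x * E (n *\<^sub>R (x - y))" for x
    proof -
      have "norm (n *\<^sub>R (- x + y)) = norm (n *\<^sub>R (x - y))"
        by (metis minus_diff_eq norm_minus_cancel scaleR_minus_right uminus_add_conv_diff diff_conv_add_uminus add.commute)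
      then show ?thesis by (simp add: even E_def)
    qed
    then show ?thesis
      by (subst integral_lborel_affine[of "-1" _ 0]) simp_all
  qed
  also have "((\<integral>x. f x * E (n *\<^sub>R (x - y)) \<partial>lborel) + (\<integral>x. f x * E (n *\<^sub>R (x - y)) \<partial>lborel)) / 2 =
     (\<integral>x. f x * E (n *\<^sub>R (x - y)) \<partial>lborel)" by simp
  also have "\<dots> = \<bar>1 / n\<bar> ^ DIM('a) * (\<integral>u. f (y + (1 / n) *\<^sub>R u) * E (n *\<^sub>R (y + (1 / n) *\<^sub>R u - y)) \<partial>lborel)"
    using n by (intro integral_lborel_affine) simp_all
  also have "\<dots> = \<bar>1 / n\<bar> ^ DIM('a) * (\<integral>u. sqrt (2 * pi) ^ DIM('a) * (gauss u * f (y + (1 / n) *\<^sub>R u)) \<partial>lborel)"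
  proof -
    have "f (y + (1 / n) *\<^sub>R u) * E (n *\<^sub>R (y + (1 / n) *\<^sub>R u - y)) = sqrt (2 * pi) ^ DIM('a) * (gauss u * f (y + (1 / n) *\<^sub>R u))" for u
      using n by (simp add: E_def gauss_def)
    then show ?thesis by (simp only:)
  qed
  also have "\<dots> = (sqrt (2 * pi) / n) ^ DIM('a) * (\<integral>u. gauss u * f (y + (1 / n) *\<^sub>R u) \<partial>lborel)"
    unfolding integral_mult_right_zero using n by (simp add: power_divide power_one_over)
  finally show ?thesis .
qed

lemma integral_gauss: "(\<integral>x. gauss (x::'a::euclidean_space) \<partial>lborel) = 1"
  using integral_gauss_cos[of "0::'a"] by simp

lemma gauss_smoothing_tendsto:
  fixes f :: "'a::euclidean_space \<Rightarrow> real"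
  assumes cont: "continuous_on UNIV f" and B: "\<And>x. \<bar>f x\<bar> \<le> B"
  shows "(\<lambda>n. \<integral>u. gauss u * f (y + (1 / real (Suc n)) *\<^sub>R u) \<partial>lborel) \<longlonglongrightarrow> f y"
proof -
  have [measurable]: "f \<in> borel_measurable borel" using cont by (rule borel_measurable_continuous_onI)
  have "(\<lambda>n. \<integral>u. gauss u * f (y + (1 / real (Suc n)) *\<^sub>R u) \<partial>lborel) \<longlonglongrightarrow> (\<integral>u. gauss (u::'a) * f y \<partial>lborel)"
  proof (rule integral_dominated_convergence)
    show "integrable lborel (\<lambda>u::'a. gauss u * B)" by (simp add: integrable_gauss)
    show "AE u in lborel. (\<lambda>n. gauss u * f (y + (1 / real (Suc n)) *\<^sub>R u)) \<longlonglongrightarrow> gauss u * f y"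
    proof (intro AE_I2 tendsto_mult tendsto_const)
      fix u :: 'a
      have "(\<lambda>n. y + (1 / real (Suc n)) *\<^sub>R u) \<longlonglongrightarrow> y + 0 *\<^sub>R u"
        by (intro tendsto_intros) (rule LIMSEQ_Suc[OF lim_1_over_n])
      then show "(\<lambda>n. f (y + (1 / real (Suc n)) *\<^sub>R u)) \<longlonglongrightarrow> f y"
        by (intro continuous_on_tendsto_compose[OF cont]) simp_all
    qed
    show "AE u in lborel. norm (gauss u * f (y + (1 / real (Suc n)) *\<^sub>R u)) \<le> gauss u * B" for n
      using B by (auto simp: abs_mult intro!: mult_left_mono)
  qed measurable
  then show ?thesis by (simp add: integral_gauss)
qed

lemma abs_gauss_smoothing_le:
  fixes f :: "'a::euclidean_space \<Rightarrow> real"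
  assumes [measurable]: "f \<in> borel_measurable borel" and B: "\<And>x. \<bar>f x\<bar> \<le> B"
  shows "\<bar>\<integral>u. gauss u * f (y + a *\<^sub>R u) \<partial>lborel\<bar> \<le> B"
proof -
  have "\<bar>\<integral>u. gauss u * f (y + a *\<^sub>R u) \<partial>lborel\<bar> \<le> (\<integral>u. \<bar>gauss u * f (y + a *\<^sub>R u)\<bar> \<partial>lborel)"
    using integral_norm_bound[of lborel "\<lambda>u. gauss u * f (y + a *\<^sub>R u)"] by simp
  also have "\<dots> \<le> (\<integral>u. gauss (u::'a) * B \<partial>lborel)"
  proof (rule integral_mono)
    show "integrable lborel (\<lambda>u. \<bar>gauss u * f (y + a *\<^sub>R u)\<bar>)"
      by (intro integrable_abs integrable_mult_bounded[OF integrable_gauss _ B]) measurable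
    show "integrable lborel (\<lambda>u::'a. gauss u * B)" by (simp add: integrable_gauss)
    show "\<bar>gauss u * f (y + a *\<^sub>R u)\<bar> \<le> gauss u * B" for u
      using B by (simp add: abs_mult mult_left_mono)
  qed
  finally show ?thesis by (simp add: integral_gauss)
qed

text \<open>If the transform of \<open>f\<close> and that of the measure \<open>\<Sum> c(v) \<delta>\<^sub>v + p dy\<close>, averaged over
rotations, are nonnegative, then so is the integral of \<open>f\<close> against the measure. By
\<open>gauss_smoothing\<close>, the smoothed \<open>f\<close> at \<open>y\<close> is an integral of \<open>sphere_ft (N |z| |y|)\<close> with the
nonnegative weight \<open>w z\<close>; exchanging the integrals leaves \<open>w\<close> times the transform of the measure.
The finitely many point masses stand for spheres, as \<open>f\<close> is radial.\<close>
lemma radial_positive_definite_pairing: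
  fixes f :: "real ^ 5 \<Rightarrow> real" and p :: "real ^ 5 \<Rightarrow> real" and c :: "real ^ 5 \<Rightarrow> real"
  assumes rad: "radial f" and cont: "continuous_on UNIV f" and B: "\<And>x. \<bar>f x\<bar> \<le> B"
    and f: "integrable lborel f" and pos: "\<And>w. cos_transform f w \<ge> 0"
    and V: "finite V" and p: "integrable lborel p"
    and F: "\<And>t. t \<ge> 0 \<Longrightarrow> (\<Sum>v\<in>V. c v * sphere_ft (t * norm v)) + (\<integral>y. p y * sphere_ft (t * norm y) \<partial>lborel) \<ge> 0"
  shows "(\<Sum>v\<in>V. c v * f v) + (\<integral>y. p y * f y \<partial>lborel) \<ge> 0"
proof -
  have [measurable]: "f \<in> borel_measurable borel" "p \<in> borel_measurable borel" using f p by simp_all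
  define m where "m n y = (\<integral>u. gauss u * f (y + (1 / real (Suc n)) *\<^sub>R u) \<partial>lborel)" for n y
  have [measurable]: "m n \<in> borel_measurable borel" for n unfolding m_def by measurable
  have mB: "\<bar>m n y\<bar> \<le> B" for n y
    unfolding m_def by (rule abs_gauss_smoothing_le[OF _ B]) measurable
  have step: "(\<Sum>v\<in>V. c v * m n v) + (\<integral>y. p y * m n y \<partial>lborel) \<ge> 0" for n
  proof -
    define N where "N = real (Suc n)"
    have N: "N > 0" by (simp add: N_def)
    define K where "K = (sqrt (2 * pi) / N) ^ DIM(real ^ 5)"
    have K: "K > 0" using N by (simp add: K_def)
    define w where "w z = gauss z * cos_transform f (N *\<^sub>R z)" for z
    have w: "integrable lborel w"
      unfolding w_def by (rule integrable_mult_bounded[OF integrable_gauss _ abs_cos_transform_le[OF f]]) measurable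
    have w0: "w z \<ge> 0" for z unfolding w_def by (intro mult_nonneg_nonneg pos gauss_nonneg)
    have "radial w"
      unfolding radial_def
    proof (intro allI impI)
      fix x y :: "real ^ 5" assume xy: "norm x = norm y"
      have "cos_transform f (N *\<^sub>R x) = cos_transform f (N *\<^sub>R y)"
        using xy by (intro radial_cos_transform[OF rad f, unfolded radial_def, rule_format]) simp
      then show "w x = w y" using xy by (simp add: w_def gauss_def)
    qed
    have J: "K * m n y = (\<integral>z. w z * sphere_ft (N * norm z * norm y) \<partial>lborel)" for y
    proof -
      have "K * m n y = (\<integral>z. gauss z * cos_transform f (N *\<^sub>R z) * cos (N * (z \<bullet> y)) \<partial>lborel)"
        unfolding K_def m_def N_def [symmetric]
        by (rule gauss_smoothing [symmetric, OF f _ N]) (rule rad[unfolded radial_def, rule_format], simp)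
      also have "\<dots> = (\<integral>z. w z * cos (z \<bullet> (N *\<^sub>R y)) \<partial>lborel)"
        by (simp add: w_def)
      also have "\<dots> = (\<integral>z. w z * sphere_ft (norm (N *\<^sub>R y) * norm z) \<partial>lborel)"
        by (rule integral_radial_cos[OF \<open>radial w\<close> w])
      finally show ?thesis using N by (simp add: mult_ac)
    qed
    have int: "integrable lborel (\<lambda>z. w z * sphere_ft (N * norm z * norm y))" for y
      by (rule integrable_mult_bounded[OF w _ abs_sphere_ft_le_1]) measurable
    have "K * ((\<Sum>v\<in>V. c v * m n v) + (\<integral>y. p y * m n y \<partial>lborel)) =
      (\<Sum>v\<in>V. c v * (K * m n v)) + (\<integral>y. p y * (K * m n y) \<partial>lborel)"
    proof -
      have "(\<integral>y. p y * (K * m n y) \<partial>lborel) = K * (\<integral>y. p y * m n y \<partial>lborel)"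
        by (subst integral_mult_right_zero [symmetric]) (simp add: mult_ac)
      then show ?thesis by (simp add: distrib_left sum_distrib_left mult_ac)
    qed
    also have "(\<integral>y. p y * (K * m n y) \<partial>lborel) =
        (\<integral>z. w z * (\<integral>y. p y * sphere_ft (N * norm z * norm y) \<partial>lborel) \<partial>lborel)"
      unfolding J by (rule integral_swap_bounded [symmetric, OF w p _ abs_sphere_ft_le_1]) measurable
    also have "(\<Sum>v\<in>V. c v * (K * m n v)) = (\<integral>z. w z * (\<Sum>v\<in>V. c v * sphere_ft (N * norm z * norm v)) \<partial>lborel)"
    proof -
      have "(\<Sum>v\<in>V. c v * (K * m n v)) = (\<Sum>v\<in>V. \<integral>z. c v * (w z * sphere_ft (N * norm z * norm v)) \<partial>lborel)"
        unfolding J by simp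
      also have "\<dots> = (\<integral>z. (\<Sum>v\<in>V. c v * (w z * sphere_ft (N * norm z * norm v))) \<partial>lborel)"
        by (rule Bochner_Integration.integral_sum [symmetric]) (simp add: int)
      also have "\<dots> = (\<integral>z. w z * (\<Sum>v\<in>V. c v * sphere_ft (N * norm z * norm v)) \<partial>lborel)"
        by (simp add: sum_distrib_left mult_ac)
      finally show ?thesis .
    qed
    also have "(\<integral>z. w z * (\<Sum>v\<in>V. c v * sphere_ft (N * norm z * norm v)) \<partial>lborel) +
        (\<integral>z. w z * (\<integral>y. p y * sphere_ft (N * norm z * norm y) \<partial>lborel) \<partial>lborel) =
      (\<integral>z. w z * (\<Sum>v\<in>V. c v * sphere_ft (N * norm z * norm v)) +
        w z * (\<integral>y. p y * sphere_ft (N * norm z * norm y) \<partial>lborel) \<partial>lborel)"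
    proof (rule Bochner_Integration.integral_add [symmetric])
      show "integrable lborel (\<lambda>z. w z * (\<Sum>v\<in>V. c v * sphere_ft (N * norm z * norm v)))"
      proof (rule integrable_mult_bounded[OF w])
        fix z :: "real ^ 5"
        have "\<bar>\<Sum>v\<in>V. c v * sphere_ft (N * norm z * norm v)\<bar> \<le> (\<Sum>v\<in>V. \<bar>c v * sphere_ft (N * norm z * norm v)\<bar>)"
          by (rule sum_abs)
        also have "\<dots> \<le> (\<Sum>v\<in>V. \<bar>c v\<bar>)"
          by (intro sum_mono) (simp add: abs_mult mult_left_le abs_sphere_ft_le_1)
        finally show "\<bar>\<Sum>v\<in>V. c v * sphere_ft (N * norm z * norm v)\<bar> \<le> (\<Sum>v\<in>V. \<bar>c v\<bar>)" .
      qed measurable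
      show "integrable lborel (\<lambda>z. w z * (\<integral>y. p y * sphere_ft (N * norm z * norm y) \<partial>lborel))"
      proof (rule integrable_mult_bounded[OF w])
        fix z :: "real ^ 5"
        have "\<bar>\<integral>y. p y * sphere_ft (N * norm z * norm y) \<partial>lborel\<bar> \<le> (\<integral>y. \<bar>p y * sphere_ft (N * norm z * norm y)\<bar> \<partial>lborel)"
          using integral_norm_bound[of lborel "\<lambda>y. p y * sphere_ft (N * norm z * norm y)"] by simp
        also have "\<dots> \<le> (\<integral>y. \<bar>p y\<bar> \<partial>lborel)"
          using p by (intro integral_mono integrable_abs integrable_mult_bounded[OF p _ abs_sphere_ft_le_1])
             (auto simp: abs_mult intro!: mult_left_le abs_sphere_ft_le_1)
        finally show "\<bar>\<integral>y. p y * sphere_ft (N * norm z * norm y) \<partial>lborel\<bar> \<le> (\<integral>y. \<bar>p y\<bar> \<partial>lborel)" .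
      qed measurable
    qed
    also have "\<dots> \<ge> 0"
      unfolding distrib_left [symmetric] using N
      by (intro integral_nonneg_AE AE_I2 mult_nonneg_nonneg w0 F) simp_all
    finally show ?thesis using K by (simp add: zero_le_mult_iff)
  qed
  have "(\<lambda>n. (\<Sum>v\<in>V. c v * m n v) + (\<integral>y. p y * m n y \<partial>lborel)) \<longlonglongrightarrow> (\<Sum>v\<in>V. c v * f v) + (\<integral>y. p y * f y \<partial>lborel)"
  proof (intro tendsto_add tendsto_sum tendsto_mult tendsto_const)
    show "(\<lambda>n. m n v) \<longlonglongrightarrow> f v" for v
      unfolding m_def by (rule gauss_smoothing_tendsto[OF cont B])
    show "(\<lambda>n. \<integral>y. p y * m n y \<partial>lborel) \<longlonglongrightarrow> (\<integral>y. p y * f y \<partial>lborel)"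
    proof (rule integral_dominated_convergence)
      show "integrable lborel (\<lambda>y. \<bar>p y\<bar> * B)" using p by simp
      show "AE y in lborel. (\<lambda>n. p y * m n y) \<longlonglongrightarrow> p y * f y"
        unfolding m_def by (intro AE_I2 tendsto_mult tendsto_const gauss_smoothing_tendsto[OF cont B])
      show "AE y in lborel. norm (p y * m n y) \<le> \<bar>p y\<bar> * B" for n
        using mB by (auto simp: abs_mult intro!: mult_left_mono)
    qed measurable
  qed
  then show ?thesis
    by (rule LIMSEQ_le_const) (use step in auto)
qed

section \<open>The dual measure and the bound it gives\<close>

text \<open>Up to the factor \<open>3 / (8 \<pi>\<^sup>2)\<close>, the density that the dual measure subtracts inside the ball of
radius \<open>1.53\<close> and that has to be nonnegative outside. It is a positive constant plus positive multiples of
the transforms of spheres of radii \<open>9.97\<close> and \<open>14.92\<close>.\<close>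
definition tail :: "real \<Rightarrow> real" where
  "tail r = 8276 / 100 + 39635 / 10 * sphere_ft (997 / 100 * r) + 119401 / 10 * sphere_ft (1492 / 100 * r)"

text \<open>The Fourier transform of the dual measure: a unit mass at the origin, masses on the spheres of
radii \<open>1\<close> and \<open>1.48\<close>, and the negative density inside the ball of radius \<open>1.53\<close>. The weight
of the second sphere is \<open>(769 / 24) * 1.48\<^sup>3\<close>, so that the cube cancels in the closed form.\<close>
definition dual_ft :: "real \<Rightarrow> real" where
  "dual_ft t = 1 + 4759 / 100 * sphere_ft t + 38952157 / 375000 * sphere_ft (148 / 100 * t) -
     integral {0..153 / 100} (\<lambda>r. r ^ 4 * tail r * sphere_ft (t * r))"

lemma borel_measurable_tail [measurable]: "tail \<in> borel_measurable borel"
  unfolding tail_def by measurable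

lemma abs_tail_le: "\<bar>tail r\<bar> \<le> 20000"
  using abs_sphere_ft_le_1[of "997 / 100 * r"] abs_sphere_ft_le_1[of "1492 / 100 * r"]
  unfolding tail_def abs_le_iff by linarith

lemma continuous_on_sphere_ft [continuous_intros]:
  "continuous_on S f \<Longrightarrow> continuous_on S (\<lambda>x. sphere_ft (f x))"
  using continuous_on_compose2[of UNIV sphere_ft S f] isCont_sphere_ft
  by (simp add: continuous_at_imp_continuous_on)

lemma continuous_on_tail: "continuous_on S tail"
  unfolding tail_def by (intro continuous_intros)

lemma integral_tail_ball:
  "(\<integral>x. indicator (ball (0::real^5) (153 / 100)) x * tail (norm x) * sphere_ft (t * norm x) \<partial>lborel) =
     8 * pi\<^sup>2 / 3 * integral {0..153 / 100} (\<lambda>r. r ^ 4 * tail r * sphere_ft (t * r))"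
proof -
  let ?L = "153 / 100 :: real"
  define \<phi> where "\<phi> r = indicator {..<?L} r * tail r * sphere_ft (t * r)" for r
  have [measurable]: "\<phi> \<in> borel_measurable borel" unfolding \<phi>_def by measurable
  have "(\<integral>x. indicator (ball (0::real^5) ?L) x * tail (norm x) * sphere_ft (t * norm x) \<partial>lborel) =
        (\<integral>x. \<phi> (norm (x::real^5)) \<partial>lborel)"
    by (intro Bochner_Integration.integral_cong) (auto simp: \<phi>_def indicator_def)
  also have "\<dots> = (\<integral>r. 8 * pi\<^sup>2 / 3 * r ^ 4 * indicator {0..} r * \<phi> r \<partial>lborel)"
    by (rule integral_radial) simp_all
  also have "\<dots> = (\<integral>r. 8 * pi\<^sup>2 / 3 * (indicator {0..?L} r *\<^sub>R (r ^ 4 * tail r * sphere_ft (t * r))) \<partial>lborel)"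
  proof (rule integral_cong_AE)
    show "AE r in lborel. 8 * pi\<^sup>2 / 3 * r ^ 4 * indicator {0..} r * \<phi> r =
        8 * pi\<^sup>2 / 3 * (indicator {0..?L} r *\<^sub>R (r ^ 4 * tail r * sphere_ft (t * r)))"
      using AE_lborel_singleton[of ?L] by eventually_elim (auto simp: \<phi>_def indicator_def)
  qed measurable
  also have "\<dots> = 8 * pi\<^sup>2 / 3 * (\<integral>r. indicator {0..?L} r *\<^sub>R (r ^ 4 * tail r * sphere_ft (t * r)) \<partial>lborel)"
    by simp
  also have "(\<integral>r. indicator {0..?L} r *\<^sub>R (r ^ 4 * tail r * sphere_ft (t * r)) \<partial>lborel) =
     integral {0..?L} (\<lambda>r. r ^ 4 * tail r * sphere_ft (t * r))"
  proof -
    have "continuous_on {0..?L} (\<lambda>r. r ^ 4 * tail r * sphere_ft (t * r))"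
      by (intro continuous_intros continuous_on_tail)
    then have "set_integrable lborel {0..?L} (\<lambda>r. r ^ 4 * tail r * sphere_ft (t * r))"
      by (rule borel_integrable_atLeastAtMost'[unfolded set_integrable_def[symmetric]])
    from set_borel_integral_eq_integral(2)[OF this] show ?thesis
      by (simp add: set_lebesgue_integral_def)
  qed
  finally show ?thesis .
qed

text \<open>The duality argument at scale \<open>1\<close>. Pairing \<open>g\<close> with the dual measure bounds \<open>g 0\<close> from below
by the integral of \<open>g\<close> times the density over the ball. Extending this integral to the whole space
only decreases it, and it then equals the constant part of the density times \<open>\<integral> g\<close> plus
nonnegative values of the transform of \<open>g\<close>.\<close>
lemma unit_scale_bound:
  fixes g :: "real ^ 5 \<Rightarrow> real"
  assumes rad: "radial g" and cont: "continuous_on UNIV g" and B: "\<And>x. \<bar>g x\<bar> \<le> B"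
    and g: "integrable lborel g" and pos: "\<And>w. cos_transform g w \<ge> 0"
    and neg: "\<And>x. norm x \<ge> 1 \<Longrightarrow> g x \<le> 0"
    and F: "\<And>t. t \<ge> 0 \<Longrightarrow> dual_ft t \<ge> 0" and H: "\<And>r. r \<ge> 153 / 100 \<Longrightarrow> tail r \<ge> 0"
  shows "3 / (8 * pi\<^sup>2) * (8276 / 100) * (\<integral>x. g x \<partial>lborel) \<le> g 0"
proof -
  let ?L = "153 / 100 :: real" and ?k = "3 / (8 * pi\<^sup>2)"
  have [measurable]: "g \<in> borel_measurable borel" using g by simp
  define e :: "real ^ 5" where "e = axis 1 1"
  have e: "norm e = 1" by (simp add: e_def)
  have e0: "e \<noteq> 0" using e by auto
  define p where "p x = - ?k * (indicator (ball 0 ?L) x * tail (norm x))" for x :: "real ^ 5"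
  have p: "integrable lborel p"
  proof -
    have "integrable lborel (\<lambda>x::real^5. - ?k * (indicator (ball 0 ?L) x * tail (norm x)))"
      using emeasure_lborel_ball_finite[of "0::real^5" ?L]
      by (intro integrable_mult_right integrable_mult_bounded[where B = 20000] abs_tail_le integrable_real_indicator) simp_all
    then show ?thesis unfolding p_def .
  qed
  \<comment> \<open>One point on each sphere represents the sphere.\<close>
  define c :: "real ^ 5 \<Rightarrow> real" where "c v = (if v = 0 then 1 else if v = e then 4759 / 100 else 38952157 / 375000)" for v
  have ne: "(148 / 100) *\<^sub>R e \<noteq> e" "(148 / 100) *\<^sub>R e \<noteq> 0"
  proof -
    have "norm ((148 / 100) *\<^sub>R e) \<noteq> norm e" "norm ((148 / 100) *\<^sub>R e) \<noteq> 0" using e by simp_all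
    then show "(148 / 100) *\<^sub>R e \<noteq> e" "(148 / 100) *\<^sub>R e \<noteq> 0" by (metis, metis norm_zero)
  qed
  have "(\<Sum>v\<in>{0, e, (148 / 100) *\<^sub>R e}. c v * g v) + (\<integral>y. p y * g y \<partial>lborel) \<ge> 0"
  proof (rule radial_positive_definite_pairing[OF rad cont B g pos _ p])
    fix t :: real assume t: "t \<ge> 0"
    have "(\<integral>y. p y * sphere_ft (t * norm y) \<partial>lborel) =
        - ?k * (\<integral>x. indicator (ball (0::real^5) ?L) x * tail (norm x) * sphere_ft (t * norm x) \<partial>lborel)"
      unfolding integral_mult_right_zero [symmetric] p_def
      by (intro Bochner_Integration.integral_cong) auto
    also have "\<dots> = - integral {0..?L} (\<lambda>r. r ^ 4 * tail r * sphere_ft (t * r))"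
      unfolding integral_tail_ball by simp
    finally have "(\<Sum>v\<in>{0, e, (148 / 100) *\<^sub>R e}. c v * sphere_ft (t * norm v)) +
       (\<integral>y. p y * sphere_ft (t * norm y) \<partial>lborel) = dual_ft t"
      using e e0 ne by (simp add: dual_ft_def c_def mult_ac)
    then show "(\<Sum>v\<in>{0, e, (148 / 100) *\<^sub>R e}. c v * sphere_ft (t * norm v)) +
       (\<integral>y. p y * sphere_ft (t * norm y) \<partial>lborel) \<ge> 0" using F[OF t] by simp
  qed simp
  moreover have "g e \<le> 0" "g ((148 / 100) *\<^sub>R e) \<le> 0"
    using e by (auto intro!: neg)
  ultimately have 1: "g 0 + (\<integral>y. p y * g y \<partial>lborel) \<ge> 0"
    using e0 ne by (simp add: c_def)
  have it: "integrable lborel (\<lambda>x. g x * tail (norm x))"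
    by (rule integrable_mult_bounded[OF g _ abs_tail_le]) measurable
  have ii: "integrable lborel (\<lambda>x. g x * tail (norm x) * indicator (ball 0 ?L) x)"
    by (rule integrable_mult_bounded[OF it, where B = 1]) (simp_all add: indicator_def)
  have "(\<integral>y. p y * g y \<partial>lborel) = - ?k * (\<integral>x. g x * tail (norm x) * indicator (ball 0 ?L) x \<partial>lborel)"
    unfolding integral_mult_right_zero [symmetric] p_def
    by (intro Bochner_Integration.integral_cong) auto
  moreover have "(\<integral>x. g x * tail (norm x) \<partial>lborel) \<le> (\<integral>x. g x * tail (norm x) * indicator (ball 0 ?L) x \<partial>lborel)"
  proof (rule integral_mono[OF it ii])
    fix x :: "real ^ 5"
    show "g x * tail (norm x) \<le> g x * tail (norm x) * indicator (ball 0 ?L) x"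
    proof (cases "norm x < ?L")
      case False
      then show ?thesis using neg[of x] H[of "norm x"] by (simp add: mult_nonpos_nonneg)
    qed (simp add: indicator_def)
  qed
  moreover have "(\<integral>x. g x * tail (norm x) \<partial>lborel) \<ge> 8276 / 100 * (\<integral>x. g x \<partial>lborel)"
  proof -
    have w: "(\<integral>x. g x * sphere_ft (a * norm x) \<partial>lborel) \<ge> 0"
      "integrable lborel (\<lambda>x. g x * sphere_ft (a * norm x))" if "a \<ge> 0" for a
    proof -
      have "(\<integral>x. g x * sphere_ft (a * norm x) \<partial>lborel) = cos_transform g (a *\<^sub>R e)"
        unfolding cos_transform_def integral_radial_cos[OF rad g] using e that by simp
      then show "(\<integral>x. g x * sphere_ft (a * norm x) \<partial>lborel) \<ge> 0" using pos by simp
      show "integrable lborel (\<lambda>x. g x * sphere_ft (a * norm x))"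
        by (rule integrable_mult_bounded[OF g _ abs_sphere_ft_le_1]) measurable
    qed
    have "(\<lambda>x. g x * tail (norm x)) = (\<lambda>x. 8276 / 100 * g x + 39635 / 10 * (g x * sphere_ft (997 / 100 * norm x)) +
       119401 / 10 * (g x * sphere_ft (1492 / 100 * norm x)))"
      by (auto simp: tail_def algebra_simps)
    then have "(\<integral>x. g x * tail (norm x) \<partial>lborel) = 8276 / 100 * (\<integral>x. g x \<partial>lborel) +
       39635 / 10 * (\<integral>x. g x * sphere_ft (997 / 100 * norm x) \<partial>lborel) +
       119401 / 10 * (\<integral>x. g x * sphere_ft (1492 / 100 * norm x) \<partial>lborel)"
      using g w(2)[of "997 / 100"] w(2)[of "1492 / 100"] by simp
    then show ?thesis using w(1)[of "997 / 100"] w(1)[of "1492 / 100"] by simp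
  qed
  ultimately have "?k * (8276 / 100 * (\<integral>x. g x \<partial>lborel)) \<le> ?k * (\<integral>x. g x * tail (norm x) * indicator (ball 0 ?L) x \<partial>lborel)"
    by (intro mult_left_mono) auto
  then show ?thesis using 1 \<open>(\<integral>y. p y * g y \<partial>lborel) = _\<close> by (simp add: mult.assoc)
qed

text \<open>Transfers \<open>unit_scale_bound\<close> to an admissible \<open>f\<close> through \<open>g x = f (r x)\<close>.\<close>
lemma admissible_lower_bound:
  fixes f :: "real ^ 5 \<Rightarrow> real"
  assumes r: "r > 0" and adm: "cohn_elkies_admissible r f"
    and F: "\<And>t. t \<ge> 0 \<Longrightarrow> dual_ft t \<ge> 0" and H: "\<And>r. r \<ge> 153 / 100 \<Longrightarrow> tail r \<ge> 0"
  shows "(r / 2) ^ 5 * f 0 \<ge> 3 / (8 * pi\<^sup>2) * (8276 / 100) / 32"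
proof -
  from adm have rad: "radial f" and "smooth f" and rd: "rapidly_decreasing f"
    and f0: "fourier (\<lambda>x. complex_of_real (f x)) 0 \<ge> 1" and neg: "\<And>x. norm x \<ge> r \<Longrightarrow> f x \<le> 0"
    and fpos: "\<And>y. fourier (\<lambda>x. complex_of_real (f x)) y \<ge> 0"
    by (auto simp: cohn_elkies_admissible_def)
  have cont: "continuous_on UNIV f"
    using \<open>smooth f\<close>[unfolded smooth_def, rule_format, of 0] by simp
  then have [measurable]: "f \<in> borel_measurable borel" by (rule borel_measurable_continuous_onI)
  obtain B where B: "\<And>x. \<bar>f x\<bar> \<le> B"
  proof -
    obtain C where C: "\<And>x. \<bar>f x\<bar> \<le> C * inverse ((1 + norm x) ^ 1)"
      using rd[unfolded rapidly_decreasing_def, rule_format, of 1] by auto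
    have "\<bar>f x\<bar> \<le> \<bar>C\<bar>" for x
    proof -
      have "C * inverse ((1 + norm x) ^ 1) \<le> \<bar>C\<bar> * 1"
        by (intro mult_mono) (auto simp: field_simps add_pos_nonneg)
      with C[of x] show ?thesis by linarith
    qed
    then show ?thesis using that by blast
  qed
  \<comment> \<open>The Bochner integral of a non-integrable function is \<open>0\<close>, so the normalisation forces integrability.\<close>
  have "integrable lborel (\<lambda>x. complex_of_real (f x))"
  proof (rule ccontr)
    assume "\<not> integrable lborel (\<lambda>x. complex_of_real (f x))"
    then have "(\<integral>x. complex_of_real (f x) \<partial>lborel) = 0" by (rule not_integrable_integral_eq)
    then have "fourier (\<lambda>x. complex_of_real (f x)) 0 = 0" by (simp add: fourier_def)
    with f0 show False by (simp add: less_eq_complex_def)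
  qed
  from integrable_Re[OF this] have f: "integrable lborel f" by simp
  have Re_fourier: "Re (fourier (\<lambda>x. complex_of_real (f x)) y) = cos_transform f ((2 * pi) *\<^sub>R y)" for y
  proof -
    have "integrable lborel (\<lambda>x. complex_of_real (f x) * exp (- 2 * of_real pi * \<i> * of_real (x \<bullet> y)))"
      by (rule Bochner_Integration.integrable_bound[OF f]) (simp_all add: norm_mult)
    then show ?thesis
      unfolding fourier_def cos_transform_def
      by (subst integral_Re [symmetric]) (simp_all add: Re_exp mult_ac)
  qed
  define g where "g x = f (r *\<^sub>R x)" for x
  have trans: "r ^ 5 * cos_transform g w = cos_transform f ((1 / r) *\<^sub>R w)" for w
    unfolding cos_transform_def g_def
    by (subst integral_lborel_affine[of r "\<lambda>x. f x * cos (x \<bullet> ((1 / r) *\<^sub>R w))" 0]) (use r in simp_all)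
  have pos: "cos_transform g w \<ge> 0" for w
  proof -
    have "cos_transform f ((2 * pi) *\<^sub>R ((1 / (2 * pi)) *\<^sub>R (1 / r) *\<^sub>R w)) \<ge> 0"
      unfolding Re_fourier [symmetric] using fpos by (simp add: less_eq_complex_def)
    then have "r ^ 5 * cos_transform g w \<ge> 0" unfolding trans by simp
    then show ?thesis using r by (simp add: zero_le_mult_iff)
  qed
  have int: "r ^ 5 * (\<integral>x. g x \<partial>lborel) \<ge> 1"
  proof -
    have "cos_transform f 0 \<ge> 1"
      using f0 Re_fourier[of 0] by (simp add: less_eq_complex_def)
    then show ?thesis using trans[of 0] by (simp add: cos_transform_def)
  qed
  have "3 / (8 * pi\<^sup>2) * (8276 / 100) * (\<integral>x. g x \<partial>lborel) \<le> g 0"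
  proof (rule unit_scale_bound[OF _ _ _ _ pos _ F H])
    show "radial g"
      unfolding radial_def g_def
      by (intro allI impI rad[unfolded radial_def, rule_format]) simp
    show "continuous_on UNIV g"
      unfolding g_def by (intro continuous_on_compose2[OF cont] continuous_intros) simp
    show "\<bar>g x\<bar> \<le> B" for x unfolding g_def by (rule B)
    show "integrable lborel g"
      using integrable_lborel_affine_iff[of r f 0] r f by (simp add: g_def[abs_def])
    show "g x \<le> 0" if "norm x \<ge> 1" for x
      unfolding g_def using r that by (intro neg) simp
  qed
  then have "r ^ 5 * (3 / (8 * pi\<^sup>2) * (8276 / 100) * (\<integral>x. g x \<partial>lborel)) \<le> r ^ 5 * f 0"
    using r by (intro mult_left_mono) (simp_all add: g_def)
  then have "3 / (8 * pi\<^sup>2) * (8276 / 100) * (r ^ 5 * (\<integral>x. g x \<partial>lborel)) \<le> r ^ 5 * f 0"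
    by (simp only: mult.left_commute)
  moreover have "3 / (8 * pi\<^sup>2) * (8276 / 100) * 1 \<le> 3 / (8 * pi\<^sup>2) * (8276 / 100) * (r ^ 5 * (\<integral>x. g x \<partial>lborel))"
    using int by (intro mult_left_mono) auto
  ultimately show ?thesis by (simp add: power_divide)
qed

section \<open>Positivity of the density outside the ball\<close>

text \<open>For a lower bound only positive values of the cosine matter, and the bound decreases in size along
the half-line.\<close>
lemma sphere_ft_lower:
  assumes "x \<ge> y" "y > 0" "cos x \<le> c" "0 \<le> c"
  shows "sphere_ft x \<ge> - 3 * (1 / y ^ 3 + c / y\<^sup>2)"
proof -
  have x: "x > 0" using assms by linarith
  have "x * cos x \<le> x * c" using x assms by (intro mult_left_mono) auto
  then have "sin x - x * cos x \<ge> - (1 + c * x)"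
    using sin_ge_minus_one[of x] mult.commute[of x c] by linarith
  then have "sphere_ft x \<ge> 3 * (- (1 + c * x)) / x ^ 3"
    using x by (simp add: sphere_ft_def divide_right_mono)
  also have "3 * (- (1 + c * x)) / x ^ 3 = - 3 * (1 / x ^ 3 + c / x\<^sup>2)"
    using x by (simp add: field_simps eval_nat_numeral)
  finally have "- 3 * (1 / x ^ 3 + c / x\<^sup>2) \<le> sphere_ft x" .
  moreover have "1 / x ^ 3 \<le> 1 / y ^ 3" "c / x\<^sup>2 \<le> c / y\<^sup>2"
    using assms x by (auto intro!: divide_left_mono power_mono mult_pos_pos)
  then have "- 3 * (1 / y ^ 3 + c / y\<^sup>2) \<le> - 3 * (1 / x ^ 3 + c / x\<^sup>2)"
    by (intro mult_left_mono_neg add_mono) auto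
  ultimately show ?thesis by linarith
qed

lemma abs_sin_minus_le: "\<bar>sin x - x * cos x\<bar> \<le> 1 + x" if "x \<ge> 0" for x :: real
proof -
  have "\<bar>sin x - x * cos x\<bar> \<le> \<bar>sin x\<bar> + x * \<bar>cos x\<bar>"
    using that abs_triangle_ineq4[of "sin x" "x * cos x"] by (simp add: abs_mult)
  also have "\<dots> \<le> 1 + x * 1"
    using that by (intro add_mono mult_left_mono) auto
  finally show ?thesis by simp
qed

lemma abs_sphere_ft_upper:
  assumes "x \<ge> y" "y > 0"
  shows "\<bar>sphere_ft x\<bar> \<le> 3 * (1 / y ^ 3 + 1 / y\<^sup>2)"
proof -
  have x: "x > 0" using assms by linarith
  have "\<bar>sin x - x * cos x\<bar> \<le> 1 + x"
    using x by (intro abs_sin_minus_le) simp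
  then have "\<bar>sphere_ft x\<bar> \<le> 3 * (1 + x) / x ^ 3"
    using x by (simp add: sphere_ft_def abs_mult abs_divide divide_right_mono)
  also have "3 * (1 + x) / x ^ 3 = 3 * (1 / x ^ 3 + 1 / x\<^sup>2)"
    using x by (simp add: field_simps eval_nat_numeral)
  also have "\<dots> \<le> 3 * (1 / y ^ 3 + 1 / y\<^sup>2)"
    using assms x by (intro mult_left_mono add_mono divide_left_mono power_mono mult_pos_pos) auto
  finally show ?thesis .
qed

text \<open>For \<open>r \<ge> 1.9\<close> the plain decay of the two sphere transforms is enough. Closer to \<open>1.53\<close> one of the
cosines is nonpositive or small, because its argument is near an odd multiple of \<open>\<pi>\<close>
(respectively near \<open>11 / 2 * \<pi>\<close>), which removes the leading negative term.\<close>
lemma tail_nonneg: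
  assumes pi: "314159 / 100000 < pi" "pi < 31416 / 10000" and r: "r \<ge> 153 / 100"
  shows "tail r \<ge> 0"
proof -
  have cosn: "cos x = - cos (x - real n * pi)" if "odd n" for x n
    using that by (simp add: cos_diff)
  have cos_nonpos: "cos x \<le> 0" if "odd n" "\<bar>x - real n * pi\<bar> \<le> pi / 2" for x n
  proof -
    have "cos (x - real n * pi) \<ge> 0" using that(2) by (intro cos_ge_zero) linarith+
    then show ?thesis using cosn[OF that(1), of x] by simp
  qed
  have bounds: "tail r \<ge> 8276 / 100 + 39635 / 10 * L1 + 119401 / 10 * L2"
    if "sphere_ft (997 / 100 * r) \<ge> L1" "sphere_ft (1492 / 100 * r) \<ge> L2" for L1 L2
    using that unfolding tail_def by linarith
  \<comment> \<open>For the first frequency \<open>9.97 r\<close> the cosine stays nonpositive up to \<open>11 / 2 * \<pi>\<close>, reached near \<open>r = 1.733\<close>, and is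
    small up to \<open>1.79\<close>; from there to \<open>1.9\<close> the cosine of the second frequency is nonpositive.\<close>
  consider "r \<le> 1733 / 1000" | "1733 / 1000 \<le> r" "r \<le> 179 / 100" | "179 / 100 \<le> r" "r \<le> 19 / 10" | "19 / 10 \<le> r"
    by linarith
  then show ?thesis
  proof cases
    case 1
    have "\<bar>997 / 100 * r - 5 * pi\<bar> \<le> pi / 2"
      using 1 r pi by linarith
    then have "cos (997 / 100 * r) \<le> 0"
      using cos_nonpos[of 5 "997 / 100 * r"] by simp
    then have "sphere_ft (997 / 100 * r) \<ge> - 3 * (1 / (152541 / 10000) ^ 3 + 0 / (152541 / 10000)\<^sup>2)"
      using r by (intro sphere_ft_lower) simp_all
    moreover have "sphere_ft (1492 / 100 * r) \<ge> - 3 * (1 / (228276 / 10000) ^ 3 + 1 / (228276 / 10000)\<^sup>2)"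
      using r by (intro sphere_ft_lower) simp_all
    ultimately show ?thesis by (rule order_trans[OF _ bounds, rotated]) (simp add: eval_nat_numeral)
  next
    case 2
    have "cos (997 / 100 * r) = sin (997 / 100 * r - 11 / 2 * pi)"
    proof -
      have "cos (997 / 100 * r) = - cos ((997 / 100 * r - 11 / 2 * pi) + pi / 2)"
        using cosn[of 5 "997 / 100 * r"] by (simp add: algebra_simps)
      then show ?thesis using minus_sin_cos_eq[of "997 / 100 * r - 11 / 2 * pi"] by simp
    qed
    also have "\<dots> \<le> \<bar>997 / 100 * r - 11 / 2 * pi\<bar>"
      using abs_sin_x_le_abs_x[of "997 / 100 * r - 11 / 2 * pi"] by linarith
    also have "\<dots> \<le> 57 / 100" using 2 pi by linarith
    finally have "sphere_ft (997 / 100 * r) \<ge> - 3 * (1 / (17278 / 1000) ^ 3 + (57 / 100) / (17278 / 1000)\<^sup>2)"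
      using 2 by (intro sphere_ft_lower) simp_all
    moreover have "sphere_ft (1492 / 100 * r) \<ge> - 3 * (1 / (25856 / 1000) ^ 3 + 1 / (25856 / 1000)\<^sup>2)"
      using 2 by (intro sphere_ft_lower) simp_all
    ultimately show ?thesis by (rule order_trans[OF _ bounds, rotated]) (simp add: eval_nat_numeral)
  next
    case 3
    have "sphere_ft (997 / 100 * r) \<ge> - 3 * (1 / (178 / 10) ^ 3 + 1 / (178 / 10)\<^sup>2)"
      using 3 by (intro sphere_ft_lower) simp_all
    moreover have "\<bar>1492 / 100 * r - 9 * pi\<bar> \<le> pi / 2"
      using 3 pi by linarith
    then have "cos (1492 / 100 * r) \<le> 0"
      using cos_nonpos[of 9 "1492 / 100 * r"] by simp
    then have "sphere_ft (1492 / 100 * r) \<ge> - 3 * (1 / (267 / 10) ^ 3 + 0 / (267 / 10)\<^sup>2)"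
      using 3 by (intro sphere_ft_lower) simp_all
    ultimately show ?thesis by (rule order_trans[OF _ bounds, rotated]) (simp add: eval_nat_numeral)
  next
    case 4
    have "sphere_ft (997 / 100 * r) \<ge> - 3 * (1 / (18943 / 1000) ^ 3 + 1 / (18943 / 1000)\<^sup>2)"
      using 4 by (intro sphere_ft_lower) simp_all
    moreover have "sphere_ft (1492 / 100 * r) \<ge> - 3 * (1 / (28348 / 1000) ^ 3 + 1 / (28348 / 1000)\<^sup>2)"
      using 4 by (intro sphere_ft_lower) simp_all
    ultimately show ?thesis by (rule order_trans[OF _ bounds, rotated]) (simp add: eval_nat_numeral)
  qed
qed

section \<open>The transform of the dual measure in closed form\<close>

text \<open>The integral over \<open>[0, r]\<close> of the product of two sphere transforms, \<open>s\<^sup>4 sphere_ft (a s)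
sphere_ft (t s)\<close>. It is elementary because both factors are radial eigenfunctions of the Laplacian,
so that the integral reduces to a boundary term (Green's identity).\<close>
definition wave_ft :: "real \<Rightarrow> real \<Rightarrow> real \<Rightarrow> real" where
  "wave_ft a t r = 9 / (a ^ 3 * t ^ 3 * (a\<^sup>2 - t\<^sup>2)) *
     ((t\<^sup>2 * (sin (a * r) - a * r * cos (a * r)) * sin (t * r) - a\<^sup>2 * (sin (t * r) - t * r * cos (t * r)) * sin (a * r)) / r)"

text \<open>The closed form has an apparent pole at \<open>0\<close>, so differentiation is done on the open interval and
continuity at \<open>0\<close> comes from a quadratic bound on the numerator.\<close>
lemma has_integral_wave:
  assumes a: "a > 0" and t: "t > 0" and ne: "a \<noteq> t" and L: "L \<ge> 0"
  shows "((\<lambda>r. r ^ 4 * sphere_ft (a * r) * sphere_ft (t * r)) has_integral wave_ft a t L) {0..L}"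
proof -
  define N where "N r = t\<^sup>2 * (sin (a * r) - a * r * cos (a * r)) * sin (t * r) - a\<^sup>2 * (sin (t * r) - t * r * cos (t * r)) * sin (a * r)" for r
  define K where "K = 9 / (a ^ 3 * t ^ 3 * (a\<^sup>2 - t\<^sup>2))"
  have K: "K * (a\<^sup>2 - t\<^sup>2) = 9 / (a ^ 3 * t ^ 3)"
  proof -
    have "a\<^sup>2 \<noteq> t\<^sup>2" using a t ne by (simp add: power2_eq_iff)
    then have "a\<^sup>2 - t\<^sup>2 \<noteq> 0" by simp
    then show ?thesis unfolding K_def by (metis nonzero_divide_eq_eq times_divide_eq_left times_divide_times_eq mult.commute divide_divide_eq_left)
  qed
  have "((\<lambda>r. r ^ 4 * sphere_ft (a * r) * sphere_ft (t * r)) has_integral (K * (N L / L) - K * (N 0 / 0))) {0..L}"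
  proof (rule fundamental_theorem_of_calculus_interior[OF L])
    have deriv: "((\<lambda>r. K * (N r / r)) has_real_derivative r ^ 4 * sphere_ft (a * r) * sphere_ft (t * r)) (at r)" if r: "r > 0" for r
    proof -
      have N': "(N has_real_derivative t ^ 3 * (sin (a * r) - a * r * cos (a * r)) * cos (t * r) - a ^ 3 * (sin (t * r) - t * r * cos (t * r)) * cos (a * r)) (at r)"
        unfolding N_def by (auto intro!: derivative_eq_intros simp: algebra_simps eval_nat_numeral)
      have "((\<lambda>r. K * (N r / r)) has_real_derivative
         K * (((t ^ 3 * (sin (a * r) - a * r * cos (a * r)) * cos (t * r) - a ^ 3 * (sin (t * r) - t * r * cos (t * r)) * cos (a * r)) * r - N r * 1) / (r * r))) (at r)"
        using r by (intro DERIV_cmult DERIV_divide N' DERIV_ident) simp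
      also have "(t ^ 3 * (sin (a * r) - a * r * cos (a * r)) * cos (t * r) - a ^ 3 * (sin (t * r) - t * r * cos (t * r)) * cos (a * r)) * r - N r * 1 =
         (a\<^sup>2 - t\<^sup>2) * ((sin (a * r) - a * r * cos (a * r)) * (sin (t * r) - t * r * cos (t * r)))"
        unfolding N_def by (simp add: algebra_simps eval_nat_numeral)
      also have "K * ((a\<^sup>2 - t\<^sup>2) * ((sin (a * r) - a * r * cos (a * r)) * (sin (t * r) - t * r * cos (t * r))) / (r * r)) =
         9 / (a ^ 3 * t ^ 3) * ((sin (a * r) - a * r * cos (a * r)) * (sin (t * r) - t * r * cos (t * r))) / (r * r)"
        unfolding K [symmetric] by simp
      also have "\<dots> = r ^ 4 * sphere_ft (a * r) * sphere_ft (t * r)"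
        using a t r by (simp add: sphere_ft_def field_simps eval_nat_numeral)
      finally show ?thesis .
    qed
    show "((\<lambda>r. K * (N r / r)) has_vector_derivative r ^ 4 * sphere_ft (a * r) * sphere_ft (t * r)) (at r)"
      if "r \<in> {0<..<L}" for r
      using deriv[of r] that by (simp add: has_real_derivative_iff_has_vector_derivative)
    show "continuous_on {0..L} (\<lambda>r. K * (N r / r))"
    proof (rule continuous_at_imp_continuous_on, intro ballI)
      fix r assume "r \<in> {0..L}"
      then consider "r > 0" | "r = 0" by fastforce
      then show "isCont (\<lambda>r. K * (N r / r)) r"
      proof cases
        case 1
        then show ?thesis using deriv DERIV_isCont by blast
      next
        case 2
        have bound: "\<bar>N r / r\<bar> \<le> (2 * t ^ 3 * a + 2 * a ^ 3 * t) * \<bar>r\<bar>" for r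
        proof -
          have u: "\<bar>sin (b * r) - b * r * cos (b * r)\<bar> \<le> 2 * b * \<bar>r\<bar>" if "b > 0" for b
          proof -
            have "\<bar>sin (b * r) - b * r * cos (b * r)\<bar> \<le> \<bar>sin (b * r)\<bar> + \<bar>b * r\<bar> * \<bar>cos (b * r)\<bar>"
              using abs_triangle_ineq4[of "sin (b * r)" "b * r * cos (b * r)"] by (simp add: abs_mult)
            also have "\<dots> \<le> \<bar>b * r\<bar> + \<bar>b * r\<bar> * 1"
              by (intro add_mono mult_left_mono abs_sin_x_le_abs_x) auto
            finally show ?thesis using that by (simp add: abs_mult)
          qed
          have s: "\<bar>sin (b * r)\<bar> \<le> b * \<bar>r\<bar>" if "b > 0" for b
            using abs_sin_x_le_abs_x[of "b * r"] that by (simp add: abs_mult)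
          have "\<bar>N r\<bar> \<le> t\<^sup>2 * \<bar>sin (a * r) - a * r * cos (a * r)\<bar> * \<bar>sin (t * r)\<bar> + a\<^sup>2 * \<bar>sin (t * r) - t * r * cos (t * r)\<bar> * \<bar>sin (a * r)\<bar>"
            unfolding N_def by (rule order_trans[OF abs_triangle_ineq4]) (simp add: abs_mult)
          also have "\<dots> \<le> t\<^sup>2 * (2 * a * \<bar>r\<bar>) * (t * \<bar>r\<bar>) + a\<^sup>2 * (2 * t * \<bar>r\<bar>) * (a * \<bar>r\<bar>)"
            using a t by (intro add_mono mult_mono u s) auto
          also have "\<dots> = (2 * t ^ 3 * a + 2 * a ^ 3 * t) * \<bar>r\<bar> * \<bar>r\<bar>"
            by (simp add: algebra_simps eval_nat_numeral)
          finally have N: "\<bar>N r\<bar> \<le> (2 * t ^ 3 * a + 2 * a ^ 3 * t) * \<bar>r\<bar> * \<bar>r\<bar>" .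
          show ?thesis
          proof (cases "r = 0")
            case False
            then show ?thesis using N by (simp add: abs_divide pos_divide_le_eq)
          qed simp
        qed
        have "(\<lambda>r. N r / r) \<midarrow>0\<rightarrow> 0"
        proof (rule Lim_null_comparison)
          show "\<forall>\<^sub>F r in at 0. norm (N r / r) \<le> (2 * t ^ 3 * a + 2 * a ^ 3 * t) * \<bar>r\<bar>"
            using bound by (intro always_eventually) simp
          show "(\<lambda>r. (2 * t ^ 3 * a + 2 * a ^ 3 * t) * \<bar>r\<bar>) \<midarrow>0\<rightarrow> 0"
            by (auto intro!: tendsto_eq_intros)
        qed
        from tendsto_mult[OF tendsto_const[of K] this] show ?thesis using 2 by (simp add: isCont_def)
      qed
    qed
  qed
  then show ?thesis by (simp add: wave_ft_def N_def K_def)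
qed

lemma dual_ft_eq:
  assumes t: "t > 0" "t \<noteq> 997 / 100" "t \<noteq> 1492 / 100"
  shows "dual_ft t = 1 + 4759 / 100 * sphere_ft t + 38952157 / 375000 * sphere_ft (148 / 100 * t)
     - (8276 / 100 * ball_ft t (153 / 100) + 39635 / 10 * wave_ft (997 / 100) t (153 / 100)
        + 119401 / 10 * wave_ft (1492 / 100) t (153 / 100))"
proof -
  have b: "((\<lambda>r. r ^ 4 * sphere_ft (t * r)) has_integral ball_ft t (153 / 100) - ball_ft t 0) {0..153 / 100}"
    by (intro fundamental_theorem_of_calculus)
       (auto intro!: has_field_derivative_at_within[OF has_derivative_ball_ft]
          simp: has_real_derivative_iff_has_vector_derivative [symmetric])
  have "((\<lambda>r. 8276 / 100 * (r ^ 4 * sphere_ft (t * r)) + 39635 / 10 * (r ^ 4 * sphere_ft (997 / 100 * r) * sphere_ft (t * r)) +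
       119401 / 10 * (r ^ 4 * sphere_ft (1492 / 100 * r) * sphere_ft (t * r))) has_integral
     8276 / 100 * (ball_ft t (153 / 100) - ball_ft t 0) + 39635 / 10 * wave_ft (997 / 100) t (153 / 100)
        + 119401 / 10 * wave_ft (1492 / 100) t (153 / 100)) {0..153 / 100}"
    using t by (intro has_integral_add has_integral_mult_right has_integral_wave b) auto
  also have "(\<lambda>r. 8276 / 100 * (r ^ 4 * sphere_ft (t * r)) + 39635 / 10 * (r ^ 4 * sphere_ft (997 / 100 * r) * sphere_ft (t * r)) +
       119401 / 10 * (r ^ 4 * sphere_ft (1492 / 100 * r) * sphere_ft (t * r))) = (\<lambda>r. r ^ 4 * tail r * sphere_ft (t * r))"
    by (auto simp: tail_def algebra_simps)
  finally show ?thesis by (simp add: dual_ft_def integral_unique)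
qed

text \<open>The factor \<open>1 / (t\<^sup>2 - a\<^sup>2)\<close> is at most a constant times \<open>1 / t\<^sup>2\<close> for \<open>t \<ge> T > a\<close>, so everything
decays at least like \<open>1 / t\<^sup>3\<close>.\<close>
lemma abs_wave_ft_le:
  assumes a: "a > 0" and T: "T > a" and t: "t \<ge> T" and L: "L > 0"
  shows "\<bar>wave_ft a t L\<bar> \<le> 9 * (T\<^sup>2 / (T\<^sup>2 - a\<^sup>2)) / (a ^ 3 * L) *
     ((1 + a * L) / T ^ 3 + a\<^sup>2 * (1 / T ^ 5 + L / T ^ 4))"
proof -
  have t0: "t > 0" "T > 0" using assms by auto
  have sq: "a\<^sup>2 < T\<^sup>2" "T\<^sup>2 \<le> t\<^sup>2" using assms by (auto intro!: power_strict_mono power_mono)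
  define \<kappa> where "\<kappa> = T\<^sup>2 / (T\<^sup>2 - a\<^sup>2)"
  have \<kappa>: "\<kappa> > 0" using sq t0 by (simp add: \<kappa>_def)
  have 1: "1 / (t\<^sup>2 - a\<^sup>2) \<le> \<kappa> / t\<^sup>2"
  proof -
    have "a\<^sup>2 * T\<^sup>2 \<le> a\<^sup>2 * t\<^sup>2" using sq by (intro mult_left_mono) auto
    then have le: "t\<^sup>2 * (T\<^sup>2 - a\<^sup>2) \<le> T\<^sup>2 * (t\<^sup>2 - a\<^sup>2)" by (simp add: algebra_simps)
    have "x / y \<le> z / w" if "x * w \<le> z * y" "y > 0" "w > 0" for x y z w :: real
      using that by (simp add: field_simps)
    from this[of "t\<^sup>2" "T\<^sup>2 - a\<^sup>2" "T\<^sup>2" "t\<^sup>2 - a\<^sup>2"] le sq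
    have "t\<^sup>2 / (t\<^sup>2 - a\<^sup>2) \<le> \<kappa>" by (simp add: \<kappa>_def)
    then have "t\<^sup>2 / (t\<^sup>2 - a\<^sup>2) / t\<^sup>2 \<le> \<kappa> / t\<^sup>2" by (intro divide_right_mono) auto
    then show ?thesis using t0 by simp
  qed
  define M where "M = t\<^sup>2 * (1 + a * L) + a\<^sup>2 * (1 + t * L)"
  have M: "\<bar>t\<^sup>2 * (sin (a * L) - a * L * cos (a * L)) * sin (t * L) - a\<^sup>2 * (sin (t * L) - t * L * cos (t * L)) * sin (a * L)\<bar> \<le> M"
  proof -
    have "\<bar>t\<^sup>2 * (sin (a * L) - a * L * cos (a * L)) * sin (t * L) - a\<^sup>2 * (sin (t * L) - t * L * cos (t * L)) * sin (a * L)\<bar>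
       \<le> t\<^sup>2 * \<bar>sin (a * L) - a * L * cos (a * L)\<bar> * \<bar>sin (t * L)\<bar> + a\<^sup>2 * \<bar>sin (t * L) - t * L * cos (t * L)\<bar> * \<bar>sin (a * L)\<bar>"
      by (rule order_trans[OF abs_triangle_ineq4]) (simp add: abs_mult)
    also have "\<dots> \<le> t\<^sup>2 * (1 + a * L) * 1 + a\<^sup>2 * (1 + t * L) * 1"
      using a t0 L by (intro add_mono mult_mono abs_sin_minus_le) auto
    finally show ?thesis by (simp add: M_def)
  qed
  have "\<bar>wave_ft a t L\<bar> = 9 / (a ^ 3 * L) * (1 / t ^ 3) * (1 / (t\<^sup>2 - a\<^sup>2)) *
     \<bar>t\<^sup>2 * (sin (a * L) - a * L * cos (a * L)) * sin (t * L) - a\<^sup>2 * (sin (t * L) - t * L * cos (t * L)) * sin (a * L)\<bar>"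
  proof -
    have "\<bar>9 / (A * B * d) * (X / L)\<bar> = 9 / (A * L) * (1 / B) * (1 / e) * \<bar>X\<bar>"
      if "A > 0" "B > 0" "\<bar>d\<bar> = e" for A B d e X
      using that L by (simp add: abs_mult abs_divide)
    moreover have "\<bar>a\<^sup>2 - t\<^sup>2\<bar> = t\<^sup>2 - a\<^sup>2" using sq by simp
    moreover have "a ^ 3 > 0" "t ^ 3 > 0" using a t0 by simp_all
    ultimately show ?thesis unfolding wave_ft_def by blast
  qed
  also have "\<dots> \<le> 9 / (a ^ 3 * L) * (1 / t ^ 3) * (\<kappa> / t\<^sup>2) * M"
    using a T t t0 L sq \<kappa> by (intro mult_mono 1 M mult_nonneg_nonneg) auto
  also have "\<dots> = 9 * \<kappa> / (a ^ 3 * L) * ((1 + a * L) / t ^ 3 + a\<^sup>2 * (1 / t ^ 5 + L / t ^ 4))"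
    using a t0 L unfolding M_def by (simp add: field_simps eval_nat_numeral)
  also have "\<dots> \<le> 9 * \<kappa> / (a ^ 3 * L) * ((1 + a * L) / T ^ 3 + a\<^sup>2 * (1 / T ^ 5 + L / T ^ 4))"
    using a t0 t L \<kappa> by (intro mult_left_mono add_mono divide_left_mono power_mono mult_pos_pos zero_less_power) auto
  finally show ?thesis by (simp add: \<kappa>_def)
qed

lemma abs_ball_ft_le:
  assumes t: "t \<ge> T" "T > 0" and L: "L > 0"
  shows "\<bar>ball_ft t L\<bar> \<le> 3 * (3 / T ^ 5 + 3 * L / T ^ 4 + L\<^sup>2 / T ^ 3)"
proof -
  have t0: "t > 0" using t by linarith
  have "\<bar>3 * sin (t * L) - 3 * (t * L) * cos (t * L) - (t * L)\<^sup>2 * sin (t * L)\<bar> \<le>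
     \<bar>3 * (sin (t * L) - t * L * cos (t * L))\<bar> + \<bar>(t * L)\<^sup>2 * sin (t * L)\<bar>"
    by (rule order_trans[OF _ abs_triangle_ineq4]) (simp add: algebra_simps)
  also have "\<dots> \<le> 3 * (1 + t * L) + (t * L)\<^sup>2 * 1"
    unfolding abs_mult using t0 L by (intro add_mono mult_mono abs_sin_minus_le) auto
  finally have "\<bar>ball_ft t L\<bar> \<le> 3 * (3 * (1 + t * L) + (t * L)\<^sup>2) / t ^ 5"
    using t0 by (simp add: ball_ft_def abs_mult abs_divide divide_right_mono)
  also have "\<dots> = 3 * (3 / t ^ 5 + 3 * L / t ^ 4 + L\<^sup>2 / t ^ 3)"
    using t0 by (simp add: field_simps eval_nat_numeral)
  also have "\<dots> \<le> 3 * (3 / T ^ 5 + 3 * L / T ^ 4 + L\<^sup>2 / T ^ 3)"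
    using t t0 L by (intro mult_left_mono add_mono divide_left_mono power_mono mult_pos_pos zero_less_power) auto
  finally show ?thesis .
qed

text \<open>At \<open>t = 22\<close> the five decaying terms add up to about \<open>0.9\<close>, less than the unit mass.\<close>
lemma dual_ft_nonneg_large:
  assumes t: "t \<ge> 22"
  shows "dual_ft t \<ge> 0"
proof -
  have 1: "\<bar>sphere_ft t\<bar> \<le> 3 * (1 / 22 ^ 3 + 1 / 22\<^sup>2)"
    using t by (intro abs_sphere_ft_upper) auto
  have 2: "\<bar>sphere_ft (148 / 100 * t)\<bar> \<le> 3 * (1 / (148 / 100 * 22) ^ 3 + 1 / (148 / 100 * 22)\<^sup>2)"
    using t by (intro abs_sphere_ft_upper) auto
  have 3: "\<bar>ball_ft t (153 / 100)\<bar> \<le> 3 * (3 / 22 ^ 5 + 3 * (153 / 100) / 22 ^ 4 + (153 / 100)\<^sup>2 / 22 ^ 3)"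
    using t by (intro abs_ball_ft_le) auto
  have 4: "\<bar>wave_ft (997 / 100) t (153 / 100)\<bar> \<le> 9 * (22\<^sup>2 / (22\<^sup>2 - (997 / 100)\<^sup>2)) / ((997 / 100) ^ 3 * (153 / 100)) *
     ((1 + 997 / 100 * (153 / 100)) / 22 ^ 3 + (997 / 100)\<^sup>2 * (1 / 22 ^ 5 + (153 / 100) / 22 ^ 4))"
    using t by (intro abs_wave_ft_le) auto
  have 5: "\<bar>wave_ft (1492 / 100) t (153 / 100)\<bar> \<le> 9 * (22\<^sup>2 / (22\<^sup>2 - (1492 / 100)\<^sup>2)) / ((1492 / 100) ^ 3 * (153 / 100)) *
     ((1 + 1492 / 100 * (153 / 100)) / 22 ^ 3 + (1492 / 100)\<^sup>2 * (1 / 22 ^ 5 + (153 / 100) / 22 ^ 4))"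
    using t by (intro abs_wave_ft_le) auto
  have 1: "\<bar>sphere_ft t\<bar> \<le> 65 / 10000" by (rule order_trans[OF 1]) (simp add: eval_nat_numeral)
  have 2: "\<bar>sphere_ft (148 / 100 * t)\<bar> \<le> 295 / 100000" by (rule order_trans[OF 2]) (simp add: eval_nat_numeral)
  have 3: "\<bar>ball_ft t (153 / 100)\<bar> \<le> 73 / 100000" by (rule order_trans[OF 3]) (simp add: eval_nat_numeral)
  have 4: "\<bar>wave_ft (997 / 100) t (153 / 100)\<bar> \<le> 17 / 1000000" by (rule order_trans[OF 4]) (simp add: eval_nat_numeral)
  have 5: "\<bar>wave_ft (1492 / 100) t (153 / 100)\<bar> \<le> 13 / 1000000" by (rule order_trans[OF 5]) (simp add: eval_nat_numeral)
  have "t > 0" "t \<noteq> 997 / 100" "t \<noteq> 1492 / 100" using t by auto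
  from dual_ft_eq[OF this] 1 2 3 4 5 show ?thesis by linarith
qed

section \<open>Interpolation at six equidistant nodes\<close>

text \<open>The functions \<open>h k\<close> are the successive derivatives of \<open>h 0\<close>; each differentiation loses at most
one zero.\<close>
lemma repeated_Rolle:
  fixes h :: "nat \<Rightarrow> real \<Rightarrow> real"
  assumes deriv: "\<And>k y. (h k has_real_derivative h (Suc k) y) (at y)"
    and Z: "finite Z" "card Z = Suc n" "\<And>z. z \<in> Z \<Longrightarrow> h 0 z = 0"
  shows "\<exists>\<xi>. h n \<xi> = 0"
  using deriv Z
proof (induction n arbitrary: h Z)
  case 0
  then obtain z where "z \<in> Z" by (metis card.empty ex_in_conv nat.distinct(1))
  with 0 show ?case by blast
next
  case (Suc n)
  define xs where "xs = sorted_list_of_set Z"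
  have xs: "length xs = Suc (Suc n)" "set xs = Z" "sorted_wrt (<) xs"
    using Suc.prems by (auto simp: xs_def strict_sorted_list_of_set)
  have less: "xs ! i < xs ! j" if "i < j" "j < Suc (Suc n)" for i j
    using xs that by (metis sorted_wrt_iff_nth_less)
  have "\<exists>\<xi>. xs ! i < \<xi> \<and> \<xi> < xs ! Suc i \<and> h 1 \<xi> = 0" if "i < Suc n" for i
  proof -
    have "xs ! i \<in> Z" "xs ! Suc i \<in> Z" using xs that by (metis Suc_lessI less_SucI nth_mem Suc_mono)+
    then have eq: "h 0 (xs ! i) = h 0 (xs ! Suc i)" using Suc.prems(4) by simp
    have "\<exists>\<xi>. xs ! i < \<xi> \<and> \<xi> < xs ! Suc i \<and> DERIV (h 0) \<xi> :> 0"
    proof (rule Rolle)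
      show "xs ! i < xs ! Suc i" using that by (intro less) auto
      show "continuous_on {xs ! i..xs ! Suc i} (h 0)"
        using Suc.prems(1)[of 0] by (intro continuous_at_imp_continuous_on) (blast intro: DERIV_isCont)
      show "h 0 differentiable (at y)" for y
        using Suc.prems(1)[of 0 y] by (auto simp: real_differentiable_def)
    qed (fact eq)
    then show ?thesis using Suc.prems(1)[of 0] DERIV_unique by (metis One_nat_def)
  qed
  then obtain \<xi> where \<xi>: "\<And>i. i < Suc n \<Longrightarrow> xs ! i < \<xi> i \<and> \<xi> i < xs ! Suc i \<and> h 1 (\<xi> i) = 0"
    by metis
  have mono: "\<xi> i < \<xi> j" if "i < j" "j < Suc n" for i j
  proof -
    have "\<xi> i < xs ! Suc i" using \<xi>[of i] that by simp
    also have "xs ! Suc i \<le> xs ! j" using less[of "Suc i" j] that by (cases "Suc i = j") auto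
    also have "xs ! j < \<xi> j" using \<xi>[of j] that by simp
    finally show ?thesis .
  qed
  have "inj_on \<xi> {..<Suc n}"
    by (intro inj_onI) (metis lessThan_iff less_irrefl linorder_neqE_nat mono)
  then have "card (\<xi> ` {..<Suc n}) = Suc n" by (simp add: card_image)
  from Suc.IH[of "\<lambda>k. h (Suc k)" "\<xi> ` {..<Suc n}", OF Suc.prems(1) _ this] show ?case
    using \<xi> by auto
qed

text \<open>Cauchy's remainder. The multiple \<open>K\<close> of the node polynomial is chosen such that the difference
also vanishes at \<open>x\<close>, and the repeated Rolle theorem is applied to the \<open>n + 1\<close> zeros.\<close>
lemma polynomial_interpolation_error:
  fixes f :: "nat \<Rightarrow> real \<Rightarrow> real"
  assumes deriv: "\<And>k y. (f k has_real_derivative f (Suc k) y) (at y)"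
    and Z: "finite Z" "card Z = n" and p: "degree p < n" "\<And>z. z \<in> Z \<Longrightarrow> poly p z = f 0 z"
  shows "\<exists>\<xi>. f 0 x - poly p x = f n \<xi> / fact n * (\<Prod>z\<in>Z. x - z)"
proof (cases "x \<in> Z")
  case True
  then have "(\<Prod>z\<in>Z. x - z) = 0" using Z(1) by auto
  then show ?thesis using p(2)[OF True] by simp
next
  case False
  \<comment> \<open>The node polynomial is monic, so its \<open>n\<close>-th derivative is the constant \<open>fact n\<close>.\<close>
  define q :: "real poly" where "q = (\<Prod>z\<in>Z. [:-z, 1:])"
  have q: "poly q y = (\<Prod>z\<in>Z. y - z)" for y
    by (simp add: q_def poly_prod)
  have "degree q = n" using Z by (simp add: q_def degree_prod_eq_sum_degree)
  moreover have "lead_coeff q = 1" unfolding q_def by (simp add: lead_coeff_prod)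
  ultimately have qn: "coeff q n = 1" by simp
  have D: "(pderiv ^^ n) r = [:fact n * coeff r n:]" if "degree r \<le> n" for r :: "real poly"
  proof (rule poly_eqI)
    fix i
    show "coeff ((pderiv ^^ n) r) i = coeff [:fact n * coeff r n:] i"
    proof (cases i)
      case 0
      then show ?thesis by (simp add: coeff_higher_pderiv pochhammer_fact)
    next
      case (Suc j)
      then show ?thesis using that by (simp add: coeff_higher_pderiv coeff_eq_0)
    qed
  qed
  have w: "(\<Prod>z\<in>Z. x - z) \<noteq> 0" using False Z(1) by auto
  define K where "K = (f 0 x - poly p x) / (\<Prod>z\<in>Z. x - z)"
  define h where "h k y = f k y - poly ((pderiv ^^ k) p) y - K * poly ((pderiv ^^ k) q) y" for k y
  have "\<exists>\<xi>. h n \<xi> = 0"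
  proof (rule repeated_Rolle)
    show "(h k has_real_derivative h (Suc k) y) (at y)" for k y
      unfolding h_def by (auto intro!: derivative_eq_intros deriv poly_DERIV)
    show "finite (insert x Z)" "card (insert x Z) = Suc n" using Z False by auto
    show "h 0 z = 0" if "z \<in> insert x Z" for z
    proof (cases "z = x")
      case True
      then show ?thesis using w by (simp add: h_def K_def q)
    next
      case False
      with that have "z \<in> Z" by simp
      moreover then have "(\<Prod>z'\<in>Z. z - z') = 0" using Z(1) by auto
      ultimately show ?thesis by (simp add: h_def p(2) q)
    qed
  qed
  then obtain \<xi> where "h n \<xi> = 0" by blast
  then have "f n \<xi> = K * fact n"
    using p(1) qn \<open>degree q = n\<close> by (simp add: h_def D coeff_eq_0)
  then show ?thesis using w by (intro exI[of _ \<xi>]) (simp add: K_def)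
qed

text \<open>The quintic with values \<open>v 0, ..., v 5\<close> at the nodes \<open>-2, ..., 3\<close>, written in the Bernstein basis
of the middle interval \<open>[0, 1]\<close>: the six coefficients bound it from below there.\<close>
definition interp6 :: "(nat \<Rightarrow> real) \<Rightarrow> real \<Rightarrow> real" where
  "interp6 v s = (1 - s) ^ 5 * v 2
     + 5 * s * (1 - s) ^ 4 * ((12 * v 0 - 120 * v 1 + 1120 * v 2 + 240 * v 3 - 60 * v 4 + 8 * v 5) / 1200)
     + 10 * s ^ 2 * (1 - s) ^ 3 * ((19 * v 0 - 160 * v 1 + 890 * v 2 + 560 * v 3 - 125 * v 4 + 16 * v 5) / 1200)
     + 10 * s ^ 3 * (1 - s) ^ 2 * ((16 * v 0 - 125 * v 1 + 560 * v 2 + 890 * v 3 - 160 * v 4 + 19 * v 5) / 1200)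
     + 5 * s ^ 4 * (1 - s) * ((8 * v 0 - 60 * v 1 + 240 * v 2 + 1120 * v 3 - 120 * v 4 + 12 * v 5) / 1200)
     + s ^ 5 * v 3"

definition lagrange6 :: "nat \<Rightarrow> real \<Rightarrow> real" where
  "lagrange6 j s = interp6 (\<lambda>i. if i = j then 1 else 0) s"

lemma interp6_eq_sum: "interp6 v s = (\<Sum>j<6. v j * lagrange6 j s)"
  by (simp add: eval_nat_numeral lagrange6_def interp6_def) (simp add: field_simps)

lemma interp6_node: "j < 6 \<Longrightarrow> interp6 v (real j - 2) = v j"
proof -
  assume "j < 6"
  then consider "j = 0" | "j = 1" | "j = 2" | "j = 3" | "j = 4" | "j = 5" by linarith
  then show ?thesis by cases (simp_all add: interp6_def field_simps)
qed

lemma interp6_const: "interp6 (\<lambda>_. c) s = c"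
  unfolding interp6_def by (simp add: eval_nat_numeral algebra_simps)

lemma interp6_is_poly: "\<exists>p. degree p < 6 \<and> (\<forall>s. poly p s = interp6 v s)"
proof -
  let ?X = "[:0, 1:] :: real poly" and ?Y = "[:1, -1:] :: real poly"
  define c :: "nat \<Rightarrow> real" where "c k = [v 2,
      5 * ((12 * v 0 - 120 * v 1 + 1120 * v 2 + 240 * v 3 - 60 * v 4 + 8 * v 5) / 1200),
      10 * ((19 * v 0 - 160 * v 1 + 890 * v 2 + 560 * v 3 - 125 * v 4 + 16 * v 5) / 1200),
      10 * ((16 * v 0 - 125 * v 1 + 560 * v 2 + 890 * v 3 - 160 * v 4 + 19 * v 5) / 1200),
      5 * ((8 * v 0 - 60 * v 1 + 240 * v 2 + 1120 * v 3 - 120 * v 4 + 12 * v 5) / 1200), v 3] ! k" for k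
  let ?p = "\<Sum>k\<le>5. smult (c k) (?X ^ k * ?Y ^ (5 - k))"
  have "degree ?p \<le> 5"
  proof (rule degree_sum_le)
    fix k :: nat assume k: "k \<in> {..5}"
    have "degree (smult (c k) (?X ^ k * ?Y ^ (5 - k))) \<le> degree (?X ^ k) + degree (?Y ^ (5 - k))"
      using degree_mult_le degree_smult_le order_trans by blast
    also have "\<dots> \<le> k + (5 - k)"
      by (intro add_mono) (simp_all add: degree_power_eq)
    finally show "degree (smult (c k) (?X ^ k * ?Y ^ (5 - k))) \<le> 5" using k by simp
  qed simp
  moreover have "poly ?p s = interp6 v s" for s
  proof -
    have set: "{..5} = {0, 1, 2, 3, 4, 5 :: nat}" by auto
    have "poly ?p s = (\<Sum>k\<le>5. c k * (s ^ k * (1 - s) ^ (5 - k)))"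
      by (simp add: poly_sum)
    also have "\<dots> = interp6 v s"
      unfolding set by (simp add: interp6_def c_def) (simp add: field_simps)
    finally show ?thesis .
  qed
  ultimately show ?thesis by (intro exI[of _ ?p]) auto
qed

text \<open>The nodes are symmetric around \<open>1 / 2\<close>, so the product depends only on \<open>q = s (1 - s)\<close> and is
largest at the midpoint.\<close>
lemma node_polynomial_le:
  fixes s :: real
  assumes "0 \<le> s" "s \<le> 1"
  shows "\<bar>\<Prod>z\<in>(\<lambda>j. real j - 2) ` {..<6}. s - z\<bar> \<le> 225 / 64"
proof -
  define q where "q = s * (1 - s)"
  have q: "0 \<le> q" "q \<le> 1 / 4"
    using assms zero_le_square[of "s - 1 / 2"] by (simp_all add: q_def algebra_simps mult_left_le)
  have "(\<Prod>z\<in>(\<lambda>j. real j - 2) ` {..<6}. s - z) = (\<Prod>j<6. s - (real j - 2))"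
    by (subst prod.reindex) (auto simp: inj_on_def)
  also have "\<dots> = - (q * (q + 2) * (q + 6))"
    by (simp add: eval_nat_numeral q_def) (simp add: algebra_simps)
  finally have "\<bar>\<Prod>z\<in>(\<lambda>j. real j - 2) ` {..<6}. s - z\<bar> = q * (q + 2) * (q + 6)"
    using q by simp
  also have "\<dots> \<le> (1 / 4) * (1 / 4 + 2) * (1 / 4 + 6)"
    using q by (intro mult_mono) auto
  finally show ?thesis by simp
qed

lemma interp6_cos_error:
  assumes s: "0 \<le> s" "s \<le> 1"
  shows "\<bar>cos (a + b * s) - interp6 (\<lambda>j. cos (a + b * (real j - 2))) s\<bar> \<le> 225 / 46080 * b ^ 6"
proof -
  \<comment> \<open>The derivatives of the cosine are its shifts by quarter periods.\<close>
  define f where "f k y = b ^ k * cos (a + b * y + real k * (pi / 2))" for k y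
  obtain p where p: "degree p < 6" "\<And>y. poly p y = interp6 (\<lambda>j. cos (a + b * (real j - 2))) y"
    using interp6_is_poly by metis
  have "\<exists>\<xi>. f 0 s - poly p s = f 6 \<xi> / fact 6 * (\<Prod>z\<in>(\<lambda>j. real j - 2) ` {..<6}. s - z)"
  proof (rule polynomial_interpolation_error)
    show "(f k has_real_derivative f (Suc k) y) (at y)" for k y
    proof -
      have "cos (a + b * y + real (Suc k) * (pi / 2)) = - sin (a + b * y + real k * (pi / 2))"
      proof -
        have "a + b * y + real (Suc k) * (pi / 2) = (a + b * y + real k * (pi / 2)) + pi / 2"
          by (simp add: algebra_simps add_divide_distrib)
        then show ?thesis by (simp only: cos_add[of _ "pi / 2"] sin_pi_half cos_pi_half mult_zero_right mult_1_right diff_0)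
      qed
      then show ?thesis unfolding f_def by (auto intro!: derivative_eq_intros)
    qed
    show "card ((\<lambda>j. real j - 2) ` {..<6::nat}) = 6"
      by (subst card_image) (auto simp: inj_on_def)
    show "poly p z = f 0 z" if "z \<in> (\<lambda>j. real j - 2) ` {..<6}" for z
      using that by (auto simp: p interp6_node f_def)
  qed (use p in auto)
  then obtain \<xi> where \<xi>: "f 0 s - poly p s = f 6 \<xi> / fact 6 * (\<Prod>z\<in>(\<lambda>j. real j - 2) ` {..<6}. s - z)" by blast
  have "\<bar>f 6 \<xi>\<bar> \<le> b ^ 6"
    by (simp add: f_def abs_mult mult_left_le)
  then have "\<bar>f 6 \<xi> / fact 6\<bar> * \<bar>\<Prod>z\<in>(\<lambda>j. real j - 2) ` {..<6}. s - z\<bar> \<le> (b ^ 6 / fact 6) * (225 / 64)"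
    by (intro mult_mono node_polynomial_le s) (simp_all add: divide_right_mono)
  then have "\<bar>f 0 s - poly p s\<bar> \<le> (b ^ 6 / fact 6) * (225 / 64)"
    unfolding \<xi> abs_mult .
  then show ?thesis by (simp add: f_def p fact_numeral)
qed

text \<open>The sixth moment of the density \<open>3 / 4 * (1 - u\<^sup>2)\<close> is \<open>1 / 21\<close>; this is the gain of the sphere
over a single cosine.\<close>
lemma abs_average_le:
  assumes f: "((\<lambda>u. 3 / 4 * (1 - u\<^sup>2) * f u) has_integral I) {-1..1::real}"
    and b: "\<And>u. \<bar>u\<bar> \<le> 1 \<Longrightarrow> \<bar>f u\<bar> \<le> K * u ^ 6"
  shows "\<bar>I\<bar> \<le> K / 21"
proof -
  define P :: "real \<Rightarrow> real" where "P u = 3 / 4 * K * (u ^ 7 / 7 - u ^ 9 / 9)" for u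
  have "((\<lambda>u. 3 / 4 * (1 - u\<^sup>2) * (K * u ^ 6)) has_integral (P 1 - P (-1))) {-1..1}"
  proof (intro fundamental_theorem_of_calculus)
    fix u :: real
    have "(P has_real_derivative 3 / 4 * (1 - u\<^sup>2) * (K * u ^ 6)) (at u)"
      unfolding P_def by (auto intro!: derivative_eq_intros simp: eval_nat_numeral algebra_simps)
    then show "(P has_vector_derivative 3 / 4 * (1 - u\<^sup>2) * (K * u ^ 6)) (at u within {-1..1})"
      by (simp add: has_real_derivative_iff_has_vector_derivative has_vector_derivative_at_within)
  qed auto
  moreover have "P 1 - P (-1) = K / 21" by (simp add: P_def field_simps)
  ultimately have K: "((\<lambda>u. 3 / 4 * (1 - u\<^sup>2) * (K * u ^ 6)) has_integral K / 21) {-1..1}" by simp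
  have le: "\<bar>3 / 4 * (1 - u\<^sup>2) * f u\<bar> \<le> 3 / 4 * (1 - u\<^sup>2) * (K * u ^ 6)" if "u \<in> {-1..1}" for u
  proof -
    have u: "\<bar>u\<bar> \<le> 1" using that by auto
    then have "u\<^sup>2 \<le> 1" by (simp add: abs_square_le_1)
    then show ?thesis using b[OF u] by (simp add: abs_mult mult_left_mono)
  qed
  have "I \<le> K / 21" using le by (intro has_integral_le[OF f K]) (simp add: abs_le_iff)
  moreover have "- (K / 21) \<le> I"
  proof (rule has_integral_le[OF has_integral_neg[OF K] f])
    show "- (3 / 4 * (1 - u\<^sup>2) * (K * u ^ 6)) \<le> 3 / 4 * (1 - u\<^sup>2) * f u" if "u \<in> {-1..1}" for u
      using le[OF that] by linarith
  qed
  ultimately show ?thesis by linarith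
qed

lemma interp6_sphere_ft_error:
  assumes s: "0 \<le> s" "s \<le> 1"
  shows "\<bar>sphere_ft (a + b * s) - interp6 (\<lambda>j. sphere_ft (a + b * (real j - 2))) s\<bar> \<le> 225 / 46080 * b ^ 6 / 21"
proof (rule abs_average_le)
  have "((\<lambda>u. 3 / 4 * (1 - u\<^sup>2) * cos ((a + b * s) * u) -
       (\<Sum>j<6. (3 / 4 * (1 - u\<^sup>2) * cos ((a + b * (real j - 2)) * u)) * lagrange6 j s)) has_integral
       sphere_ft (a + b * s) - (\<Sum>j<6. sphere_ft (a + b * (real j - 2)) * lagrange6 j s)) {-1..1}"
    by (intro has_integral_diff sphere_ft_average has_integral_sum has_integral_mult_left) simp
  then show "((\<lambda>u. 3 / 4 * (1 - u\<^sup>2) * (cos (a * u + (b * u) * s) - interp6 (\<lambda>j. cos (a * u + (b * u) * (real j - 2))) s)) has_integral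
       sphere_ft (a + b * s) - interp6 (\<lambda>j. sphere_ft (a + b * (real j - 2))) s) {-1..1}"
    unfolding interp6_eq_sum by (simp add: right_diff_distrib sum_distrib_left mult.assoc algebra_simps)
  show "\<bar>cos (a * u + (b * u) * s) - interp6 (\<lambda>j. cos (a * u + (b * u) * (real j - 2))) s\<bar> \<le> 225 / 46080 * b ^ 6 * u ^ 6" for u
    using interp6_cos_error[OF s, of "a * u" "b * u"] by (simp add: power_mult_distrib)
qed

text \<open>The sphere transforms decay quadratically. Using this instead of \<open>|sphere_ft| \<le> 1\<close> makes the
interpolation error small enough.\<close>
lemma power_tail_le:
  assumes r: "r \<ge> 0"
  shows "\<bar>r ^ 10 * tail r\<bar> \<le> 8276 / 100 * r ^ 10 + 281 * r ^ 8 + 23 * r ^ 7"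
proof -
  have *: "\<bar>r ^ 10 * sphere_ft (a * r)\<bar> \<le> 3 / a ^ 3 * (r ^ 7 + a * r ^ 8)" if a: "a > 0" for a
  proof (cases "r = 0")
    case False
    have "r ^ 10 * sphere_ft (a * r) = 3 / a ^ 3 * r ^ 7 * (sin (a * r) - a * r * cos (a * r))"
      using a False by (simp add: sphere_ft_def field_simps eval_nat_numeral)
    then have "\<bar>r ^ 10 * sphere_ft (a * r)\<bar> = 3 / a ^ 3 * r ^ 7 * \<bar>sin (a * r) - a * r * cos (a * r)\<bar>"
      using a r by (simp add: abs_mult power_abs)
    also have "\<dots> \<le> 3 / a ^ 3 * r ^ 7 * (1 + a * r)"
      using a r by (intro mult_left_mono abs_sin_minus_le) auto
    also have "\<dots> = 3 / a ^ 3 * (r ^ 7 + a * r ^ 8)"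
    proof -
      have "r ^ 8 = r ^ 7 * r" by (simp add: eval_nat_numeral)
      moreover have "c * u * (1 + a * r) = c * (u + a * (u * r))" for c u
        by (simp add: algebra_simps)
      ultimately show ?thesis by (simp only:)
    qed
    finally show ?thesis .
  qed (use a in simp)
  have "r ^ 10 * tail r = 8276 / 100 * r ^ 10 + 39635 / 10 * (r ^ 10 * sphere_ft (997 / 100 * r)) + 119401 / 10 * (r ^ 10 * sphere_ft (1492 / 100 * r))"
    by (simp add: tail_def algebra_simps)
  moreover have "r ^ 10 \<ge> 0" "r ^ 8 \<ge> 0" "r ^ 7 \<ge> 0" using r by simp_all
  ultimately have "\<bar>r ^ 10 * tail r\<bar> \<le> 8276 / 100 * r ^ 10 + 39635 / 10 * (3 / (997 / 100) ^ 3 * (r ^ 7 + 997 / 100 * r ^ 8)) +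
      119401 / 10 * (3 / (1492 / 100) ^ 3 * (r ^ 7 + 1492 / 100 * r ^ 8))"
  proof -
    have gen: "\<bar>x + b * y + c * z\<bar> \<le> x + b * k + c * l"
      if "\<bar>y\<bar> \<le> k" "\<bar>z\<bar> \<le> l" "x \<ge> 0" "b \<ge> 0" "c \<ge> 0" for x y z b c k l :: real
    proof -
      have "b * \<bar>y\<bar> \<le> b * k" "c * \<bar>z\<bar> \<le> c * l" using that by (simp_all add: mult_left_mono)
      moreover have "\<bar>b * y\<bar> = b * \<bar>y\<bar>" "\<bar>c * z\<bar> = c * \<bar>z\<bar>" using that by (simp_all add: abs_mult)
      ultimately show ?thesis using that(3) by linarith
    qed
    have "0 \<le> 8276 / 100 * r ^ 10" using \<open>r ^ 10 \<ge> 0\<close> by simp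
    then show ?thesis
      unfolding \<open>r ^ 10 * tail r = _\<close> by (intro gen *) simp_all
  qed
  also have "\<dots> \<le> 8276 / 100 * r ^ 10 + 281 * r ^ 8 + 23 * r ^ 7"
  proof -
    have "8276 / 100 * z + 39635 / 10 * (3 / (997 / 100) ^ 3 * (x + 997 / 100 * y)) +
        119401 / 10 * (3 / (1492 / 100) ^ 3 * (x + 1492 / 100 * y)) \<le> 8276 / 100 * z + 281 * y + 23 * x"
      if "x \<ge> 0" "y \<ge> 0" for x y z :: real
    proof -
      have "3 / (997 / 100) ^ 3 * (x + 997 / 100 * y) \<le> 3028 / 10 ^ 6 * (x + 997 / 100 * y)"
        "3 / (1492 / 100) ^ 3 * (x + 1492 / 100 * y) \<le> 904 / 10 ^ 6 * (x + 1492 / 100 * y)"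
        using that by (intro mult_right_mono; simp add: power_divide)+
      moreover have "8276 / 100 * z + 39635 / 10 * A + 119401 / 10 * B \<le> 8276 / 100 * z + 281 * y + 23 * x"
        if "A \<le> 3028 / 10 ^ 6 * (x + 997 / 100 * y)" "B \<le> 904 / 10 ^ 6 * (x + 1492 / 100 * y)" for A B
        using that \<open>x \<ge> 0\<close> \<open>y \<ge> 0\<close> by simp
      ultimately show ?thesis by blast
    qed
    from this[OF \<open>r ^ 7 \<ge> 0\<close> \<open>r ^ 8 \<ge> 0\<close>] show ?thesis .
  qed
  finally show ?thesis .
qed

text \<open>Interpolation is linear and reproduces constants, so the error of \<open>dual_ft\<close> is the integral of
the errors of \<open>sphere_ft (r t)\<close>, which scale like \<open>r\<^sup>6\<close>, against the total variation of the dual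
measure. The unit mass at the origin contributes nothing.\<close>
lemma dual_ft_interp_error:
  assumes s: "0 \<le> s" "s \<le> 1"
  shows "\<bar>dual_ft (a + 2 / 5 * s) - interp6 (\<lambda>j. dual_ft (a + 2 / 5 * (real j - 2))) s\<bar> \<le> 3305 / 10 ^ 6"
proof -
  let ?L = "153 / 100 :: real"
  define C :: real where "C = 225 / 46080 * (2 / 5) ^ 6 / 21"
  define \<Delta> where "\<Delta> g = g (a + 2 / 5 * s) - (\<Sum>j<6. g (a + 2 / 5 * (real j - 2)) * lagrange6 j s)" for g :: "real \<Rightarrow> real"
  have sph: "\<bar>\<Delta> (\<lambda>t. sphere_ft (r * t))\<bar> \<le> C * r ^ 6" for r
  proof -
    have "r * a + r * (2 / 5) * x = r * (a + 2 / 5 * x)" for x by (simp add: algebra_simps)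
    moreover have "225 / 46080 * (r * (2 / 5)) ^ 6 / 21 = C * r ^ 6"
      by (simp add: C_def power_divide power_mult_distrib)
    ultimately show ?thesis
      using interp6_sphere_ft_error[OF s, of "r * a" "r * (2 / 5)"]
      unfolding \<Delta>_def interp6_eq_sum by (simp only: mult.commute)
  qed
  have sumL: "(\<Sum>j<6. lagrange6 j s) = 1"
    using interp6_const[of 1 s] unfolding interp6_eq_sum by simp
  have cont: "continuous_on {0..?L} (\<lambda>r. r ^ 4 * tail r * sphere_ft (t * r))" for t
    by (intro continuous_intros continuous_on_tail)
  define I where "I t = integral {0..?L} (\<lambda>r. r ^ 4 * tail r * sphere_ft (t * r))" for t
  have I: "((\<lambda>r. r ^ 4 * tail r * sphere_ft (t * r)) has_integral I t) {0..?L}" for t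
    unfolding I_def by (intro integrable_integral integrable_continuous_interval cont)
  have DI: "((\<lambda>r. r ^ 4 * tail r * \<Delta> (\<lambda>t. sphere_ft (r * t))) has_integral \<Delta> I) {0..?L}"
  proof -
    have "((\<lambda>r. r ^ 4 * tail r * sphere_ft ((a + 2 / 5 * s) * r) -
        (\<Sum>j<6. (r ^ 4 * tail r * sphere_ft ((a + 2 / 5 * (real j - 2)) * r)) * lagrange6 j s)) has_integral \<Delta> I) {0..?L}"
      unfolding \<Delta>_def by (intro has_integral_diff has_integral_sum has_integral_mult_left I) simp
    then show ?thesis
      unfolding \<Delta>_def by (simp add: right_diff_distrib sum_distrib_left mult_ac)
  qed
  have dual: "dual_ft t = 1 + 4759 / 100 * sphere_ft (1 * t) + 38952157 / 375000 * sphere_ft (148 / 100 * t) - I t" for t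
    by (simp add: dual_ft_def I_def)
  have "dual_ft (a + 2 / 5 * s) - interp6 (\<lambda>j. dual_ft (a + 2 / 5 * (real j - 2))) s =
     \<Delta> (\<lambda>t. 1 + 4759 / 100 * sphere_ft (1 * t) + 38952157 / 375000 * sphere_ft (148 / 100 * t) - I t)"
    unfolding \<Delta>_def interp6_eq_sum dual ..
  also have "\<dots> = 4759 / 100 * \<Delta> (\<lambda>t. sphere_ft (1 * t)) + 38952157 / 375000 * \<Delta> (\<lambda>t. sphere_ft (148 / 100 * t)) - \<Delta> I"
    unfolding \<Delta>_def using sumL
    by (simp add: distrib_right left_diff_distrib sum.distrib sum_subtractf right_diff_distrib sum_distrib_left mult.assoc)
  finally have eq: "dual_ft (a + 2 / 5 * s) - interp6 (\<lambda>j. dual_ft (a + 2 / 5 * (real j - 2))) s = \<dots>" .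
  have "\<bar>\<Delta> I\<bar> \<le> C * (8276 / 100 * (?L ^ 11 / 11) + 281 * (?L ^ 9 / 9) + 23 * (?L ^ 8 / 8))"
  proof -
    define P :: "real \<Rightarrow> real" where "P r = C * (8276 / 100 * (r ^ 11 / 11) + 281 * (r ^ 9 / 9) + 23 * (r ^ 8 / 8))" for r
    have P: "((\<lambda>r. C * (8276 / 100 * r ^ 10 + 281 * r ^ 8 + 23 * r ^ 7)) has_integral (P ?L - P 0)) {0..?L}"
    proof (intro fundamental_theorem_of_calculus)
      fix r :: real
      have "(P has_real_derivative C * (8276 / 100 * r ^ 10 + 281 * r ^ 8 + 23 * r ^ 7)) (at r)"
        unfolding P_def by (auto intro!: derivative_eq_intros)
      then show "(P has_vector_derivative C * (8276 / 100 * r ^ 10 + 281 * r ^ 8 + 23 * r ^ 7)) (at r within {0..?L})"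
        by (simp add: has_real_derivative_iff_has_vector_derivative has_vector_derivative_at_within)
    qed simp
    have le: "\<bar>r ^ 4 * tail r * \<Delta> (\<lambda>t. sphere_ft (r * t))\<bar> \<le> C * (8276 / 100 * r ^ 10 + 281 * r ^ 8 + 23 * r ^ 7)"
      if "r \<in> {0..?L}" for r
    proof -
      have "\<bar>r ^ 4 * tail r * \<Delta> (\<lambda>t. sphere_ft (r * t))\<bar> \<le> \<bar>r ^ 4 * tail r\<bar> * (C * r ^ 6)"
        unfolding abs_mult[of "r ^ 4 * tail r"] by (intro mult_left_mono sph) simp
      also have "\<dots> = C * \<bar>r ^ 10 * tail r\<bar>"
        using that by (simp add: abs_mult mult_ac eval_nat_numeral)
      also have "\<dots> \<le> C * (8276 / 100 * r ^ 10 + 281 * r ^ 8 + 23 * r ^ 7)"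
        using that by (intro mult_left_mono power_tail_le) (auto simp: C_def)
      finally show ?thesis .
    qed
    have "\<Delta> I \<le> P ?L - P 0"
    proof (rule has_integral_le[OF DI P])
      show "r ^ 4 * tail r * \<Delta> (\<lambda>t. sphere_ft (r * t)) \<le> C * (8276 / 100 * r ^ 10 + 281 * r ^ 8 + 23 * r ^ 7)"
        if "r \<in> {0..?L}" for r using le[OF that] by linarith
    qed
    moreover have "- (P ?L - P 0) \<le> \<Delta> I"
    proof (rule has_integral_le[OF has_integral_neg[OF P] DI])
      show "- (C * (8276 / 100 * r ^ 10 + 281 * r ^ 8 + 23 * r ^ 7)) \<le> r ^ 4 * tail r * \<Delta> (\<lambda>t. sphere_ft (r * t))"
        if "r \<in> {0..?L}" for r using le[OF that] by linarith
    qed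
    moreover have "P 0 = 0" by (simp add: P_def)
    ultimately show ?thesis unfolding P_def by linarith
  qed
  moreover have "\<bar>\<Delta> (\<lambda>t. sphere_ft (1 * t))\<bar> \<le> C * 1 ^ 6" by (rule sph)
  moreover have "\<bar>\<Delta> (\<lambda>t. sphere_ft (148 / 100 * t))\<bar> \<le> C * (148 / 100) ^ 6" by (rule sph)
  ultimately have "\<bar>dual_ft (a + 2 / 5 * s) - interp6 (\<lambda>j. dual_ft (a + 2 / 5 * (real j - 2))) s\<bar> \<le>
     4759 / 100 * (C * 1 ^ 6) + 38952157 / 375000 * (C * (148 / 100) ^ 6) +
     C * (8276 / 100 * (?L ^ 11 / 11) + 281 * (?L ^ 9 / 9) + 23 * (?L ^ 8 / 8))"
    unfolding eq by linarith
  also have "\<dots> \<le> 3305 / 10 ^ 6"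
    by (simp add: C_def power_divide)
  finally show ?thesis .
qed

section \<open>Sines and cosines in fixed-point arithmetic\<close>

lemma cos_taylor:
  "\<bar>cos x - (1 - x^2/2 + x^4/24 - x^6/720 + x^8/40320 - x^10/3628800 + x^12/479001600 - x^14/87178291200 + x^16/20922789888000)\<bar> \<le> \<bar>x\<bar>^18 / 6402373705728000"
  for x :: real
proof -
  obtain t where t: "cos x = (\<Sum>m<18. cos_coeff m * x ^ m) + (cos (t + 1 / 2 * real 18 * pi) / fact 18) * x ^ 18"
    using Maclaurin_cos_expansion[of x 18] by auto
  have "(\<Sum>m<18. cos_coeff m * x ^ m) = 1 - x^2/2 + x^4/24 - x^6/720 + x^8/40320 - x^10/3628800 + x^12/479001600 - x^14/87178291200 + x^16/20922789888000"
    by (simp add: cos_coeff_def lessThan_nat_numeral fact_numeral)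
  moreover have "\<bar>(cos (t + 1 / 2 * real 18 * pi) / fact 18) * x ^ 18\<bar> \<le> \<bar>x\<bar>^18 / fact 18"
  proof -
    have "\<bar>cos (t + 1 / 2 * real 18 * pi)\<bar> * \<bar>x\<bar> ^ 18 \<le> 1 * \<bar>x\<bar> ^ 18"
      by (intro mult_right_mono) auto
    then show ?thesis by (simp only: abs_mult abs_divide power_abs) (simp add: field_simps)
  qed
  ultimately show ?thesis unfolding t by (simp add: fact_numeral)
qed

lemma sin_taylor:
  "\<bar>sin x - (x - x^3/6 + x^5/120 - x^7/5040 + x^9/362880 - x^11/39916800 + x^13/6227020800 - x^15/1307674368000 + x^17/355687428096000)\<bar> \<le> \<bar>x\<bar>^19 / 121645100408832000"
  for x :: real
proof -
  have eq: "(\<Sum>m<19. sin_coeff m * x ^ m) = x - x^3/6 + x^5/120 - x^7/5040 + x^9/362880 - x^11/39916800 + x^13/6227020800 - x^15/1307674368000 + x^17/355687428096000"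
    by (simp add: sin_coeff_def lessThan_nat_numeral fact_numeral)
  have f: "inverse (fact 19) * \<bar>x\<bar> ^ 19 = \<bar>x\<bar>^19 / 121645100408832000"
    by (simp add: fact_numeral)
  show ?thesis using Maclaurin_sin_bound[of x 19] unfolding eq f .
qed

text \<open>\<open>(C, S)\<close> represents the point \<open>cis \<theta>\<close> in units of \<open>10 ^ (- 15)\<close>, with an error of at most \<open>k\<close>
units. Measuring the error by the complex modulus makes rotations error-free apart from
rounding.\<close>
definition near :: "real \<Rightarrow> real \<Rightarrow> int \<times> int \<Rightarrow> bool" where
  "near k \<theta> z \<longleftrightarrow> cmod (Complex (of_int (fst z)) (of_int (snd z)) - of_real (10 ^ 15) * cis \<theta>) \<le> k"

text \<open>Numerator of the Taylor polynomial of degree \<open>16\<close> at \<open>p / 10 ^ 4\<close> over the common denominator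
\<open>16! * 10 ^ 64\<close>, in Horner form; \<open>sin_num\<close> is the same for degree \<open>17\<close>.\<close>
definition cos_num :: "int \<Rightarrow> int" where
  "cos_num p = (let q = p * p; N = 10 ^ 8 in
     20922789888000 * N ^ 8 - q * (10461394944000 * N ^ 7 - q * (871782912000 * N ^ 6 - q * (29059430400 * N ^ 5 -
     q * (518918400 * N ^ 4 - q * (5765760 * N ^ 3 - q * (43680 * N ^ 2 - q * (240 * N - q))))))))"

definition sin_num :: "int \<Rightarrow> int" where
  "sin_num p = (let q = p * p; N = 10 ^ 8 in
     p * (355687428096000 * N ^ 8 - q * (59281238016000 * N ^ 7 - q * (2964061900800 * N ^ 6 - q * (70572902400 * N ^ 5 -
     q * (980179200 * N ^ 4 - q * (8910720 * N ^ 3 - q * (57120 * N ^ 2 - q * (272 * N - q)))))))))"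

lemma near_taylor:
  assumes p: "\<bar>p\<bar> \<le> 10 ^ 4"
    and c: "\<bar>10 ^ 15 * cos_num p - C * (20922789888000 * 10 ^ 64)\<bar> \<le> 20922789888000 * 10 ^ 64 div 2"
    and s: "\<bar>10 ^ 15 * sin_num p - S * (355687428096000 * 10 ^ 68)\<bar> \<le> 355687428096000 * 10 ^ 68 div 2"
  shows "near 2 (real_of_int p / 10 ^ 4) (C, S)"
proof -
  define x where "x = real_of_int p / 10 ^ 4"
  have px: "real_of_int p = 10 ^ 4 * x" by (simp add: x_def)
  have x: "\<bar>x\<bar> \<le> 1" using p by (simp add: x_def)
  have x18: "\<bar>x\<bar> ^ 18 \<le> 1" "\<bar>x\<bar> ^ 19 \<le> 1" by (rule power_le_one[OF abs_ge_zero x])+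
  have cn: "real_of_int (cos_num p) = 20922789888000 * 10 ^ 64 * (1 - x^2/2 + x^4/24 - x^6/720 + x^8/40320 - x^10/3628800 + x^12/479001600 - x^14/87178291200 + x^16/20922789888000)"
    by (simp add: cos_num_def Let_def px power_mult_distrib algebra_simps eval_nat_numeral)
  have sn: "real_of_int (sin_num p) = 355687428096000 * 10 ^ 68 * (x - x^3/6 + x^5/120 - x^7/5040 + x^9/362880 - x^11/39916800 + x^13/6227020800 - x^15/1307674368000 + x^17/355687428096000)"
    by (simp add: sin_num_def Let_def px power_mult_distrib algebra_simps eval_nat_numeral)
  have le: "\<bar>10 ^ 15 * y - z\<bar> \<le> 1 / 2"
    if "\<bar>10 ^ 15 * n - m * K\<bar> \<le> K div 2" "real_of_int n = K * y" "z = of_int m" "K > 0" for y z :: real and n m K :: int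
  proof -
    have "real_of_int \<bar>10 ^ 15 * n - m * K\<bar> \<le> real_of_int (K div 2)" using that(1) by linarith
    also have "\<dots> \<le> K / 2" by linarith
    finally have "real_of_int K * \<bar>10 ^ 15 * y - z\<bar> \<le> real_of_int K * (1 / 2)"
      using that(2-4) by (simp add: abs_mult_pos' algebra_simps flip: abs_mult_pos)
    then show ?thesis using that(4) by (simp add: mult_le_cancel_left)
  qed
  define yc where "yc = 1 - x^2/2 + x^4/24 - x^6/720 + x^8/40320 - x^10/3628800 + x^12/479001600 - x^14/87178291200 + x^16/20922789888000"
  define ys where "ys = x - x^3/6 + x^5/120 - x^7/5040 + x^9/362880 - x^11/39916800 + x^13/6227020800 - x^15/1307674368000 + x^17/355687428096000"
  have "\<bar>10 ^ 15 * yc - of_int C\<bar> \<le> 1 / 2"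
    using cn by (intro le[OF c]) (simp_all add: yc_def)
  moreover have "\<bar>cos x - yc\<bar> \<le> 1 / 6402373705728000"
    using cos_taylor[of x, folded yc_def] x18(1) by simp
  moreover have "\<bar>10 ^ 15 * cos x - of_int C\<bar> \<le> 10 ^ 15 * \<bar>cos x - yc\<bar> + \<bar>10 ^ 15 * yc - of_int C\<bar>"
  proof -
    have eq: "10 ^ 15 * cos x - of_int C = 10 ^ 15 * (cos x - yc) + (10 ^ 15 * yc - of_int C)"
      by (simp add: algebra_simps)
    show ?thesis unfolding eq by (rule order_trans[OF abs_triangle_ineq]) (simp only: abs_mult power_abs abs_numeral order_refl)
  qed
  ultimately have C: "\<bar>10 ^ 15 * cos x - C\<bar> \<le> 1" by simp
  have "\<bar>10 ^ 15 * ys - of_int S\<bar> \<le> 1 / 2"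
    using sn by (intro le[OF s]) (simp_all add: ys_def)
  moreover have "\<bar>sin x - ys\<bar> \<le> 1 / 121645100408832000"
    using sin_taylor[of x, folded ys_def] x18(2) by simp
  moreover have "\<bar>10 ^ 15 * sin x - of_int S\<bar> \<le> 10 ^ 15 * \<bar>sin x - ys\<bar> + \<bar>10 ^ 15 * ys - of_int S\<bar>"
  proof -
    have eq: "10 ^ 15 * sin x - of_int S = 10 ^ 15 * (sin x - ys) + (10 ^ 15 * ys - of_int S)"
      by (simp add: algebra_simps)
    show ?thesis unfolding eq by (rule order_trans[OF abs_triangle_ineq]) (simp only: abs_mult power_abs abs_numeral order_refl)
  qed
  ultimately have S: "\<bar>10 ^ 15 * sin x - S\<bar> \<le> 1" by simp
  have "cmod (Complex C S - of_real (10 ^ 15) * cis x) \<le> \<bar>C - 10 ^ 15 * cos x\<bar> + \<bar>S - 10 ^ 15 * sin x\<bar>"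
    using cmod_le[of "Complex C S - of_real (10 ^ 15) * cis x"] by simp
  also have "\<dots> \<le> 2" using C S by linarith
  finally show ?thesis by (simp add: near_def x_def)
qed

text \<open>Multiplication of complex numbers in fixed point, that is, the addition theorems with
truncation.\<close>
definition rot :: "int \<times> int \<Rightarrow> int \<times> int \<Rightarrow> int \<times> int" where
  "rot z w = ((fst z * fst w - snd z * snd w) div 10 ^ 15, (snd z * fst w + fst z * snd w) div 10 ^ 15)"

text \<open>The errors add up: \<open>2\<close> units come from truncating both coordinates, and \<open>1\<close> absorbs the product
of the two errors.\<close>
lemma near_rot:
  assumes z: "near a \<theta> z" and w: "near b \<phi> w" and ab: "a * b \<le> 10 ^ 15"
  shows "near (a + b + 3) (\<theta> + \<phi>) (rot z w)"
proof -
  define D :: real where "D = 10 ^ 15"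
  have D: "D > 0" by (simp add: D_def)
  define Z where "Z = Complex (of_int (fst z)) (of_int (snd z))"
  define W where "W = Complex (of_int (fst w)) (of_int (snd w))"
  define R where "R = Complex (of_int (fst (rot z w))) (of_int (snd (rot z w)))"
  have z: "cmod (Z - of_real D * cis \<theta>) \<le> a" and w: "cmod (W - of_real D * cis \<phi>) \<le> b"
    using z w by (simp_all add: near_def Z_def W_def D_def)
  have a: "a \<ge> 0" using z norm_ge_zero order_trans by blast
  have fl: "\<bar>real_of_int (n div 10 ^ 15) - of_int n / D\<bar> \<le> 1" for n :: int
    using floor_divide_of_int_eq[of n "10 ^ 15", where ?'a = real] by (simp add: D_def)
  have "cmod (R - Z * W / of_real D) \<le> \<bar>Re (R - Z * W / of_real D)\<bar> + \<bar>Im (R - Z * W / of_real D)\<bar>"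
    by (rule cmod_le)
  also have "\<dots> \<le> 1 + 1"
  proof (rule add_mono)
    show "\<bar>Re (R - Z * W / of_real D)\<bar> \<le> 1"
      using fl[of "fst z * fst w - snd z * snd w"] by (simp add: R_def Z_def W_def rot_def Re_divide_of_real)
    show "\<bar>Im (R - Z * W / of_real D)\<bar> \<le> 1"
      using fl[of "snd z * fst w + fst z * snd w"] by (simp add: R_def Z_def W_def rot_def Im_divide_of_real add.commute)
  qed
  finally have 1: "cmod (R - Z * W / of_real D) \<le> 2" by simp
  have "Z * W / of_real D - of_real D * cis (\<theta> + \<phi>) =
      (Z - of_real D * cis \<theta>) * W / of_real D + cis \<theta> * (W - of_real D * cis \<phi>)"
    using D by (simp add: cis_mult [symmetric] field_simps)
  then have "cmod (Z * W / of_real D - of_real D * cis (\<theta> + \<phi>)) \<le>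
      cmod ((Z - of_real D * cis \<theta>) * W / of_real D) + cmod (cis \<theta> * (W - of_real D * cis \<phi>))"
    by (simp add: norm_triangle_ineq)
  also have "cmod (cis \<theta> * (W - of_real D * cis \<phi>)) \<le> b"
    using w by (simp add: norm_mult)
  also have "cmod ((Z - of_real D * cis \<theta>) * W / of_real D) \<le> a * (D + b) / D"
  proof -
    have "cmod W \<le> cmod (of_real D * cis \<phi>) + cmod (W - of_real D * cis \<phi>)"
      by (metis norm_triangle_sub)
    then have "cmod W \<le> D + b" using w D by (simp add: norm_mult)
    then have "cmod (Z - of_real D * cis \<theta>) * cmod W / D \<le> a * (D + b) / D"
      using z a D by (intro divide_right_mono mult_mono) auto
    then show ?thesis using D by (simp add: norm_mult norm_divide)
  qed
  also have "a * (D + b) / D \<le> a + 1"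
    using ab D by (simp add: field_simps) (simp add: D_def)
  finally have 2: "cmod (Z * W / of_real D - of_real D * cis (\<theta> + \<phi>)) \<le> a + 1 + b" by simp
  have "cmod (R - of_real D * cis (\<theta> + \<phi>)) \<le> a + b + 3"
    using norm_triangle_ineq[of "R - Z * W / of_real D" "Z * W / of_real D - of_real D * cis (\<theta> + \<phi>)"] 1 2 by simp
  then show ?thesis by (simp add: near_def R_def D_def)
qed

lemma near_sin_cos:
  assumes "near k \<theta> (C, S)"
  shows "\<bar>cos \<theta> - of_int C / 10 ^ 15\<bar> \<le> k / 10 ^ 15" "\<bar>sin \<theta> - of_int S / 10 ^ 15\<bar> \<le> k / 10 ^ 15"
proof -
  have "cmod (Complex C S - of_real (10 ^ 15) * cis \<theta>) \<le> k" using assms by (simp add: near_def)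
  then have "\<bar>of_int C - 10 ^ 15 * cos \<theta>\<bar> \<le> k" "\<bar>of_int S - 10 ^ 15 * sin \<theta>\<bar> \<le> k"
    using abs_Re_le_cmod[of "Complex C S - of_real (10 ^ 15) * cis \<theta>"]
      abs_Im_le_cmod[of "Complex C S - of_real (10 ^ 15) * cis \<theta>"] by simp_all
  then show "\<bar>cos \<theta> - of_int C / 10 ^ 15\<bar> \<le> k / 10 ^ 15" "\<bar>sin \<theta> - of_int S / 10 ^ 15\<bar> \<le> k / 10 ^ 15"
    by (auto simp: field_simps abs_le_iff)
qed

text \<open>Compares \<open>sin (\<pi> / 6) = 1 / 2\<close> with Taylor polynomials, by monotonicity of the sine.\<close>
lemma pi_bounds: "314159 / 100000 < pi" "pi < 31416 / 10000"
proof -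
  have "x < h" if "\<bar>x - v\<bar> \<le> e" "v + e < h" for x v e h :: real
    using that by linarith
  note less = this[OF sin_taylor]
  have "h < x" if "\<bar>x - v\<bar> \<le> e" "h < v - e" for x v e h :: real
    using that by linarith
  note greater = this[OF sin_taylor]
  have b: "sin (314159 / 600000) < (1 / 2 :: real)"
    by (rule less) (simp add: power_divide)
  have b': "1 / 2 < sin (31416 / 60000 :: real)"
    by (rule greater) (simp add: power_divide)
  have half: "sin (pi / 6) = 1 / 2" by (rule sin_30)
  show "314159 / 100000 < pi"
  proof (rule ccontr)
    assume "\<not> ?thesis"
    then have "sin (pi / 6) \<le> sin (314159 / 600000)"
      using pi_ge_two by (intro sin_monotone_2pi_le) auto
    with b b' half show False by simp
  qed
  show "pi < 31416 / 10000"
  proof (rule ccontr)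
    assume "\<not> ?thesis"
    then have "sin (31416 / 60000) \<le> sin (pi / 6)"
      by (intro sin_monotone_2pi_le) auto
    with b b' half show False by simp
  qed
qed

section \<open>A table of values of the transform\<close>

text \<open>The two combinations of \<open>sin (1.53 a)\<close> and \<open>cos (1.53 a)\<close> in \<open>wave_ft a t 1.53\<close> that do not
depend on \<open>t\<close>, each multiplied by the weight \<open>b\<close> of the wave.\<close>
definition wave_sin_coeff :: "real \<Rightarrow> real \<Rightarrow> real" where
  "wave_sin_coeff a b = 9 * b * (sin (a * (153 / 100)) - a * (153 / 100) * cos (a * (153 / 100))) / (a ^ 3 * (153 / 100))"

definition wave_bessel_coeff :: "real \<Rightarrow> real \<Rightarrow> real" where
  "wave_bessel_coeff a b = 9 * b * sin (a * (153 / 100)) / (a * (153 / 100))"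

lemma wave_ft_coeffs:
  assumes "a > 0" "t > 0"
  shows "b * wave_ft a t (153 / 100) = (t\<^sup>2 * wave_sin_coeff a b * sin (t * (153 / 100)) -
     wave_bessel_coeff a b * (sin (t * (153 / 100)) - t * (153 / 100) * cos (t * (153 / 100)))) / (a\<^sup>2 - t\<^sup>2) / t ^ 3"
proof -
  have gen: "b * (9 / (a ^ 3 * t ^ 3 * d) * ((t\<^sup>2 * U * S - a\<^sup>2 * J * \<sigma>) / L)) =
     (t\<^sup>2 * (9 * b * U / (a ^ 3 * L)) * S - (9 * b * \<sigma> / (a * L)) * J) / d / t ^ 3"
    if "L \<noteq> 0" for U S J \<sigma> d L :: real
    using assms that by (cases "d = 0") (simp_all add: field_simps eval_nat_numeral)
  show ?thesis
    unfolding wave_ft_def wave_sin_coeff_def wave_bessel_coeff_def by (rule gen) simp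
qed

text \<open>The form used for numerical evaluation: one division by \<open>t\<^sup>3\<close> at the end, and at each \<open>t\<close> only the
sines and cosines of \<open>t\<close>, \<open>1.48 t\<close> and \<open>1.53 t\<close>.\<close>
lemma dual_ft_trig:
  assumes t: "t > 0" "t \<noteq> 997 / 100" "t \<noteq> 1492 / 100"
  shows "dual_ft t = 1 + (14277 / 100 * (sin t - t * cos t) +
      769 / 8 * (sin (148 / 100 * t) - 148 / 100 * t * cos (148 / 100 * t)) +
      581198652 / 1000000 * sin (t * (153 / 100)) -
      (t\<^sup>2 * wave_sin_coeff (997 / 100) (39635 / 10) * sin (t * (153 / 100)) -
        wave_bessel_coeff (997 / 100) (39635 / 10) * (sin (t * (153 / 100)) - t * (153 / 100) * cos (t * (153 / 100)))) / ((997 / 100)\<^sup>2 - t\<^sup>2) -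
      (t\<^sup>2 * wave_sin_coeff (1492 / 100) (119401 / 10) * sin (t * (153 / 100)) -
        wave_bessel_coeff (1492 / 100) (119401 / 10) * (sin (t * (153 / 100)) - t * (153 / 100) * cos (t * (153 / 100)))) / ((1492 / 100)\<^sup>2 - t\<^sup>2) -
      74484 / 100 * (sin (t * (153 / 100)) - t * (153 / 100) * cos (t * (153 / 100))) / t\<^sup>2) / t ^ 3"
proof -
  have 1: "4759 / 100 * sphere_ft t = 14277 / 100 * (sin t - t * cos t) / t ^ 3"
    using t by (simp add: sphere_ft_def)
  have 2: "38952157 / 375000 * sphere_ft (148 / 100 * t) = 769 / 8 * (sin (148 / 100 * t) - 148 / 100 * t * cos (148 / 100 * t)) / t ^ 3"
  proof -
    have "38952157 / 375000 * (3 * Y / (148 / 100 * t) ^ 3) = 769 / 8 * Y / t ^ 3" for Y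
      using t by (simp add: power_mult_distrib field_simps)
    moreover have "sphere_ft (148 / 100 * t) = 3 * (sin (148 / 100 * t) - 148 / 100 * t * cos (148 / 100 * t)) / (148 / 100 * t) ^ 3"
      using t by (simp add: sphere_ft_def)
    ultimately show ?thesis by (simp only:)
  qed
  have 3: "8276 / 100 * ball_ft t (153 / 100) =
     (74484 / 100 * (sin (t * (153 / 100)) - t * (153 / 100) * cos (t * (153 / 100))) / t\<^sup>2 - 581198652 / 1000000 * sin (t * (153 / 100))) / t ^ 3"
    using t by (simp add: ball_ft_def field_simps eval_nat_numeral)
  have "(0::real) < 997 / 100" "(0::real) < 1492 / 100" by simp_all
  note w = this[THEN wave_ft_coeffs, OF t(1)]
  have gen: "1 + A / T + B / T - ((C - E) / T + X / T + Y / T) = 1 + (A + B + E - X - Y - C) / T" for A B C E X Y T :: real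
    by (simp add: diff_divide_distrib add_divide_distrib)
  show ?thesis
    unfolding dual_ft_eq[OF t] 1 2 3 w by (rule gen)
qed

text \<open>A wave term of \<open>dual_ft_trig\<close> at \<open>t = m / 5\<close> in units of \<open>10 ^ (- 23)\<close>: \<open>P\<close> and \<open>Q\<close> carry a
scale of \<open>10 ^ 8\<close>, \<open>S\<close> and \<open>J\<close> one of \<open>10 ^ 15\<close> and \<open>500 * 10 ^ 15\<close>, and \<open>d\<close> is
\<open>10 ^ 4 * a\<^sup>2\<close>.\<close>
definition wave_int :: "int \<Rightarrow> int \<Rightarrow> int \<Rightarrow> int \<Rightarrow> int \<Rightarrow> int \<Rightarrow> int" where
  "wave_int P Q d m S J = (20 * (20 * m\<^sup>2 * P * S - Q * J)) div (d - 400 * m\<^sup>2)"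

text \<open>Tests with integers whether \<open>dual_ft (m / 5)\<close> is within one unit of \<open>f\<close>, in units of
\<open>10 ^ (- 5)\<close>, when the approximations \<open>z1, z2, z3\<close> to the sines and cosines are taken as exact. With
\<open>M = 10 ^ 18 * m ^ 5\<close> all denominators of \<open>dual_ft_trig\<close> are cleared; \<open>V\<close> is \<open>M\<close> times the
deviation from \<open>f\<close> in these units. The four long constants are the coefficients
\<open>wave_sin_coeff\<close> and \<open>wave_bessel_coeff\<close> in units of \<open>10 ^ (- 8)\<close>.\<close>
definition value_ok :: "int \<Rightarrow> int \<times> int \<Rightarrow> int \<times> int \<Rightarrow> int \<times> int \<Rightarrow> int \<Rightarrow> bool" where
  "value_ok m z1 z2 z3 f = (let S = snd z3; J = 500 * S - 153 * m * fst z3;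
       M = 1000000000000000000 * m ^ 5;
       V = 125 * (m\<^sup>2 * (2855400000 * (5 * snd z1 - m * fst z1) + 76900000 * (125 * snd z2 - 37 * m * fst z2) +
          58119865200 * S - wave_int 33284814654 102528803905 994009 m S J -
          wave_int 30778731513 (-349423465064) 2226064 m S J) - 3724200000 * J) - M * (f - 100000)
     in \<bar>V\<bar> \<le> M)"

lemma abs_perturb_mult:
  fixes x y x' y' :: real
  assumes "\<bar>x - x'\<bar> \<le> d" "\<bar>y - y'\<bar> \<le> e" "\<bar>x'\<bar> \<le> X" "\<bar>y\<bar> \<le> Y"
  shows "\<bar>x * y - x' * y'\<bar> \<le> d * Y + X * e"
proof -
  have "x * y - x' * y' = (x - x') * y + x' * (y - y')" by (simp add: algebra_simps)
  then have "\<bar>x * y - x' * y'\<bar> \<le> \<bar>x - x'\<bar> * \<bar>y\<bar> + \<bar>x'\<bar> * \<bar>y - y'\<bar>"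
    by (metis abs_mult abs_triangle_ineq)
  also have "\<dots> \<le> d * Y + X * e"
    using assms by (intro add_mono mult_mono) auto
  finally show ?thesis .
qed

text \<open>Besides the one unit that \<open>value_ok\<close> allows, there are the errors of the sines and cosines, of the
wave coefficients and of two integer divisions. They are propagated through \<open>dual_ft_trig\<close>. The
worst case is the division by \<open>t\<^sup>3\<close> at \<open>t = 1 / 5\<close>, where they still stay below \<open>9 * 10 ^ (- 6)\<close>.
The conditions \<open>d1\<close> and \<open>d2\<close> keep \<open>t\<close> away from the removable poles at \<open>9.97\<close> and
\<open>14.92\<close>.\<close>
lemma value_ok_imp:
  assumes ok: "value_ok m z1 z2 z3 f" and m: "m \<ge> 1" and t: "t = real_of_int m / 5"
    and d1: "\<bar>994009 - 400 * m\<^sup>2\<bar> \<ge> 20000" and d2: "\<bar>2226064 - 400 * m\<^sup>2\<bar> \<ge> 20000"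
    and z1: "near 1000 t z1" and z2: "near 1000 (148 / 100 * t) z2" and z3: "near 1000 (t * (153 / 100)) z3"
    and P1: "\<bar>wave_sin_coeff (997 / 100) (39635 / 10) - 33284814654 / 10 ^ 8\<bar> \<le> 2 / 10 ^ 8"
    and Q1: "\<bar>wave_bessel_coeff (997 / 100) (39635 / 10) - 102528803905 / 10 ^ 8\<bar> \<le> 2 / 10 ^ 8"
    and P2: "\<bar>wave_sin_coeff (1492 / 100) (119401 / 10) - 30778731513 / 10 ^ 8\<bar> \<le> 2 / 10 ^ 8"
    and Q2: "\<bar>wave_bessel_coeff (1492 / 100) (119401 / 10) - (- 349423465064) / 10 ^ 8\<bar> \<le> 2 / 10 ^ 8"
  shows "\<bar>dual_ft t - of_int f / 10 ^ 5\<bar> \<le> 2 / 10 ^ 5"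
proof -
  define D :: real where "D = 10 ^ 15"
  define \<epsilon> :: real where "\<epsilon> = 1 / 10 ^ 12"
  define \<eta> :: real where "\<eta> = 2 / 10 ^ 8"
  have t5: "t \<ge> 1 / 5" using m by (simp add: t)
  have t0: "t > 0" using t5 by linarith
  obtain C1 S1 C2 S2 C3 S3 where z: "z1 = (C1, S1)" "z2 = (C2, S2)" "z3 = (C3, S3)"
    by (metis surj_pair)
  define c1 s1 c2 s2 c3 s3 where "c1 = real_of_int C1 / D" and "s1 = real_of_int S1 / D"
    and "c2 = real_of_int C2 / D" and "s2 = real_of_int S2 / D"
    and "c3 = real_of_int C3 / D" and "s3 = real_of_int S3 / D"
  have tr: "\<bar>cos t - c1\<bar> \<le> \<epsilon>" "\<bar>sin t - s1\<bar> \<le> \<epsilon>"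
    "\<bar>cos (148 / 100 * t) - c2\<bar> \<le> \<epsilon>" "\<bar>sin (148 / 100 * t) - s2\<bar> \<le> \<epsilon>"
    "\<bar>cos (t * (153 / 100)) - c3\<bar> \<le> \<epsilon>" "\<bar>sin (t * (153 / 100)) - s3\<bar> \<le> \<epsilon>"
    using near_sin_cos[OF z1[unfolded z]] near_sin_cos[OF z2[unfolded z]] near_sin_cos[OF z3[unfolded z]]
    by (simp_all add: c1_def s1_def c2_def s2_def c3_def s3_def D_def \<epsilon>_def)
  have bes: "\<bar>(S - x * C) - (s - x * c)\<bar> \<le> \<epsilon> * (1 + x)"
    if "\<bar>C - c\<bar> \<le> \<epsilon>" "\<bar>S - s\<bar> \<le> \<epsilon>" "x \<ge> 0" for S C s c x :: real
  proof -
    have "(S - x * C) - (s - x * c) = (S - s) - x * (C - c)" by (simp add: algebra_simps)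
    then have "\<bar>(S - x * C) - (s - x * c)\<bar> \<le> \<bar>S - s\<bar> + x * \<bar>C - c\<bar>"
      using abs_triangle_ineq4[of "S - s" "x * (C - c)"] that(3) by (simp add: abs_mult)
    also have "\<dots> \<le> \<epsilon> + x * \<epsilon>" using that by (intro add_mono mult_left_mono) auto
    finally show ?thesis by (simp add: algebra_simps)
  qed
  define B1 b1 where "B1 = sin t - t * cos t" and "b1 = s1 - t * c1"
  define B2 b2 where "B2 = sin (148 / 100 * t) - 148 / 100 * t * cos (148 / 100 * t)" and "b2 = s2 - 148 / 100 * t * c2"
  define B3 b3 where "B3 = sin (t * (153 / 100)) - t * (153 / 100) * cos (t * (153 / 100))" and "b3 = s3 - t * (153 / 100) * c3"
  define S where "S = sin (t * (153 / 100))"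
  have eB1: "\<bar>B1 - b1\<bar> \<le> \<epsilon> * (1 + t)" unfolding B1_def b1_def using tr t0 by (intro bes) auto
  have eB2: "\<bar>B2 - b2\<bar> \<le> \<epsilon> * (1 + 148 / 100 * t)" unfolding B2_def b2_def using tr t0 by (intro bes) auto
  have eB3: "\<bar>B3 - b3\<bar> \<le> \<epsilon> * (1 + t * (153 / 100))" unfolding B3_def b3_def using tr t0 by (intro bes) auto
  have eS: "\<bar>S - s3\<bar> \<le> \<epsilon>" unfolding S_def by (rule tr)
  have S1: "\<bar>S\<bar> \<le> 1" by (simp add: S_def)
  have B3: "\<bar>B3\<bar> \<le> 1 + t * (153 / 100)"
  proof -
    have "\<bar>t * (153 / 100) * cos (t * (153 / 100))\<bar> \<le> t * (153 / 100) * 1"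
      unfolding abs_mult using t0 by (intro mult_mono) auto
    then show ?thesis unfolding B3_def using abs_sin_le_one[of "t * (153 / 100)"] by linarith
  qed
  \<comment> \<open>The errors of both coefficients and both trigonometric factors enter, and the denominator, at least
    \<open>2\<close> in size, halves them.\<close>
  have wave: "\<bar>(t\<^sup>2 * P * S - Q * B3) / d - (t\<^sup>2 * p * s3 - q * b3) / d\<bar> \<le>
     (t\<^sup>2 * (\<eta> + K * \<epsilon>) + (\<eta> + K * \<epsilon>) * (1 + t * (153 / 100))) / 2"
    if "\<bar>P - p\<bar> \<le> \<eta>" "\<bar>Q - q\<bar> \<le> \<eta>" "\<bar>p\<bar> \<le> K" "\<bar>q\<bar> \<le> K" "\<bar>d\<bar> \<ge> 2" for P Q p q K d
  proof -
    have 1: "\<bar>P * S - p * s3\<bar> \<le> \<eta> * 1 + K * \<epsilon>"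
      using that eS S1 by (intro abs_perturb_mult)
    have 2: "\<bar>Q * B3 - q * b3\<bar> \<le> \<eta> * (1 + t * (153 / 100)) + K * (\<epsilon> * (1 + t * (153 / 100)))"
      using that eB3 B3 by (intro abs_perturb_mult)
    have "(t\<^sup>2 * P * S - Q * B3) - (t\<^sup>2 * p * s3 - q * b3) = t\<^sup>2 * (P * S - p * s3) - (Q * B3 - q * b3)"
      by (simp add: algebra_simps)
    then have "\<bar>(t\<^sup>2 * P * S - Q * B3) - (t\<^sup>2 * p * s3 - q * b3)\<bar> \<le> t\<^sup>2 * \<bar>P * S - p * s3\<bar> + \<bar>Q * B3 - q * b3\<bar>"
      using abs_triangle_ineq4[of "t\<^sup>2 * (P * S - p * s3)" "Q * B3 - q * b3"] by (simp add: abs_mult)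
    also have "\<dots> \<le> t\<^sup>2 * (\<eta> + K * \<epsilon>) + (\<eta> + K * \<epsilon>) * (1 + t * (153 / 100))"
    proof (intro add_mono mult_left_mono)
      show "\<bar>Q * B3 - q * b3\<bar> \<le> (\<eta> + K * \<epsilon>) * (1 + t * (153 / 100))"
        using 2 by (simp only: distrib_right mult.assoc)
    qed (use 1 in auto)
    finally have "\<bar>(t\<^sup>2 * P * S - Q * B3) - (t\<^sup>2 * p * s3 - q * b3)\<bar> / \<bar>d\<bar> \<le>
       (t\<^sup>2 * (\<eta> + K * \<epsilon>) + (\<eta> + K * \<epsilon>) * (1 + t * (153 / 100))) / 2"
      using that(5) by (intro frac_le) auto
    then show ?thesis by (simp flip: diff_divide_distrib abs_divide)
  qed
  define W1 w1 where "W1 = (t\<^sup>2 * wave_sin_coeff (997 / 100) (39635 / 10) * S - wave_bessel_coeff (997 / 100) (39635 / 10) * B3) / ((997 / 100)\<^sup>2 - t\<^sup>2)"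
    and "w1 = (t\<^sup>2 * (33284814654 / 10 ^ 8) * s3 - 102528803905 / 10 ^ 8 * b3) / ((997 / 100)\<^sup>2 - t\<^sup>2)"
  define W2 w2 where "W2 = (t\<^sup>2 * wave_sin_coeff (1492 / 100) (119401 / 10) * S - wave_bessel_coeff (1492 / 100) (119401 / 10) * B3) / ((1492 / 100)\<^sup>2 - t\<^sup>2)"
    and "w2 = (t\<^sup>2 * (30778731513 / 10 ^ 8) * s3 - (- 349423465064) / 10 ^ 8 * b3) / ((1492 / 100)\<^sup>2 - t\<^sup>2)"
  have dd: "(997 / 100)\<^sup>2 - t\<^sup>2 = of_int (994009 - 400 * m\<^sup>2) / 10 ^ 4" "(1492 / 100)\<^sup>2 - t\<^sup>2 = of_int (2226064 - 400 * m\<^sup>2) / 10 ^ 4"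
    by (simp_all add: t power_divide)
  have dd2: "\<bar>(997 / 100)\<^sup>2 - t\<^sup>2\<bar> \<ge> 2" "\<bar>(1492 / 100)\<^sup>2 - t\<^sup>2\<bar> \<ge> 2"
  proof -
    have "real_of_int 20000 \<le> real_of_int \<bar>994009 - 400 * m\<^sup>2\<bar>" "real_of_int 20000 \<le> real_of_int \<bar>2226064 - 400 * m\<^sup>2\<bar>"
      using d1 d2 by (simp_all only: of_int_le_iff)
    then show "\<bar>(997 / 100)\<^sup>2 - t\<^sup>2\<bar> \<ge> 2" "\<bar>(1492 / 100)\<^sup>2 - t\<^sup>2\<bar> \<ge> 2"
      unfolding dd by (simp_all add: abs_divide)
  qed
  have eW1: "\<bar>W1 - w1\<bar> \<le> (t\<^sup>2 * (\<eta> + 3600 * \<epsilon>) + (\<eta> + 3600 * \<epsilon>) * (1 + t * (153 / 100))) / 2"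
    unfolding W1_def w1_def using P1 Q1 dd2 by (intro wave) (simp_all add: \<eta>_def)
  have eW2: "\<bar>W2 - w2\<bar> \<le> (t\<^sup>2 * (\<eta> + 3600 * \<epsilon>) + (\<eta> + 3600 * \<epsilon>) * (1 + t * (153 / 100))) / 2"
    unfolding W2_def w2_def using P2 Q2 dd2 by (intro wave) (simp_all add: \<eta>_def)
  \<comment> \<open>Each integer division costs at most one unit of \<open>10 ^ (- 23)\<close>.\<close>
  define J where "J = 500 * S3 - 153 * m * C3"
  define u1 u2 where "u1 = real_of_int (wave_int 33284814654 102528803905 994009 m S3 J) / (10 ^ 8 * D)"
    and "u2 = real_of_int (wave_int 30778731513 (-349423465064) 2226064 m S3 J) / (10 ^ 8 * D)"
  have J: "b3 = of_int J / (500 * D)"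
    by (simp add: b3_def s3_def c3_def J_def t D_def field_simps)
  have fl: "\<bar>real_of_int (n div k) - of_int n / of_int k\<bar> \<le> 1" for n k :: int
    using floor_divide_of_int_eq[of n k, where ?'a = real] by linarith
  have wu: "\<bar>(t\<^sup>2 * (of_int p / 10 ^ 8) * s3 - of_int q / 10 ^ 8 * b3) / (of_int (k - 400 * m\<^sup>2) / 10 ^ 4) - of_int (wave_int p q k m S3 J) / (10 ^ 8 * D)\<bar> \<le> \<epsilon>"
    if "k - 400 * m\<^sup>2 \<noteq> 0" for p q k
  proof -
    have quot: "(t\<^sup>2 * (of_int p / 10 ^ 8) * s3 - of_int q / 10 ^ 8 * b3) / (of_int (k - 400 * m\<^sup>2) / 10 ^ 4) =
       of_int (20 * (20 * m\<^sup>2 * p * S3 - q * J)) / of_int (k - 400 * m\<^sup>2) / (10 ^ 8 * D)"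
    proof -
      have "(t\<^sup>2 * (of_int p / 10 ^ 8) * s3 - of_int q / 10 ^ 8 * b3) * 10 ^ 4 = of_int (20 * (20 * m\<^sup>2 * p * S3 - q * J)) / (10 ^ 8 * D)"
        by (simp add: t s3_def J D_def power_divide field_simps)
      moreover have "x / (y / c) = x * c / y" for x y c :: real by simp
      ultimately show ?thesis by (simp only: divide_divide_eq_left mult.commute)
    qed
    have "\<bar>(t\<^sup>2 * (of_int p / 10 ^ 8) * s3 - of_int q / 10 ^ 8 * b3) / (of_int (k - 400 * m\<^sup>2) / 10 ^ 4) - of_int (wave_int p q k m S3 J) / (10 ^ 8 * D)\<bar> =
      \<bar>of_int (20 * (20 * m\<^sup>2 * p * S3 - q * J)) / of_int (k - 400 * m\<^sup>2) - of_int (wave_int p q k m S3 J)\<bar> / (10 ^ 8 * D)"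
    proof -
      have "\<bar>y / K - v / K\<bar> = \<bar>y - v\<bar> / K" if "K > 0" for y v K :: real
        using that by (simp add: abs_divide flip: diff_divide_distrib)
      moreover have "10 ^ 8 * D > 0" by (simp add: D_def)
      ultimately show ?thesis by (simp only: quot)
    qed
    also have "\<dots> \<le> 1 / (10 ^ 8 * D)"
      using fl[of "20 * (20 * m\<^sup>2 * p * S3 - q * J)" "k - 400 * m\<^sup>2"]
      by (intro divide_right_mono) (simp_all add: wave_int_def abs_minus_commute D_def)
    also have "\<dots> \<le> \<epsilon>" by (simp add: D_def \<epsilon>_def)
    finally show ?thesis .
  qed
  have eu1: "\<bar>w1 - u1\<bar> \<le> \<epsilon>"
    using wu[of 994009 33284814654 102528803905] d1 unfolding w1_def u1_def dd by fastforce
  have eu2: "\<bar>w2 - u2\<bar> \<le> \<epsilon>"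
    using wu[of 2226064 30778731513 "-349423465064"] d2 unfolding w2_def u2_def dd by fastforce
  define T \<tau> where "T = 14277 / 100 * B1 + 769 / 8 * B2 + 581198652 / 1000000 * S - W1 - W2 - 74484 / 100 * B3 / t\<^sup>2"
    and "\<tau> = 14277 / 100 * b1 + 769 / 8 * b2 + 581198652 / 1000000 * s3 - u1 - u2 - 74484 / 100 * b3 / t\<^sup>2"
  have F: "dual_ft t = 1 + T / t ^ 3"
  proof -
    have "(997 / 100)\<^sup>2 - t\<^sup>2 \<noteq> 0" "(1492 / 100)\<^sup>2 - t\<^sup>2 \<noteq> 0" using dd2 by auto
    then have "t \<noteq> 997 / 100" "t \<noteq> 1492 / 100" by auto
    from dual_ft_trig[OF t0 this] show ?thesis
      by (simp only: T_def B1_def B2_def B3_def S_def W1_def W2_def)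
  qed
  have eB3': "\<bar>B3 / t\<^sup>2 - b3 / t\<^sup>2\<bar> \<le> \<epsilon> * (1 + t * (153 / 100)) / t\<^sup>2"
    using divide_right_mono[OF eB3, of "t\<^sup>2"] by (simp add: abs_divide flip: diff_divide_distrib)
  define E where "E = 14277 / 100 * (\<epsilon> * (1 + t)) + 769 / 8 * (\<epsilon> * (1 + 148 / 100 * t)) + 581198652 / 1000000 * \<epsilon>
     + (t\<^sup>2 * (\<eta> + 3600 * \<epsilon>) + (\<eta> + 3600 * \<epsilon>) * (1 + t * (153 / 100))) + 2 * \<epsilon>
     + 74484 / 100 * (\<epsilon> * (1 + t * (153 / 100)) / t\<^sup>2)"
  have "\<bar>T - \<tau>\<bar> \<le> E"
  proof -
    have "T - \<tau> = 14277 / 100 * (B1 - b1) + 769 / 8 * (B2 - b2) + 581198652 / 1000000 * (S - s3) - (W1 - w1) - (w1 - u1)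
      - (W2 - w2) - (w2 - u2) - 74484 / 100 * (B3 / t\<^sup>2 - b3 / t\<^sup>2)"
    proof -
      have "a * B1 + b * B2 + c * S - W1 - W2 - d * X - (a * b1 + b * b2 + c * s3 - u1 - u2 - d * x) =
        a * (B1 - b1) + b * (B2 - b2) + c * (S - s3) - (W1 - w1) - (w1 - u1) - (W2 - w2) - (w2 - u2) - d * (X - x)"
        for a b c d X x by (simp add: algebra_simps)
      from this[of "14277 / 100" "769 / 8" "581198652 / 1000000" "74484 / 100" "B3 / t\<^sup>2" "b3 / t\<^sup>2"]
      show ?thesis unfolding T_def \<tau>_def by (simp only: times_divide_eq_right)
    qed
    then have eq: "T - \<tau> = \<dots>" .
    have gen: "\<bar>a * x1 + b * x2 + c * x3 - x4 - x5 - x6 - x7 - d * x8\<bar> \<le> a * e1 + b * e2 + c * e + w + 2 * e + d * e8"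
      if "\<bar>x1\<bar> \<le> e1" "\<bar>x2\<bar> \<le> e2" "\<bar>x3\<bar> \<le> e" "\<bar>x4\<bar> \<le> w / 2" "\<bar>x5\<bar> \<le> e" "\<bar>x6\<bar> \<le> w / 2" "\<bar>x7\<bar> \<le> e" "\<bar>x8\<bar> \<le> e8"
        "a \<ge> 0" "b \<ge> 0" "c \<ge> 0" "d \<ge> 0" for a b c d e e1 e2 e8 w x1 x2 x3 x4 x5 x6 x7 x8 :: real
    proof -
      have m: "\<bar>k * x\<bar> \<le> k * y" if "\<bar>x\<bar> \<le> y" "k \<ge> 0" for k x y :: real
        using that by (simp add: abs_mult mult_left_mono)
      note f = m[OF that(1,9)] m[OF that(2,10)] m[OF that(3,11)] m[OF that(8,12)] that(4-7)
      show ?thesis using f[THEN abs_le_D1] f[THEN abs_le_D2] by (intro abs_leI) linarith+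
    qed
    show ?thesis unfolding eq E_def
      by (rule gen[OF eB1 eB2 eS eW1 eu1 eW2 eu2 eB3']) simp_all
  qed
  also have "E \<le> 9 / 10 ^ 6 * t ^ 3"
  proof -
    have a: "t\<^sup>2 \<le> 5 * t ^ 3" "t \<le> 25 * t ^ 3" "1 \<le> 125 * t ^ 3"
    proof -
      have "t\<^sup>2 * 1 \<le> t\<^sup>2 * (5 * t)" using t5 by (intro mult_left_mono) auto
      then show 1: "t\<^sup>2 \<le> 5 * t ^ 3" by (simp add: power3_eq_cube power2_eq_square)
      have "t * 1 \<le> t * (5 * t)" using t5 t0 by (intro mult_left_mono) auto
      then have 2: "t \<le> 5 * t\<^sup>2" by (simp add: power2_eq_square)
      with 1 show "t \<le> 25 * t ^ 3" by linarith
      then show "1 \<le> 125 * t ^ 3" using t5 by linarith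
    qed
    have b: "(1 + t * (153 / 100)) / t\<^sup>2 \<le> 4200 * t ^ 3"
    proof -
      have "t * 1 \<le> t * (125 * t ^ 3)" "1 * 1 \<le> (125 * t ^ 3) * (5 * t)"
        using a t0 t5 by (intro mult_mono; simp)+
      then have t4: "t \<le> 125 * t ^ 4" "1 \<le> 625 * t ^ 4" by (simp_all add: eval_nat_numeral)
      have "1 \<le> 3125 * t ^ 5"
      proof -
        have "1 * 1 \<le> (625 * t ^ 4) * (5 * t)" using t4 t5 by (intro mult_mono) auto
        then show ?thesis by (simp add: eval_nat_numeral)
      qed
      moreover have "t \<le> 625 * t ^ 5"
      proof -
        have "t * 1 \<le> t * (625 * t ^ 4)" using t4 t0 by (intro mult_left_mono) auto
        then show ?thesis by (simp add: eval_nat_numeral)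
      qed
      ultimately have "1 + t * (153 / 100) \<le> 4200 * t ^ 5" by linarith
      also have "\<dots> = 4200 * t ^ 3 * t\<^sup>2" by (simp add: eval_nat_numeral)
      finally show ?thesis using t0 by (simp add: divide_le_eq)
    qed
    have "E = \<epsilon> * (14277 / 100 * (1 + t) + 769 / 8 * (1 + 148 / 100 * t) + 581198652 / 1000000 + 2 + 74484 / 100 * ((1 + t * (153 / 100)) / t\<^sup>2))
      + (\<eta> + 3600 * \<epsilon>) * (t\<^sup>2 + 1 + t * (153 / 100))"
    proof -
      have "14277 / 100 * (\<epsilon> * (1 + t)) + 769 / 8 * (\<epsilon> * (1 + 148 / 100 * t)) + 581198652 / 1000000 * \<epsilon> +
        (t\<^sup>2 * d + d * (1 + t * (153 / 100))) + 2 * \<epsilon> + 74484 / 100 * (\<epsilon> * X) =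
        \<epsilon> * (14277 / 100 * (1 + t) + 769 / 8 * (1 + 148 / 100 * t) + 581198652 / 1000000 + 2 + 74484 / 100 * X) +
        d * (t\<^sup>2 + 1 + t * (153 / 100))" for d X by (simp add: algebra_simps)
      from this[of "\<eta> + 3600 * \<epsilon>" "(1 + t * (153 / 100)) / t\<^sup>2"] show ?thesis
        unfolding E_def by (simp only: times_divide_eq_right)
    qed
    also have "\<dots> \<le> \<epsilon> * (3400000 * t ^ 3) + (\<eta> + 3600 * \<epsilon>) * (170 * t ^ 3)"
    proof (intro add_mono mult_left_mono)
      show "14277 / 100 * (1 + t) + 769 / 8 * (1 + 148 / 100 * t) + 581198652 / 1000000 + 2 + 74484 / 100 * ((1 + t * (153 / 100)) / t\<^sup>2) \<le> 3400000 * t ^ 3"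
      proof -
        have "14277 / 100 * (1 + t) + 769 / 8 * (1 + 148 / 100 * t) + 581198652 / 1000000 + 2 + 74484 / 100 * X \<le> 3400000 * t ^ 3"
          if "0 \<le> X" "X \<le> 4200 * t ^ 3" for X
        proof -
          have "14277 / 100 * (1 + t) + 769 / 8 * (1 + 148 / 100 * t) + 581198652 / 1000000 + 2 + 74484 / 100 * X \<le>
              143 * (1 + t) + 97 * (1 + 2 * t) + 582 + 2 + 745 * (4200 * t ^ 3)"
            using that t0 a(3) by (intro add_mono mult_mono) auto
          also have "\<dots> \<le> 3400000 * t ^ 3" using a(2,3) by simp
          finally show ?thesis .
        qed
        moreover have "0 \<le> (1 + t * (153 / 100)) / t\<^sup>2" using t0 by simp
        ultimately show ?thesis using b by blast
      qed
      show "t\<^sup>2 + 1 + t * (153 / 100) \<le> 170 * t ^ 3"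
        using a by linarith
    qed (simp_all add: \<epsilon>_def \<eta>_def)
    also have "\<dots> = (\<epsilon> * 3400000 + (\<eta> + 3600 * \<epsilon>) * 170) * t ^ 3" by (simp add: algebra_simps)
    also have "\<dots> \<le> 9 / 10 ^ 6 * t ^ 3"
      using t0 by (intro mult_right_mono) (simp_all add: \<epsilon>_def \<eta>_def)
    finally show ?thesis .
  qed
  finally have "\<bar>T - \<tau>\<bar> / t ^ 3 \<le> 9 / 10 ^ 6"
    using t0 by (simp add: divide_le_eq)
  then have 1: "\<bar>T / t ^ 3 - \<tau> / t ^ 3\<bar> \<le> 9 / 10 ^ 6"
    using t0 by (simp add: abs_divide flip: diff_divide_distrib)
  have 2: "\<bar>1 + \<tau> / t ^ 3 - of_int f / 10 ^ 5\<bar> \<le> 1 / 10 ^ 5"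
  proof -
    define M V where "M = 1000000000000000000 * m ^ 5"
      and "V = 125 * (m\<^sup>2 * (2855400000 * (5 * S1 - m * C1) + 76900000 * (125 * S2 - 37 * m * C2) +
          58119865200 * S3 - wave_int 33284814654 102528803905 994009 m S3 J -
          wave_int 30778731513 (-349423465064) 2226064 m S3 J) - 3724200000 * J) - M * (f - 100000)"
    have "\<bar>V\<bar> \<le> M"
      using ok by (simp add: value_ok_def Let_def z M_def V_def J_def)
    then have VM: "\<bar>real_of_int V\<bar> \<le> real_of_int M" by linarith
    have M0: "real_of_int M > 0" using m by (simp add: M_def)
    have m0: "real_of_int m \<noteq> 0" using m by simp
    have V: "real_of_int V = 10 ^ 5 * real_of_int M * (1 + \<tau> / t ^ 3 - of_int f / 10 ^ 5)"
    proof -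
      have iw: "real_of_int (wave_int 33284814654 102528803905 994009 m S3 J) = 10 ^ 8 * D * u1"
        "real_of_int (wave_int 30778731513 (-349423465064) 2226064 m S3 J) = 10 ^ 8 * D * u2"
        by (simp_all add: u1_def u2_def D_def)
      have num: "real_of_int S1 = D * s1" "real_of_int C1 = D * c1" "real_of_int S2 = D * s2" "real_of_int C2 = D * c2"
        "real_of_int S3 = D * s3" "real_of_int J = 500 * D * b3"
        by (simp_all add: s1_def c1_def s2_def c2_def s3_def J D_def)
      have m5: "real_of_int m = 5 * t" by (simp add: t)
      have gen: "125 * ((5 * t)\<^sup>2 * (2855400000 * (5 * (D * s1) - 5 * t * (D * c1)) + 76900000 * (125 * (D * s2) - 37 * (5 * t) * (D * c2)) +
          58119865200 * (D * s3) - 10 ^ 8 * D * u1 - 10 ^ 8 * D * u2) - 3724200000 * (500 * D * b3)) -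
          1000 * D * (5 * t) ^ 5 * (f' - 10 ^ 5) =
        10 ^ 5 * (1000 * D * (5 * t) ^ 5) * (1 + x - f' / 10 ^ 5)"
        if "x = (14277 / 100 * (s1 - t * c1) + 769 / 8 * (s2 - 148 / 100 * t * c2) + 581198652 / 1000000 * s3 - u1 - u2 - 74484 / 100 * b3 / t\<^sup>2) / t ^ 3"
        for f' x :: real
      proof -
        have "x * t ^ 5 = (14277 / 100 * (s1 - t * c1) + 769 / 8 * (s2 - 148 / 100 * t * c2) + 581198652 / 1000000 * s3 - u1 - u2) * t\<^sup>2 - 74484 / 100 * b3"
          using t0 unfolding that by (simp add: field_simps eval_nat_numeral)
        then have x: "(5 * t) ^ 5 * x = 3125 * ((14277 / 100 * (s1 - t * c1) + 769 / 8 * (s2 - 148 / 100 * t * c2) + 581198652 / 1000000 * s3 - u1 - u2) * t\<^sup>2 - 74484 / 100 * b3)"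
          by (simp add: power_mult_distrib mult.commute)
        have "10 ^ 5 * (1000 * D * (5 * t) ^ 5) * (1 + x - f' / 10 ^ 5) = 10 ^ 8 * D * ((5 * t) ^ 5 * x) - 1000 * D * (5 * t) ^ 5 * (f' - 10 ^ 5)"
          by (simp add: algebra_simps)
        moreover have "125 * ((5 * t)\<^sup>2 * (2855400000 * (5 * D * A) + 76900000 * (125 * D * B) +
            58119865200 * (D * s3) - 10 ^ 8 * D * u1 - 10 ^ 8 * D * u2) - 3724200000 * (500 * D * b3)) =
            10 ^ 8 * D * (3125 * ((14277 / 100 * A + 769 / 8 * B + 581198652 / 1000000 * s3 - u1 - u2) * t\<^sup>2 - 74484 / 100 * b3))"
          for A B by (simp add: algebra_simps power2_eq_square)
        moreover have "5 * (D * s1) - 5 * t * (D * c1) = 5 * D * (s1 - t * c1)"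
          "125 * (D * s2) - 37 * (5 * t) * (D * c2) = 125 * D * (s2 - 148 / 100 * t * c2)"
          by (simp_all add: algebra_simps)
        ultimately show ?thesis unfolding x by (simp only:)
      qed
      have "real_of_int M = 1000 * D * (5 * t) ^ 5"
        by (simp add: M_def D_def flip: m5)
      then show ?thesis
        using gen[of "\<tau> / t ^ 3" "of_int f"] unfolding V_def \<tau>_def b1_def b2_def
        by (simp add: iw num flip: m5)
    qed
    have "\<bar>1 + \<tau> / t ^ 3 - of_int f / 10 ^ 5\<bar> = \<bar>real_of_int V\<bar> / (10 ^ 5 * real_of_int M)"
      unfolding V abs_mult using M0 by simp
    also have "\<dots> \<le> 1 / 10 ^ 5" using VM M0 by (simp add: divide_le_eq)
    finally show ?thesis .
  qed
  have "\<bar>1 + x - z\<bar> \<le> 2 / 10 ^ 5" if "\<bar>x - y\<bar> \<le> 9 / 10 ^ 6" "\<bar>1 + y - z\<bar> \<le> 1 / 10 ^ 5" for x y z :: real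
  proof -
    have "\<bar>1 + x - z\<bar> \<le> \<bar>x - y\<bar> + \<bar>1 + y - z\<bar>" by linarith
    also have "\<dots> \<le> 9 / 10 ^ 6 + 1 / 10 ^ 5" using that by (rule add_mono)
    also have "\<dots> \<le> 2 / 10 ^ 5" by simp
    finally show ?thesis .
  qed
  from this[OF 1 2] show ?thesis unfolding F .
qed

text \<open>The three base angles \<open>1 / 5\<close>, \<open>1.48 / 5\<close> and \<open>1.53 / 5\<close> of the table, followed by two
angles with \<open>17 * 0.8973 = 9.97 * 1.53\<close> and \<open>34 * 0.6714 = 14.92 * 1.53\<close>.\<close>
lemma near_2000: "near 2 (2000 / 10 ^ 4) (980066577841242, 198669330795061)"
  using near_taylor[of 2000 980066577841242 198669330795061] by (simp add: cos_num_def sin_num_def)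

lemma near_2960: "near 2 (2960 / 10 ^ 4) (956510924118316, 291696506736584)"
  using near_taylor[of 2960 956510924118316 291696506736584] by (simp add: cos_num_def sin_num_def)

lemma near_3060: "near 2 (3060 / 10 ^ 4) (953546182519130, 301246871856280)"
  using near_taylor[of 3060 953546182519130 301246871856280] by (simp add: cos_num_def sin_num_def)

lemma near_8973: "near 2 (8973 / 10 ^ 4) (623722682589998, 781645709527492)"
  using near_taylor[of 8973 623722682589998 781645709527492] by (simp add: cos_num_def sin_num_def)

lemma near_6714: "near 2 (6714 / 10 ^ 4) (782951517637889, 622082728444157)"
  using near_taylor[of 6714 782951517637889 622082728444157] by (simp add: cos_num_def sin_num_def)

text \<open>Repeated squaring: \<open>17 = 16 + 1\<close>.\<close>
lemma near_edge1: "near 82 (997 / 100 * (153 / 100)) (-898759998619989, 438440947997097)"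
proof -
  have rot: "rot (623722682589998, 781645709527492) (623722682589998, 781645709527492) = (-221940030445474, 975060317562899)" by code_simp
  from near_rot[OF near_8973 near_8973, unfolded rot] have n2: "near 7 (2 * (8973 / 10 ^ 4)) (-221940030445474, 975060317562899)" by simp
  have rot: "rot (-221940030445474, 975060317562899) (-221940030445474, 975060317562899) = (-901485245771724, -432809833132167)" by code_simp
  from near_rot[OF n2 n2, unfolded rot] have n4: "near 17 (4 * (8973 / 10 ^ 4)) (-901485245771724, -432809833132167)" by simp
  have rot: "rot (-901485245771724, -432809833132167) (-901485245771724, -432809833132167) = (625351296688211, 780343357587140)" by code_simp
  from near_rot[OF n4 n4, unfolded rot] have n8: "near 37 (8 * (8973 / 10 ^ 4)) (625351296688211, 780343357587140)" by simp
  have rot: "rot (625351296688211, 780343357587140) (625351296688211, 780343357587140) = (-217871511460745, 975977461058300)" by code_simp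
  from near_rot[OF n8 n8, unfolded rot] have n16: "near 77 (16 * (8973 / 10 ^ 4)) (-217871511460745, 975977461058300)" by simp
  have rot: "rot (-217871511460745, 975977461058300) (623722682589998, 781645709527492) = (-898759998619989, 438440947997097)" by code_simp
  from near_rot[OF n16 near_8973, unfolded rot] show ?thesis by simp
qed

text \<open>Repeated squaring: \<open>34 = 32 + 2\<close>.\<close>
lemma near_edge2: "near 167 (1492 / 100 * (153 / 100)) (-670101039880587, -742269894547108)"
proof -
  have rot: "rot (782951517637889, 622082728444157) (782951517637889, 622082728444157) = (226026157942946, 974121232663343)" by code_simp
  from near_rot[OF near_6714 near_6714, unfolded rot] have n2: "near 7 (2 * (6714 / 10 ^ 4)) (226026157942946, 974121232663343)" by simp
  have rot: "rot (226026157942946, 974121232663343) (226026157942946, 974121232663343) = (-897824351851102, 440353759179084)" by code_simp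
  from near_rot[OF n2 n2, unfolded rot] have n4: "near 17 (4 * (6714 / 10 ^ 4)) (-897824351851102, 440353759179084)" by simp
  have rot: "rot (-897824351851102, 440353759179084) (-897824351851102, 440353759179084) = (612177133553700, -790720656840315)" by code_simp
  from near_rot[OF n4 n4, unfolded rot] have n8: "near 37 (8 * (6714 / 10 ^ 4)) (612177133553700, -790720656840315)" by simp
  have rot: "rot (612177133553700, -790720656840315) (612177133553700, -790720656840315) = (-250478314307955, -968122210292406)" by code_simp
  from near_rot[OF n8 n8, unfolded rot] have n16: "near 77 (16 * (6714 / 10 ^ 4)) (-250478314307955, -968122210292406)" by simp
  have rot: "rot (-250478314307955, -968122210292406) (-250478314307955, -968122210292406) = (-874521228122899, 484987238556266)" by code_simp
  from near_rot[OF n16 n16, unfolded rot] have n32: "near 157 (32 * (6714 / 10 ^ 4)) (-874521228122899, 484987238556266)" by simp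
  have rot: "rot (-874521228122899, 484987238556266) (226026157942946, 974121232663343) = (-670101039880587, -742269894547108)" by code_simp
  from near_rot[OF n32 n2, unfolded rot] show ?thesis by simp
qed

lemma near_double_2000: "near 7 (2 * (2000 / 10 ^ 4)) (921060994002885, 389418342308650)"
proof -
  have rot: "rot (980066577841242, 198669330795061) (980066577841242, 198669330795061) = (921060994002885, 389418342308650)" by code_simp
  from near_rot[OF near_2000 near_2000, unfolded rot] show ?thesis by simp
qed

lemma near_double_2960: "near 7 (2 * (2960 / 10 ^ 4)) (829826295915348, 558021790441389)"
proof -
  have rot: "rot (956510924118316, 291696506736584) (956510924118316, 291696506736584) = (829826295915348, 558021790441389)" by code_simp
  from near_rot[OF near_2960 near_2960, unfolded rot] show ?thesis by simp
qed

lemma near_double_3060: "near 7 (2 * (3060 / 10 ^ 4)) (818500644393612, 574505609308770)"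
proof -
  have rot: "rot (953546182519130, 301246871856280) (953546182519130, 301246871856280) = (818500644393612, 574505609308770)" by code_simp
  from near_rot[OF near_3060 near_3060, unfolded rot] show ?thesis by simp
qed

lemma abs_bessel_perturb:
  fixes x y :: real
  assumes "\<bar>y - y'\<bar> \<le> e" "\<bar>x - x'\<bar> \<le> e" "K \<ge> 0" "L \<ge> 0"
    and "\<bar>K * (x' - L * y') - p\<bar> + K * (e + L * e) \<le> d"
  shows "\<bar>K * (x - L * y) - p\<bar> \<le> d"
proof -
  have "K * (x - L * y) - p = (K * (x' - L * y') - p) + K * ((x - x') - L * (y - y'))"
    by (simp add: algebra_simps)
  then have "\<bar>K * (x - L * y) - p\<bar> \<le> \<bar>K * (x' - L * y') - p\<bar> + K * \<bar>(x - x') - L * (y - y')\<bar>"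
    using abs_triangle_ineq[of "K * (x' - L * y') - p" "K * ((x - x') - L * (y - y'))"] assms(3)
    by (simp add: abs_mult)
  also have "\<bar>(x - x') - L * (y - y')\<bar> \<le> \<bar>x - x'\<bar> + L * \<bar>y - y'\<bar>"
    using abs_triangle_ineq4[of "x - x'" "L * (y - y')"] assms(4) by (simp add: abs_mult)
  also have "\<dots> \<le> e + L * e"
    using assms by (intro add_mono mult_left_mono) auto
  finally show ?thesis using assms(3,5) by (simp add: mult_left_mono)
qed

lemma wave_coeff_bounds:
  shows "\<bar>wave_sin_coeff (997 / 100) (39635 / 10) - 33284814654 / 10 ^ 8\<bar> \<le> 2 / 10 ^ 8"
    and "\<bar>wave_bessel_coeff (997 / 100) (39635 / 10) - 102528803905 / 10 ^ 8\<bar> \<le> 2 / 10 ^ 8"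
    and "\<bar>wave_sin_coeff (1492 / 100) (119401 / 10) - 30778731513 / 10 ^ 8\<bar> \<le> 2 / 10 ^ 8"
    and "\<bar>wave_bessel_coeff (1492 / 100) (119401 / 10) - (- 349423465064) / 10 ^ 8\<bar> \<le> 2 / 10 ^ 8"
proof -
  have s: "wave_sin_coeff a b = 9 * b / (a ^ 3 * (153 / 100)) * (sin (a * (153 / 100)) - a * (153 / 100) * cos (a * (153 / 100)))"
    and j: "wave_bessel_coeff a b = 9 * b / (a * (153 / 100)) * (sin (a * (153 / 100)) - 0 * cos (a * (153 / 100)))" for a b
    by (simp_all add: wave_sin_coeff_def wave_bessel_coeff_def)
  note e1 = near_sin_cos[OF near_edge1] and e2 = near_sin_cos[OF near_edge2]
  show "\<bar>wave_sin_coeff (997 / 100) (39635 / 10) - 33284814654 / 10 ^ 8\<bar> \<le> 2 / 10 ^ 8"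
    unfolding s by (rule abs_bessel_perturb[OF e1]) (simp_all add: power_divide)
  show "\<bar>wave_bessel_coeff (997 / 100) (39635 / 10) - 102528803905 / 10 ^ 8\<bar> \<le> 2 / 10 ^ 8"
    unfolding j by (rule abs_bessel_perturb[OF e1]) simp_all
  show "\<bar>wave_sin_coeff (1492 / 100) (119401 / 10) - 30778731513 / 10 ^ 8\<bar> \<le> 2 / 10 ^ 8"
    unfolding s by (rule abs_bessel_perturb[OF e2]) (simp_all add: power_divide)
  show "\<bar>wave_bessel_coeff (1492 / 100) (119401 / 10) - (- 349423465064) / 10 ^ 8\<bar> \<le> 2 / 10 ^ 8"
    unfolding j by (rule abs_bessel_perturb[OF e2]) simp_all
qed

text \<open>Checks consecutive table entries at \<open>t = m / 5, (m + 2) / 5, ...\<close>. From one to the next the three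
angles advance by \<open>2 / 5\<close> times \<open>1\<close>, \<open>1.48\<close> and \<open>1.53\<close>, hence the constant rotations.\<close>
fun values_ok :: "int \<Rightarrow> int \<times> int \<Rightarrow> int \<times> int \<Rightarrow> int \<times> int \<Rightarrow> int list \<Rightarrow> bool" where
  "values_ok m z1 z2 z3 [] \<longleftrightarrow> True"
| "values_ok m z1 z2 z3 (f # fs) \<longleftrightarrow>
     \<bar>994009 - 400 * m\<^sup>2\<bar> \<ge> 20000 \<and> \<bar>2226064 - 400 * m\<^sup>2\<bar> \<ge> 20000 \<and> value_ok m z1 z2 z3 f \<and>
     values_ok (m + 2) (rot z1 (921060994002885, 389418342308650)) (rot z2 (829826295915348, 558021790441389))
       (rot z3 (818500644393612, 574505609308770)) fs"

text \<open>Each step adds \<open>10\<close> units of rounding error, \<open>7\<close> from the rotation and \<open>3\<close> from the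
multiplication, which leaves room for almost a hundred entries below \<open>1000\<close>.\<close>
lemma values_ok_imp:
  assumes "values_ok m z1 z2 z3 fs" "m \<ge> 1" "i < length fs"
    and "near k (real_of_int m / 5) z1" "near k (148 / 100 * (real_of_int m / 5)) z2"
      "near k (real_of_int m / 5 * (153 / 100)) z3"
    and "0 \<le> k" "k + 10 * real (length fs) \<le> 1000"
  shows "\<bar>dual_ft (real_of_int (m + 2 * int i) / 5) - of_int (fs ! i) / 10 ^ 5\<bar> \<le> 2 / 10 ^ 5"
  using assms
proof (induction fs arbitrary: m z1 z2 z3 i k)
  case (Cons f fs)
  have mono: "near 1000 \<theta> z" if "near k \<theta> z" for \<theta> z
    using that Cons.prems(8) by (simp add: near_def)
  have step: "near (k + 10) (\<theta> + 2 * \<phi>) (rot z w)" if "near k \<theta> z" "near 7 (2 * \<phi>) w" for \<theta> \<phi> z w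
    using near_rot[OF that] Cons.prems(7,8) by (simp add: add.commute)
  show ?case
  proof (cases i)
    case 0
    have "\<bar>dual_ft (real_of_int m / 5) - of_int f / 10 ^ 5\<bar> \<le> 2 / 10 ^ 5"
      using Cons.prems(1) by (intro value_ok_imp[OF _ Cons.prems(2) refl _ _ mono[OF Cons.prems(4)]
        mono[OF Cons.prems(5)] mono[OF Cons.prems(6)] wave_coeff_bounds]) auto
    then show ?thesis by (simp add: 0)
  next
    case (Suc j)
    have 1: "near (k + 10) (real_of_int (m + 2) / 5) (rot z1 (921060994002885, 389418342308650))"
    proof -
      have eq: "real_of_int (m + 2) / 5 = real_of_int m / 5 + 2 * (2000 / 10 ^ 4)"
        by (simp add: field_simps)
      show ?thesis unfolding eq by (rule step[OF Cons.prems(4) near_double_2000])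
    qed
    have 2: "near (k + 10) (148 / 100 * (real_of_int (m + 2) / 5)) (rot z2 (829826295915348, 558021790441389))"
    proof -
      have eq: "148 / 100 * (real_of_int (m + 2) / 5) = 148 / 100 * (real_of_int m / 5) + 2 * (2960 / 10 ^ 4)"
        by (simp add: field_simps)
      show ?thesis unfolding eq by (rule step[OF Cons.prems(5) near_double_2960])
    qed
    have 3: "near (k + 10) (real_of_int (m + 2) / 5 * (153 / 100)) (rot z3 (818500644393612, 574505609308770))"
    proof -
      have eq: "real_of_int (m + 2) / 5 * (153 / 100) = real_of_int m / 5 * (153 / 100) + 2 * (3060 / 10 ^ 4)"
        by (simp add: field_simps)
      show ?thesis unfolding eq by (rule step[OF Cons.prems(6) near_double_3060])
    qed
    have "\<bar>dual_ft (real_of_int (m + 2 + 2 * int j) / 5) - of_int (fs ! j) / 10 ^ 5\<bar> \<le> 2 / 10 ^ 5"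
      by (rule Cons.IH[OF _ _ _ 1 2 3]) (use Cons.prems Suc in auto)
    then show ?thesis by (simp add: Suc algebra_simps)
  qed
qed simp

text \<open>The values of \<open>dual_ft\<close> at \<open>1 / 5, 3 / 5, ..., 23\<close>, in units of \<open>10 ^ (- 5)\<close>.\<close>
definition dual_table :: "int list" where
  "dual_table = [2419, 2407, 2356, 2232, 2008, 1688, 1312, 944, 654, 488, 453, 511,
     603, 669, 683, 661, 658, 738, 938, 1243, 1575, 1821, 1878, 1701,
     1338, 926, 639, 619, 897, 1359, 1776, 1906, 1649, 1193, 1103, 2284,
     5810, 12623, 23196, 37250, 53624, 70397, 85242, 95966, 101091, 100324, 94753, 86681,
     79117, 75016, 76483, 84143, 96882, 112048, 126083, 135441, 137539, 131491]"

lemma values_ok_table: "values_ok 1 (980066577841242, 198669330795061) (956510924118316, 291696506736584) (953546182519130, 301246871856280) dual_table"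
  by code_simp

lemma dual_table_correct:
  assumes "i < 58"
  shows "\<bar>dual_ft ((2 * real i + 1) / 5) - of_int (dual_table ! i) / 10 ^ 5\<bar> \<le> 2 / 10 ^ 5"
proof -
  have "length dual_table = 58" by (simp add: dual_table_def)
  then show ?thesis
    using values_ok_imp[OF values_ok_table, of i 2] near_2000 near_2960 near_3060 assms
    by (simp add: add.commute)
qed

section \<open>Positivity for small frequencies\<close>

text \<open>An error of \<open>2 * 10 ^ (- 5)\<close> in the values changes a Bernstein coefficient by at most
\<open>1.475 * 2 * 10 ^ (- 5)\<close>, the largest absolute row sum being \<open>1770 / 1200\<close>. This fits between
\<open>0.0034\<close> and \<open>0.003305\<close>.\<close>
lemma interp6_bound_below:
  assumes s: "0 \<le> s" "s \<le> 1"
    and v: "\<And>j. j < 6 \<Longrightarrow> \<bar>v j - x j\<bar> \<le> 2 / 10 ^ 5"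
    and "x 2 \<ge> 340 / 10 ^ 5" "x 3 \<ge> 340 / 10 ^ 5"
    and "12 * x 0 - 120 * x 1 + 1120 * x 2 + 240 * x 3 - 60 * x 4 + 8 * x 5 \<ge> 408000 / 10 ^ 5"
    and "19 * x 0 - 160 * x 1 + 890 * x 2 + 560 * x 3 - 125 * x 4 + 16 * x 5 \<ge> 408000 / 10 ^ 5"
    and "16 * x 0 - 125 * x 1 + 560 * x 2 + 890 * x 3 - 160 * x 4 + 19 * x 5 \<ge> 408000 / 10 ^ 5"
    and "8 * x 0 - 60 * x 1 + 240 * x 2 + 1120 * x 3 - 120 * x 4 + 12 * x 5 \<ge> 408000 / 10 ^ 5"
  shows "interp6 v s \<ge> 3305 / 10 ^ 6"
proof -
  let ?b = "3305 / 10 ^ 6 :: real"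
  have "(0::nat) < 6" "(1::nat) < 6" "(2::nat) < 6" "(3::nat) < 6" "(4::nat) < 6" "(5::nat) < 6" by simp_all
  note w = this[THEN v]
  note w = w[THEN abs_le_D1] w[THEN abs_le_D2]
  have c: "v 2 \<ge> ?b" "v 3 \<ge> ?b"
    "(12 * v 0 - 120 * v 1 + 1120 * v 2 + 240 * v 3 - 60 * v 4 + 8 * v 5) / 1200 \<ge> ?b"
    "(19 * v 0 - 160 * v 1 + 890 * v 2 + 560 * v 3 - 125 * v 4 + 16 * v 5) / 1200 \<ge> ?b"
    "(16 * v 0 - 125 * v 1 + 560 * v 2 + 890 * v 3 - 160 * v 4 + 19 * v 5) / 1200 \<ge> ?b"
    "(8 * v 0 - 60 * v 1 + 240 * v 2 + 1120 * v 3 - 120 * v 4 + 12 * v 5) / 1200 \<ge> ?b"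
    using w assms(4-9) by (simp_all add: le_divide_eq)
  have "?b = (1 - s) ^ 5 * ?b + 5 * s * (1 - s) ^ 4 * ?b + 10 * s ^ 2 * (1 - s) ^ 3 * ?b
     + 10 * s ^ 3 * (1 - s) ^ 2 * ?b + 5 * s ^ 4 * (1 - s) * ?b + s ^ 5 * ?b"
  proof -
    have "c = (1 - s) ^ 5 * c + 5 * s * (1 - s) ^ 4 * c + 10 * s ^ 2 * (1 - s) ^ 3 * c
      + 10 * s ^ 3 * (1 - s) ^ 2 * c + 5 * s ^ 4 * (1 - s) * c + s ^ 5 * c" for c
      by (simp add: eval_nat_numeral algebra_simps)
    then show ?thesis .
  qed
  also have "\<dots> \<le> interp6 v s"
    unfolding interp6_def using s by (intro add_mono mult_left_mono c) auto
  finally show ?thesis .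
qed

text \<open>All Bernstein coefficients of the quintic through six consecutive table values are at least
\<open>340\<close>; the last four conditions are multiplied by \<open>1200\<close>.\<close>
definition cell_ok :: "int \<Rightarrow> int \<Rightarrow> int \<Rightarrow> int \<Rightarrow> int \<Rightarrow> int \<Rightarrow> bool" where
  "cell_ok a b c d e f \<longleftrightarrow> c \<ge> 340 \<and> d \<ge> 340 \<and>
     12 * a - 120 * b + 1120 * c + 240 * d - 60 * e + 8 * f \<ge> 408000 \<and>
     19 * a - 160 * b + 890 * c + 560 * d - 125 * e + 16 * f \<ge> 408000 \<and>
     16 * a - 125 * b + 560 * c + 890 * d - 160 * e + 19 * f \<ge> 408000 \<and>
     8 * a - 60 * b + 240 * c + 1120 * d - 120 * e + 12 * f \<ge> 408000"

fun cells_ok :: "int list \<Rightarrow> bool" where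
  "cells_ok (a # b # c # d # e # f # xs) \<longleftrightarrow> cell_ok a b c d e f \<and> cells_ok (b # c # d # e # f # xs)"
| "cells_ok xs \<longleftrightarrow> True"

lemma cells_ok_nth:
  assumes "cells_ok xs" "n + 5 < length xs"
  shows "cell_ok (xs ! n) (xs ! (n + 1)) (xs ! (n + 2)) (xs ! (n + 3)) (xs ! (n + 4)) (xs ! (n + 5))"
  using assms
proof (induction n arbitrary: xs)
  case 0
  then show ?case by (cases xs rule: cells_ok.cases) simp_all
next
  case (Suc n)
  have "cells_ok ys \<Longrightarrow> cells_ok (tl ys)" for ys
    by (cases ys rule: cells_ok.cases) simp_all
  then have "cells_ok (tl xs)" using Suc.prems(1) .
  moreover have "n + 5 < length (tl xs)" using Suc.prems(2) by simp
  moreover have "tl xs ! k = xs ! Suc k" for k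
    using Suc.prems(2) by (cases xs) simp_all
  ultimately show ?case using Suc.IH[of "tl xs"] by simp
qed

text \<open>The transform is even, so the first three values continue the table to negative frequencies and
the first cell \<open>[-1 / 5, 1 / 5]\<close> has nodes on both sides.\<close>
lemma cells_ok_table: "cells_ok ([2356, 2407, 2419] @ dual_table)"
  by code_simp

lemma dual_ft_minus: "dual_ft (- t) = dual_ft t"
  using sphere_ft_minus[of t] sphere_ft_minus[of "148 / 100 * t"] sphere_ft_minus[of "t * r" for r]
  by (simp add: dual_ft_def)

lemma dual_table_extended:
  assumes "k < 61"
  shows "\<bar>dual_ft ((2 * real k - 5) / 5) - of_int (([2356, 2407, 2419] @ dual_table) ! k) / 10 ^ 5\<bar> \<le> 2 / 10 ^ 5"
proof -
  consider "k = 0" | "k = 1" | "k = 2" | i where "k = i + 3" "i < 58"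
  proof -
    have "k = 0 \<or> k = 1 \<or> k = 2 \<or> (k = (k - 3) + 3 \<and> k - 3 < 58)" using assms by arith
    then show ?thesis using that by blast
  qed
  then show ?thesis
  proof cases
    case 1
    then show ?thesis using dual_table_correct[of 2] dual_ft_minus[of 1] by (simp add: dual_table_def)
  next
    case 2
    then show ?thesis using dual_table_correct[of 1] dual_ft_minus[of "3 / 5"] by (simp add: dual_table_def)
  next
    case 3
    then show ?thesis using dual_table_correct[of 0] dual_ft_minus[of "1 / 5"] by (simp add: dual_table_def)
  next
    case 4
    then show ?thesis using dual_table_correct[of i] by (simp add: add.commute)
  qed
qed

text \<open>In each of the \<open>56\<close> grid cells that cover \<open>[0, 22]\<close> the interpolating quintic is at least as large as
its distance from the transform.\<close>
lemma dual_ft_nonneg_small: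
  assumes t: "0 \<le> t" "t \<le> 22"
  shows "dual_ft t \<ge> 0"
proof -
  \<comment> \<open>The cell of \<open>t\<close> is \<open>[a, a + 2 / 5]\<close>, and \<open>s\<close> is the relative position of \<open>t\<close> in it.\<close>
  define n where "n = nat \<lfloor>(5 * t + 1) / 2\<rfloor>"
  define s where "s = (5 * t + 1) / 2 - real n"
  have n: "real n = of_int \<lfloor>(5 * t + 1) / 2\<rfloor>" using t by (simp add: n_def)
  have s: "0 \<le> s" "s \<le> 1" unfolding s_def n by linarith+
  have "real n < 56" using s(1) t by (simp add: s_def field_simps)
  then have n55: "n \<le> 55" by linarith
  define xs where "xs = [2356, 2407, 2419] @ dual_table"
  define a where "a = (2 * real n - 1) / 5"
  have len: "n + 5 < length xs" using n55 by (simp add: xs_def dual_table_def)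
  note c = cells_ok_nth[OF cells_ok_table[folded xs_def] len, unfolded cell_ok_def]
  have le: "real_of_int k / 10 ^ 5 \<le> real_of_int m / 10 ^ 5" if "k \<le> m" for k m
    using that by (simp add: divide_right_mono)
  note c = c[THEN conjunct1, THEN le] c[THEN conjunct2, THEN conjunct1, THEN le]
    c[THEN conjunct2, THEN conjunct2, THEN conjunct1, THEN le]
    c[THEN conjunct2, THEN conjunct2, THEN conjunct2, THEN conjunct1, THEN le]
    c[THEN conjunct2, THEN conjunct2, THEN conjunct2, THEN conjunct2, THEN conjunct1, THEN le]
    c[THEN conjunct2, THEN conjunct2, THEN conjunct2, THEN conjunct2, THEN conjunct2, THEN le]
  have "interp6 (\<lambda>j. dual_ft (a + 2 / 5 * (real j - 2))) s \<ge> 3305 / 10 ^ 6"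
  proof (rule interp6_bound_below[OF s, where x = "\<lambda>j. real_of_int (xs ! (n + j)) / 10 ^ 5"])
    fix j :: nat assume "j < 6"
    then have "\<bar>dual_ft ((2 * real (n + j) - 5) / 5) - of_int (xs ! (n + j)) / 10 ^ 5\<bar> \<le> 2 / 10 ^ 5"
      using n55 unfolding xs_def by (intro dual_table_extended) auto
    moreover have "(2 * real (n + j) - 5) / 5 = a + 2 / 5 * (real j - 2)"
      by (simp add: a_def field_simps)
    ultimately show "\<bar>dual_ft (a + 2 / 5 * (real j - 2)) - of_int (xs ! (n + j)) / 10 ^ 5\<bar> \<le> 2 / 10 ^ 5"
      by (simp only:)
  qed (use c in \<open>simp_all add: add_divide_distrib diff_divide_distrib\<close>)
  with dual_ft_interp_error[OF s, of a] have "dual_ft (a + 2 / 5 * s) \<ge> 0" by linarith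
  moreover have "a + 2 / 5 * s = t" by (simp add: a_def s_def field_simps)
  ultimately show ?thesis by simp
qed

section \<open>The bound\<close>

theorem theorem7p2:
  fixes r :: real
  assumes "r > 0"
  shows "cohn_elkies_bound TYPE(5) r > ereal 0.09826308"
proof -
  have dual: "dual_ft t \<ge> 0" if "t \<ge> 0" for t
    using that dual_ft_nonneg_small dual_ft_nonneg_large by (cases "t \<le> 22") auto
  have "pi\<^sup>2 < (31416 / 10000)\<^sup>2"
    using pi_bounds by (intro power_strict_mono) auto
  then have "0.09826308 < 3 / (8 * pi\<^sup>2) * (8276 / 100) / 32"
    by (simp add: field_simps power2_eq_square)
  then have "ereal 0.09826308 < ereal (3 / (8 * pi\<^sup>2) * (8276 / 100) / 32)" by simp
  also have "\<dots> \<le> cohn_elkies_bound TYPE(5) r"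
    unfolding cohn_elkies_bound_def
    using admissible_lower_bound[OF \<open>r > 0\<close> _ dual tail_nonneg[OF pi_bounds]] by (intro INF_greatest) simp
  finally show ?thesis .
qed

end
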